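(* Assume $m\ge 1$. For all integers $j,k\ge 0$ and every scalar-valued spherical harmonic $H_k\in\mathcal H_k$ (i.e. $H_k\in\mathbb C[x_1,\dots,x_m]\otimes\Lambda_{2n}$), let $\widetilde\psi_{j,k}(x)=\partial_x^{2j}\left(H_k(x)\exp(x^2/2)\right)$. Then $$\mathcal R_{m|2n}(\widetilde\psi_{j,k})(\omega,p)=(-1)^j(2\pi)^{\frac{M-1}{2}}\,\widetilde H_{2j+k}(p)\,\exp(-p^2/2)\,H_k(\omega),$$ where $\widetilde H_t(p)=(-1)^t e^{p^2/2}\frac{d^t}{dp^t}e^{-p^2/2}$ is the classical Hermite polynomial of degree $t$, and the identity holds modulo the relation $\omega^2=-1$.
   Context: Let $m\ge 1$, $n\ge 0$ be integers and $M=m-2n$. Let $x_1,\dots,x_m$ be commuting real variables and $\grave x_1,\dots,\grave x_{2n}$ anti-commuting variables, with $x_i\grave x_j=\grave x_jx_i$; $\Lambda_{2n}$ is the Grassmann algebra (complex coefficients) generated by the $\grave x_j$. $\mathcal C$ is the complex unital associative algebra generated by $e_1,\dots,e_m,\grave e_1,\dots,\grave e_{2n}$ with relations $e_je_k+e_ke_j=-2\delta_{jk}$, $\grave e_{2j}\grave e_{2k}-\grave e_{2k}\grave e_{2j}=0$, $\grave e_{2j-1}\grave e_{2k-1}-\grave e_{2k-1}\grave e_{2j-1}=0$, $\grave e_{2j-1}\grave e_{2k}-\grave e_{2k}\grave e_{2j-1}=\delta_{jk}$, $e_j\grave e_k+\grave e_ke_j=0$; all generators of $\mathcal C$ commute with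 all variables. Further sets of variables $y_i,\grave y_j$ and $\omega_i,\grave\omega_j$ of the same type are used; all anti-commuting variables anti-commute with each other. $\partial_{\grave x_j}$ is the left derivative. $\mathcal S(\mathbb R^m)_{m|2n}=\mathcal S(\mathbb R^m)\otimes\Lambda_{2n}\otimes\mathcal C$. $x^2=\sum_{j=1}^n\grave x_{2j-1}\grave x_{2j}-\sum_{j=1}^m x_j^2$ (similarly $\omega^2$). $\partial_x=2\sum_{j=1}^n(\grave e_{2j}\partial_{\grave x_{2j-1}}-\grave e_{2j-1}\partial_{\grave x_{2j}})-\sum_{j=1}^m e_j\partial_{x_j}$ and $\Delta=\partial_x^2=4\sum_{j=1}^n\partial_{\grave x_{2j-1}}\partial_{\grave x_{2j}}-\sum_{j=1}^m\partial_{x_j}^2$. With $\mathbb E=\sum_jx_j\partial_{x_j}+\sum_j\grave x_j\partial_{\grave x_j}$, $\mathcal H_k$ is the space of polynomials $H\in\mathbb C[x_1,\dots,x_m]\otimes\Lambda_{2n}\otimes\mathcal C$ with $\Delta H=0$ and $\mathbb EH=kH$. $\langle x,y\rangle=-\sum_{i=1}^m x_iy_i+\frac12\sum_{j=1}^n(\grave x_{2j-1}\grave y_{2j}-\grave x_{2j}\grave y_{2j-1})$; $\int_{B,x}=\pi^{-n}\partial_{\grave x_{2n}}\cdots\partial_{\grave x_1}$; $$\mathcal F^{-}_{m|2n}(f)(y)=(2\pi)^{-M/2}\int_{\mathbb R^m}dV(\underline x)\int_{B,x}\exp(i\langle x,y\rangle)f(x).$$ Super Radon transform of $f\in\mathcal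 S(\mathbb R^m)_{m|2n}$ (for $m\ne0$): $$\mathcal R_{m|2n}(f)(\omega,p)=(2\pi)^{\frac M2-1}\int_{-\infty}^{\infty}e^{ipr}\left[\mathcal F^-_{m|2n}(f)(r\omega)\bmod \omega^2+1\right]dr,\qquad p\in\mathbb R,$$ where $\mathcal F^-(f)(r\omega)$ is obtained by substituting $y_i=r\omega_i$, $\grave y_j=r\grave\omega_j$, and "mod $\omega^2+1$" means working modulo the ideal generated by $\omega^2+1$, i.e. with $\omega$ on the super-sphere $\omega^2=\sum_j\grave\omega_{2j-1}\grave\omega_{2j}-\sum_j\omega_j^2=-1$. Concretely, $\mathcal R_{m|2n}(f)$ is the class of $(2\pi)^{M/2-1}\int_{-\infty}^\infty e^{ipr}\mathcal F^-_{m|2n}(f)(r\omega)\,dr$ (coefficientwise, for $(\omega_1,\dots,\omega_m)\in\mathbb R^m\setminus\{0\}$) in the quotient of $C^\infty((\mathbb R^m\setminus\{0\})\times\mathbb R)\otimes\Lambda_{2n}\otimes\mathcal C$ by the ideal generated by $\omega^2+1$. *)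

theory Defs
  imports "HOL-Analysis.Analysis" "HOL-Library.Function_Algebras"
begin

text \<open>
  Sums, differences and \<open>0\<close> of functions are pointwise (\<^theory>\<open>HOL-Library.Function_Algebras\<close>).
  The dimension \<open>m \<ge> 1\<close> is the cardinality of the finite index type \<open>'m\<close>; \<open>n\<close> is a natural number,
  possibly \<open>0\<close>.
\<close>

subsection \<open>Grassmann algebras\<close>

text \<open>
  A Grassmann element is its family of coefficients: the coefficient at a finite set \<open>S\<close> belongs to
  the product, in increasing order of the indices, of the generators with index in \<open>S\<close>.
  The elements of \<open>\<Lambda>\<^sub>2\<^sub>n\<close> are the families supported on the subsets of \<open>{1..2*n}\<close>.
\<close>

type_synonym grass = "nat set \<Rightarrow> complex"

definition reorder_sign :: "nat set \<Rightarrow> nat set \<Rightarrow> complex" where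
  "reorder_sign A B = (-1) ^ card {(a, b). a \<in> A \<and> b \<in> B \<and> b < a}"

definition gmul :: "grass \<Rightarrow> grass \<Rightarrow> grass" where
  "gmul a b = (\<lambda>S. \<Sum>A\<in>Pow S. reorder_sign A (S - A) * a A * b (S - A))"

definition gconst :: "complex \<Rightarrow> grass" where
  "gconst c = (\<lambda>S. if S = {} then c else 0)"

definition ggen :: "nat \<Rightarrow> grass" where
  "ggen v = (\<lambda>S. if S = {v} then 1 else 0)"

definition gscale :: "complex \<Rightarrow> grass \<Rightarrow> grass" where
  "gscale c a = (\<lambda>S. c * a S)"

primrec gpow :: "grass \<Rightarrow> nat \<Rightarrow> grass" where
  "gpow a 0 = gconst 1"
| "gpow a (Suc k) = gmul a (gpow a k)"

text \<open>
  Exponential of the scalar part times the exponential series of the nilpotent part. The \<open>k\<close>-th power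
  of the nilpotent part has no coefficient at sets with fewer than \<open>k\<close> elements.
\<close>

definition gexp :: "grass \<Rightarrow> grass" where
  "gexp a = (\<lambda>S. exp (a {}) * (\<Sum>k\<le>card S. gpow (a - gconst (a {})) k S / fact k))"

text \<open>Left derivative: the sign comes from moving the generator \<open>v\<close> to the front.\<close>

definition gderiv :: "nat \<Rightarrow> grass \<Rightarrow> grass" where
  "gderiv v a = (\<lambda>S. if v \<in> S then 0 else (-1) ^ card {u \<in> S. u < v} * a (insert v S))"

text \<open>\<open>fold\<close> applies the derivative with respect to the first generator first.\<close>

definition berezin :: "nat \<Rightarrow> grass \<Rightarrow> grass" where
  "berezin n a = gscale (1 / of_real pi ^ n) (fold gderiv [1..<2 * n + 1] a)"

subsection \<open>Scalar superfunctions on \<open>\<real>\<^sup>m\<close>\<close>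

definition superdim :: "'m::finite itself \<Rightarrow> nat \<Rightarrow> int" where
  "superdim _ n = int CARD('m) - 2 * int n"

definition pderiv_x :: "'m::finite \<Rightarrow> (real^'m \<Rightarrow> grass) \<Rightarrow> real^'m \<Rightarrow> grass" where
  "pderiv_x i f = (\<lambda>x S. vector_derivative (\<lambda>t. f (x + t *\<^sub>R axis i 1) S) (at 0))"

definition pderiv_g :: "nat \<Rightarrow> ('p \<Rightarrow> grass) \<Rightarrow> 'p \<Rightarrow> grass" where
  "pderiv_g v f = (\<lambda>x. gderiv v (f x))"

definition super_square :: "nat \<Rightarrow> real^'m::finite \<Rightarrow> grass" where
  "super_square n x =
     (\<Sum>j=1..n. gmul (ggen (2*j - 1)) (ggen (2*j))) - gconst (\<Sum>i\<in>UNIV. of_real ((x $ i)\<^sup>2))"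

definition laplace :: "nat \<Rightarrow> (real^'m::finite \<Rightarrow> grass) \<Rightarrow> real^'m \<Rightarrow> grass" where
  "laplace n f = (\<lambda>x S.
     4 * (\<Sum>j=1..n. pderiv_g (2*j - 1) (pderiv_g (2*j) f) x S)
     - (\<Sum>i\<in>UNIV. pderiv_x i (pderiv_x i f) x S))"

definition euler_op :: "nat \<Rightarrow> (real^'m::finite \<Rightarrow> grass) \<Rightarrow> real^'m \<Rightarrow> grass" where
  "euler_op n f = (\<lambda>x S.
     (\<Sum>i\<in>UNIV. of_real (x $ i) * pderiv_x i f x S)
     + (\<Sum>j=1..2*n. gmul (ggen j) (pderiv_g j f x) S))"

text \<open>The scalar-valued elements of \<open>\<H>\<^sub>k\<close>, as polynomial functions on \<open>\<real>\<^sup>m\<close> with values in \<open>\<Lambda>\<^sub>2\<^sub>n\<close>.\<close>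

definition spherical_harmonic :: "nat \<Rightarrow> nat \<Rightarrow> (real^'m::finite \<Rightarrow> grass) \<Rightarrow> bool" where
  "spherical_harmonic n k H \<longleftrightarrow>
     (\<forall>S. polynomial_function (\<lambda>x. H x S)) \<and>
     (\<forall>x S. \<not> S \<subseteq> {1..2*n} \<longrightarrow> H x S = 0) \<and>
     laplace n H = 0 \<and>
     euler_op n H = (\<lambda>x S. of_nat k * H x S)"

subsection \<open>Fourier and Radon transform of scalar superfunctions\<close>

text \<open>
  In the Grassmann algebra generated by both sets of anti-commuting variables, the variable
  \<open>\<grave>x\<^sub>j\<close> has index \<open>j\<close> and \<open>\<grave>y\<^sub>j\<close> has index \<open>2*n + j\<close>, for \<open>j\<close> in \<open>{1..2*n}\<close>.
\<close>

definition super_pairing :: "nat \<Rightarrow> real^'m::finite \<Rightarrow> real^'m \<Rightarrow> grass" where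
  "super_pairing n x y =
     - gconst (\<Sum>i\<in>UNIV. of_real (x $ i * y $ i))
     + gscale (1/2) (\<Sum>j=1..n. gmul (ggen (2*j - 1)) (ggen (2*n + 2*j))
                            - gmul (ggen (2*j)) (ggen (2*n + (2*j - 1))))"

text \<open>After integration only the variables \<open>\<grave>y\<^sub>j\<close> are left; they are given the index \<open>j\<close> again.\<close>

definition super_fourier :: "nat \<Rightarrow> (real^'m::finite \<Rightarrow> grass) \<Rightarrow> real^'m \<Rightarrow> grass" where
  "super_fourier n f = (\<lambda>y S.
     of_real ((2 * pi) powr (- of_int (superdim TYPE('m) n) / 2)) *
     (\<integral>x. berezin n (gmul (gexp (gscale \<i> (super_pairing n x y))) (f x)) ((\<lambda>j. 2*n + j) ` S) \<partial>lborel))"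

text \<open>
  A representative of the Radon transform, before passing to the quotient by \<open>\<omega>\<^sup>2 + 1\<close>. Substituting
  \<open>\<grave>y\<^sub>j = r \<grave>\<omega>\<^sub>j\<close> multiplies the coefficient at \<open>S\<close> by \<open>r ^ card S\<close>.
\<close>

definition radon_scalar :: "nat \<Rightarrow> (real^'m::finite \<Rightarrow> grass) \<Rightarrow> (real^'m) \<times> real \<Rightarrow> grass" where
  "radon_scalar n f = (\<lambda>(\<omega>, p) S.
     of_real ((2 * pi) powr (of_int (superdim TYPE('m) n) / 2 - 1)) *
     (\<integral>r. exp (\<i> * of_real (p * r)) * (of_real r ^ card S * super_fourier n f (r *\<^sub>R \<omega>) S) \<partial>lborel))"

subsection \<open>Superfunctions with values in \<open>\<C>\<close>\<close>

text \<open>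
  \<open>\<C>\<close> is the quotient of the free algebra on the generators \<open>e\<^sub>i\<close> and \<open>\<grave>e\<^sub>j\<close> by the two-sided ideal of
  the defining relations, so the tensor product of \<open>\<C>\<close> with a function space is a quotient of the
  noncommutative polynomials in the generators with coefficients in that space. Such a polynomial
  is the map sending each word to its coefficient. All operators below act on these representatives
  (coefficientwise, or by left multiplication with a generator, and hence compatibly with the
  relations); the relations are divided out in \<open>sphere_ideal\<close>.
\<close>

datatype 'm cgen = Gen_e 'm | Gen_eg nat

type_synonym ('m, 'p) cfun = "'m cgen list \<Rightarrow> 'p \<Rightarrow> grass"

definition scalar_cfun :: "('p \<Rightarrow> grass) \<Rightarrow> ('m, 'p) cfun" where
  "scalar_cfun f = (\<lambda>w. if w = [] then f else 0)"

definition coeffwise :: "(('p \<Rightarrow> grass) \<Rightarrow> 'q \<Rightarrow> grass) \<Rightarrow> ('m, 'p) cfun \<Rightarrow> ('m, 'q) cfun" where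
  "coeffwise D F = (\<lambda>w. D (F w))"

definition left_gen :: "'m cgen \<Rightarrow> ('m, 'p) cfun \<Rightarrow> ('m, 'p) cfun" where
  "left_gen g F = (\<lambda>w. case w of [] \<Rightarrow> 0 | h # v \<Rightarrow> if h = g then F v else 0)"

definition dirac :: "nat \<Rightarrow> ('m::finite, real^'m) cfun \<Rightarrow> ('m, real^'m) cfun" where
  "dirac n F = (\<lambda>w x S.
     2 * (\<Sum>j=1..n. left_gen (Gen_eg (2*j)) (coeffwise (pderiv_g (2*j - 1)) F) w x S
                 - left_gen (Gen_eg (2*j - 1)) (coeffwise (pderiv_g (2*j)) F) w x S)
     - (\<Sum>i\<in>UNIV. left_gen (Gen_e i) (coeffwise (pderiv_x i) F) w x S))"

definition radon :: "nat \<Rightarrow> ('m::finite, real^'m) cfun \<Rightarrow> ('m, (real^'m) \<times> real) cfun" where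
  "radon n F = coeffwise (radon_scalar n) F"

definition psi :: "nat \<Rightarrow> nat \<Rightarrow> (real^'m::finite \<Rightarrow> grass) \<Rightarrow> ('m, real^'m) cfun" where
  "psi n j H =
     (dirac n ^^ (2*j)) (scalar_cfun (\<lambda>x. gmul (H x) (gexp (gscale (1/2) (super_square n x)))))"

subsection \<open>Working modulo \<open>\<omega>\<^sup>2 + 1\<close>\<close>

primrec Ck_on :: "nat \<Rightarrow> 'a::euclidean_space set \<Rightarrow> ('a \<Rightarrow> 'b::real_normed_vector) \<Rightarrow> bool" where
  "Ck_on 0 U f \<longleftrightarrow> continuous_on U f"
| "Ck_on (Suc k) U f \<longleftrightarrow>
     (\<forall>x\<in>U. f differentiable at x) \<and> (\<forall>b\<in>Basis. Ck_on k U (\<lambda>x. frechet_derivative f (at x) b))"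

definition smooth_on :: "'a::euclidean_space set \<Rightarrow> ('a \<Rightarrow> 'b::real_normed_vector) \<Rightarrow> bool" where
  "smooth_on U f \<longleftrightarrow> (\<forall>k. Ck_on k U f)"

definition radon_domain :: "((real^'m::finite) \<times> real) set" where
  "radon_domain = (UNIV - {0}) \<times> UNIV"

text \<open>
  Representatives of the elements of the tensor product of the smooth functions on \<open>radon_domain\<close>
  with \<open>\<Lambda>\<^sub>2\<^sub>n\<close> and \<open>\<C>\<close>. Values outside \<open>radon_domain\<close> are irrelevant.
\<close>

definition smooth_cfun :: "nat \<Rightarrow> ('m::finite, (real^'m) \<times> real) cfun set" where
  "smooth_cfun n = {F.
     finite {w. F w \<noteq> 0} \<and>
     (\<forall>w. F w \<noteq> 0 \<longrightarrow> set w \<subseteq> range Gen_e \<union> Gen_eg ` {1..2*n}) \<and>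
     (\<forall>w z S. \<not> S \<subseteq> {1..2*n} \<longrightarrow> F w z S = 0) \<and>
     (\<forall>w S. smooth_on radon_domain (\<lambda>z. F w z S))}"

definition cmul :: "('m, 'p) cfun \<Rightarrow> ('m, 'p) cfun \<Rightarrow> ('m, 'p) cfun" where
  "cmul F G = (\<lambda>w z. \<Sum>i\<le>length w. gmul (F (take i w) z) (G (drop i w) z))"

definition word_cfun :: "complex \<Rightarrow> 'm cgen list \<Rightarrow> ('m, 'p) cfun" where
  "word_cfun c u = (\<lambda>w z. if w = u then gconst c else 0)"

definition clifford_weyl_relations :: "nat \<Rightarrow> ('m, 'p) cfun set" where
  "clifford_weyl_relations n =
     {word_cfun 1 [Gen_e i, Gen_e l] + word_cfun 1 [Gen_e l, Gen_e i] + word_cfun (if i = l then 2 else 0) [] | i l. True} \<union>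
     {word_cfun 1 [Gen_eg (2*j), Gen_eg (2*k)] - word_cfun 1 [Gen_eg (2*k), Gen_eg (2*j)]
       | j k. j \<in> {1..n} \<and> k \<in> {1..n}} \<union>
     {word_cfun 1 [Gen_eg (2*j - 1), Gen_eg (2*k - 1)] - word_cfun 1 [Gen_eg (2*k - 1), Gen_eg (2*j - 1)]
       | j k. j \<in> {1..n} \<and> k \<in> {1..n}} \<union>
     {word_cfun 1 [Gen_eg (2*j - 1), Gen_eg (2*k)] - word_cfun 1 [Gen_eg (2*k), Gen_eg (2*j - 1)]
         - word_cfun (if j = k then 1 else 0) []
       | j k. j \<in> {1..n} \<and> k \<in> {1..n}} \<union>
     {word_cfun 1 [Gen_e i, Gen_eg k] + word_cfun 1 [Gen_eg k, Gen_e i] | i k. k \<in> {1..2*n}}"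

text \<open>
  Dividing the representatives by this two-sided ideal is the same as first dividing by the relations
  of \<open>\<C>\<close> and then by the ideal generated by \<open>\<omega>\<^sup>2 + 1\<close>.
\<close>

inductive_set sphere_ideal :: "nat \<Rightarrow> ('m::finite, (real^'m) \<times> real) cfun set"
  for n :: nat where
  relation: "R \<in> clifford_weyl_relations n \<Longrightarrow> R \<in> sphere_ideal n"
| sphere: "scalar_cfun (\<lambda>(\<omega>, p). super_square n \<omega> + gconst 1) \<in> sphere_ideal n"
| add: "F \<in> sphere_ideal n \<Longrightarrow> G \<in> sphere_ideal n \<Longrightarrow> F + G \<in> sphere_ideal n"
| left: "A \<in> smooth_cfun n \<Longrightarrow> F \<in> sphere_ideal n \<Longrightarrow> cmul A F \<in> sphere_ideal n"
| right: "F \<in> sphere_ideal n \<Longrightarrow> A \<in> smooth_cfun n \<Longrightarrow> cmul F A \<in> sphere_ideal n"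

definition eq_on_supersphere ::
    "nat \<Rightarrow> ('m::finite, (real^'m) \<times> real) cfun \<Rightarrow> ('m, (real^'m) \<times> real) cfun \<Rightarrow> bool" where
  "eq_on_supersphere n F G \<longleftrightarrow>
     (\<exists>K\<in>sphere_ideal n. \<forall>w. \<forall>z\<in>radon_domain. F w z - G w z = K w z)"

definition hermite :: "nat \<Rightarrow> real \<Rightarrow> real" where
  "hermite t p = (-1) ^ t * exp (p\<^sup>2 / 2) * (deriv ^^ t) (\<lambda>q. exp (- (q\<^sup>2) / 2)) p"

end

theory Submission
  imports Defs "HOL-Probability.Probability" "HOL-Real_Asymp.Real_Asymp"
begin

text \<open>
  On polynomials times the Gaussian \<open>exp (x\<^sup>2/2)\<close> the summands of \<open>\<partial>\<^sub>x\<close> act through polynomials, and the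
  Fourier transform turns each of them into multiplication of its generator by \<open>-\<i>\<close> times the
  matching variable \<open>y\<close>. Together with Euler's identity this gives, by induction on \<open>k\<close>, that
  \<open>H\<^sub>k(x) exp (x\<^sup>2/2)\<close> is an eigenfunction for \<open>(-\<i>)\<^sup>k\<close>; hence \<open>\<partial>\<^sub>x\<^sup>2\<^sup>j\<close> of it is transformed to
  \<open>(-\<i>)\<^sup>2\<^sup>j\<^sup>+\<^sup>k X\<^sup>2\<^sup>j H\<^sub>k(y) exp (y\<^sup>2/2)\<close> with \<open>X = \<Sum> e\<^sub>i y\<^sub>i + \<Sum> \<grave>e\<^sub>j \<grave>y\<^sub>j\<close>. After the substitution
  \<open>y = r \<omega>\<close> the integral over \<open>r\<close> is a finite sum, over powers of the nilpotent part of \<open>\<omega>\<^sup>2\<close>, of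
  Gaussian moments of variance depending on \<open>|\<omega>|\<^sup>2\<close>. Modulo \<open>\<omega>\<^sup>2 + 1\<close> this Taylor sum equals the moment
  at \<open>\<omega>\<^sup>2 = -1\<close>, a Hermite function, and \<open>X\<^sup>2 = \<omega>\<^sup>2 = -1\<close>.
\<close>

section \<open>Grassmann algebra\<close>

text \<open>The claim lives in a quotient by two unrelated kinds of relations, and the calculation
  is arranged to meet each of them once. Up to and including the integral over r, everything happens
  in the free algebra on the generators: powers of the Dirac operator applied to a scalar function
  give one term per word, and the transforms act on each word separately. The relations between
  generators enter only through X^2 = \<omega>^2, the sphere only through division by \<omega>^2 +
  1. This division needs a quotient that is smooth for all \<omega> \<noteq> 0, not merely near
  |\<omega>| = 1; averaging over the segment from 1 to |\<omega>|^2 provides it, since the segment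
  stays in the half-line of positive numbers, where the moments are defined. Origin of the
  constants: a word of length 2j and H_k each contribute their degree to the power of r, whence the
  Hermite index 2j + k; the phase (-\<i>)^(2j+k) meets the inverse phase in the moments; a factor
  sqrt(2 pi) of the line integral raises the exponent M/2 - 1 to (M - 1)/2.\<close>

definition geven :: "grass \<Rightarrow> bool" where
  "geven a \<longleftrightarrow> (\<forall>S. odd (card S) \<longrightarrow> a S = 0)"

definition grass_on :: "nat set \<Rightarrow> grass set" where
  "grass_on V = {a. \<forall>S. \<not> S \<subseteq> V \<longrightarrow> a S = 0}"

lemma grass_onD: "a \<in> grass_on V \<Longrightarrow> \<not> S \<subseteq> V \<Longrightarrow> a S = 0"
  by (auto simp: grass_on_def)

lemma grass_onI: "(\<And>S. \<not> S \<subseteq> V \<Longrightarrow> a S = 0) \<Longrightarrow> a \<in> grass_on V"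
  by (simp add: grass_on_def)

lemma grass_on_infinite: "a \<in> grass_on V \<Longrightarrow> finite V \<Longrightarrow> infinite S \<Longrightarrow> a S = 0"
  by (metis grass_onD finite_subset)

text \<open>A \<open>grass\<close> may be nonzero at infinite sets, but a sum over the infinite set
  \<open>Pow S\<close> is 0 by convention, so products vanish there. Hence the recurring case
  distinction on \<open>finite S\<close>; and \<open>gconst 1\<close> is a unit only for elements
  without coefficients at infinite sets.\<close>

lemma gmul_infinite: "infinite S \<Longrightarrow> gmul a b S = 0"
  by (simp add: gmul_def finite_Pow_iff)

lemma reorder_sign_empty [simp]: "reorder_sign {} B = 1" "reorder_sign A {} = 1"
  by (simp_all add: reorder_sign_def)

lemma finite_inversions:
  assumes "finite A" "finite B"
  shows "finite {(a, b). a \<in> A \<and> b \<in> B \<and> b < (a::nat)}"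
  by (rule finite_subset[of _ "A \<times> B"]) (use assms in auto)

lemma reorder_sign_union_left:
  assumes "finite A" "finite B" "finite C" "A \<inter> B = {}"
  shows "reorder_sign (A \<union> B) C = reorder_sign A C * reorder_sign B C"
proof -
  have "{(a, b). a \<in> A \<union> B \<and> b \<in> C \<and> b < a} =
      {(a, b). a \<in> A \<and> b \<in> C \<and> b < a} \<union> {(a, b). a \<in> B \<and> b \<in> C \<and> b < a}" by auto
  moreover have "{(a, b). a \<in> A \<and> b \<in> C \<and> b < a} \<inter> {(a, b). a \<in> B \<and> b \<in> C \<and> b < a} = {}"
    using assms by auto
  ultimately show ?thesis
    using assms by (simp add: reorder_sign_def card_Un_disjoint finite_inversions power_add)
qed

lemma reorder_sign_union_right:
  assumes "finite A" "finite B" "finite C" "B \<inter> C = {}"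
  shows "reorder_sign A (B \<union> C) = reorder_sign A B * reorder_sign A C"
proof -
  have "{(a, b). a \<in> A \<and> b \<in> B \<union> C \<and> b < a} =
      {(a, b). a \<in> A \<and> b \<in> B \<and> b < a} \<union> {(a, b). a \<in> A \<and> b \<in> C \<and> b < a}" by auto
  moreover have "{(a, b). a \<in> A \<and> b \<in> B \<and> b < a} \<inter> {(a, b). a \<in> A \<and> b \<in> C \<and> b < a} = {}"
    using assms by auto
  ultimately show ?thesis
    using assms by (simp add: reorder_sign_def card_Un_disjoint finite_inversions power_add)
qed

text \<open>Every pair from \<open>A\<close> and \<open>B\<close> is an inversion in exactly one of
  the two orders, so the two counts add up to \<open>card A * card B\<close>.\<close>

lemma reorder_sign_swap:
  assumes "finite A" "finite B" "A \<inter> B = {}"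
  shows "reorder_sign A B * reorder_sign B A = (-1) ^ (card A * card B)"
proof -
  let ?P = "{(a, b). a \<in> A \<and> b \<in> B \<and> b < a}" and ?Q = "{(a, b). a \<in> B \<and> b \<in> A \<and> b < a}"
  have "card ?Q = card (prod.swap ` ?Q)"
    by (rule card_image[symmetric]) (auto simp: inj_on_def)
  also have "prod.swap ` ?Q = {(a, b). a \<in> A \<and> b \<in> B \<and> a < b}"
    by (auto simp: image_def)
  finally have "card ?P + card ?Q = card (?P \<union> {(a, b). a \<in> A \<and> b \<in> B \<and> a < b})"
    using assms by (subst card_Un_disjoint)
      (auto simp: finite_inversions intro: finite_subset[of _ "A \<times> B"])
  also have "?P \<union> {(a, b). a \<in> A \<and> b \<in> B \<and> a < b} = A \<times> B"
    using assms by (auto simp: linorder_neq_iff)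
  finally show ?thesis
    by (simp add: reorder_sign_def card_cartesian_product flip: power_add)
qed

lemma reorder_sign_singleton: "reorder_sign {v} B = (-1) ^ card {u \<in> B. u < v}"
proof -
  have "{(a, b). a \<in> {v} \<and> b \<in> B \<and> b < a} = Pair v ` {u \<in> B. u < v}" by auto
  then show ?thesis
    by (simp add: reorder_sign_def card_image inj_on_def)
qed

lemma reorder_sign_square: "reorder_sign A B * reorder_sign A B = 1"
  by (simp add: reorder_sign_def flip: power_mult_distrib)

text \<open>Both sides run over the ordered partitions of \<open>S\<close> into three blocks. The
  number of inversions is additive in each block, so both signs count the inversions between all
  three pairs of blocks.\<close>

lemma gmul_assoc: "gmul (gmul a b) c = gmul a (gmul b c)"
proof
  fix S
  show "gmul (gmul a b) c S = gmul a (gmul b c) S"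
  proof (cases "finite S")
    case True
    let ?X = "SIGMA D:Pow S. Pow D" and ?Y = "SIGMA A:Pow S. Pow (S - A)"
    have fin: "finite A" if "A \<subseteq> S" for A using that True finite_subset by blast
    have "gmul (gmul a b) c S = (\<Sum>D\<in>Pow S. \<Sum>A\<in>Pow D.
        reorder_sign D (S - D) * (reorder_sign A (D - A) * a A * b (D - A)) * c (S - D))"
      by (simp add: gmul_def sum_distrib_left sum_distrib_right)
    also have "\<dots> = (\<Sum>(D, A)\<in>?X.
        reorder_sign D (S - D) * (reorder_sign A (D - A) * a A * b (D - A)) * c (S - D))"
      using True by (subst sum.Sigma) (auto intro: fin)
    also have "\<dots> = (\<Sum>(A, B)\<in>?Y. reorder_sign A (S - A) * a A *
        (reorder_sign B (S - A - B) * b B * c (S - A - B)))"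
    \<comment> \<open>\<open>D\<close> is the union of the first two blocks and \<open>A\<close> the
      first one, so the middle block is \<open>D - A\<close>.\<close>
    proof (rule sum.reindex_bij_witness[where i = "\<lambda>(A, B). (A \<union> B, A)" and j = "\<lambda>(D, A). (A, D - A)"])
      fix x assume "x \<in> ?X"
      then obtain D A where x: "x = (D, A)" "A \<subseteq> D" "D \<subseteq> S" by auto
      have "D = A \<union> (D - A)" using x by auto
      then have 1: "reorder_sign D (S - D) = reorder_sign A (S - D) * reorder_sign (D - A) (S - D)"
        using x reorder_sign_union_left[of A "D - A" "S - D"] fin[of D] fin[of A] True by auto
      have "S - A = (D - A) \<union> (S - D)" using x by auto
      moreover have "finite (D - A)" "finite (S - D)" "(D - A) \<inter> (S - D) = {}"
        using x fin by auto
      ultimately have 2: "reorder_sign A (S - A) = reorder_sign A (D - A) * reorder_sign A (S - D)"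
        using x reorder_sign_union_right[of A "D - A" "S - D"] fin[of A] by auto
      have "S - A - (D - A) = S - D" using x by auto
      with 1 2 show "(case (case x of (D, A) \<Rightarrow> (A, D - A)) of (A, B) \<Rightarrow> reorder_sign A (S - A) * a A *
            (reorder_sign B (S - A - B) * b B * c (S - A - B))) =
          (case x of (D, A) \<Rightarrow> reorder_sign D (S - D) * (reorder_sign A (D - A) * a A * b (D - A)) * c (S - D))"
        by (simp add: x)
    qed auto
    also have "\<dots> = (\<Sum>A\<in>Pow S. \<Sum>B\<in>Pow (S - A). reorder_sign A (S - A) * a A *
        (reorder_sign B (S - A - B) * b B * c (S - A - B)))"
      using True by (subst sum.Sigma) auto
    also have "\<dots> = gmul a (gmul b c) S"
      by (simp add: gmul_def sum_distrib_left)
    finally show ?thesis .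
  qed (simp add: gmul_infinite)
qed

text \<open>Exchanging two blocks costs -1 to the product of their sizes, which is 1 as soon as one
  of them is even; hence a condition on \<open>a\<close> alone.\<close>

lemma gmul_even_commute:
  assumes "geven a"
  shows "gmul a b = gmul b a"
proof
  fix S
  show "gmul a b S = gmul b a S"
  proof (cases "finite S")
    case True
    have "gmul a b S = (\<Sum>B\<in>Pow S. reorder_sign (S - B) B * a (S - B) * b B)"
      unfolding gmul_def
      by (rule sum.reindex_bij_witness[where i = "\<lambda>A. S - A" and j = "\<lambda>A. S - A"])
        (auto simp: double_diff)
    also have "\<dots> = gmul b a S" unfolding gmul_def
    proof (rule sum.cong[OF refl])
      fix B assume "B \<in> Pow S"
      then have fin: "finite B" "finite (S - B)" using True finite_subset by auto
      show "reorder_sign (S - B) B * a (S - B) * b B = reorder_sign B (S - B) * b B * a (S - B)"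
      proof (cases "odd (card (S - B))")
        case False
        then have "reorder_sign (S - B) B * reorder_sign B (S - B) = 1"
          using reorder_sign_swap[OF fin(2,1)] by auto
        then have "reorder_sign (S - B) B = reorder_sign B (S - B)"
          using reorder_sign_square[of B "S - B"] by (metis mult.assoc mult_1 mult_1_right)
        then show ?thesis by simp
      qed (use assms in \<open>simp add: geven_def\<close>)
    qed
    finally show ?thesis .
  qed (simp add: gmul_infinite)
qed

lemma gmul_add_left: "gmul (a + b) c = gmul a c + gmul b c"
  by (rule ext) (simp add: gmul_def algebra_simps sum.distrib)

lemma gmul_add_right: "gmul a (b + c) = gmul a b + gmul a c"
  by (rule ext) (simp add: gmul_def algebra_simps sum.distrib)

lemma gmul_zero [simp]: "gmul 0 a = 0" "gmul a 0 = 0"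
  by (auto simp: gmul_def)

lemma sum_fun_eval: "(\<Sum>i\<in>I. f i) x = (\<Sum>i\<in>I. f i x)"
  by (induction I rule: infinite_finite_induct) auto

lemma gmul_sum_left: "gmul (\<Sum>i\<in>I. a i) c = (\<Sum>i\<in>I. gmul (a i) c)"
proof
  fix S
  show "gmul (\<Sum>i\<in>I. a i) c S = (\<Sum>i\<in>I. gmul (a i) c) S"
    unfolding sum_fun_eval gmul_def sum_distrib_left sum_distrib_right by (rule sum.swap)
qed

lemma gmul_sum_right: "gmul c (\<Sum>i\<in>I. a i) = (\<Sum>i\<in>I. gmul c (a i))"
proof
  fix S
  show "gmul c (\<Sum>i\<in>I. a i) S = (\<Sum>i\<in>I. gmul c (a i)) S"
    unfolding sum_fun_eval gmul_def sum_distrib_left sum_distrib_right by (rule sum.swap)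
qed

lemma gmul_scale_left: "gmul (gscale c a) b = gscale c (gmul a b)"
  by (rule ext) (simp add: gmul_def gscale_def sum_distrib_left mult_ac)

lemma gmul_scale_right: "gmul a (gscale c b) = gscale c (gmul a b)"
  by (rule ext) (simp add: gmul_def gscale_def sum_distrib_left mult_ac)

lemma gmul_const_left: "finite S \<Longrightarrow> gmul (gconst c) a S = c * a S"
proof -
  assume "finite S"
  have "gmul (gconst c) a S = (\<Sum>A\<in>Pow S. if A = {} then c * a S else 0)"
    unfolding gmul_def gconst_def by (rule sum.cong) auto
  with \<open>finite S\<close> show ?thesis by simp
qed

lemma gmul_const_left_on: "a \<in> grass_on V \<Longrightarrow> finite V \<Longrightarrow> gmul (gconst c) a = gscale c a"
  by (rule ext) (metis gmul_const_left gmul_infinite grass_on_infinite gscale_def mult_zero_right)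

lemma geven_const [simp]: "geven (gconst c)"
  by (simp add: geven_def gconst_def)

lemma gmul_const_right: "gmul a (gconst c) = gmul (gconst c) a"
  by (simp add: gmul_even_commute)

lemma gmul_gen_left:
  "gmul (ggen v) b S = (if finite S \<and> v \<in> S then (-1) ^ card {u \<in> S. u < v} * b (S - {v}) else 0)"
proof (cases "finite S")
  case True
  have "gmul (ggen v) b S = (\<Sum>A\<in>Pow S. if A = {v} then reorder_sign {v} (S - {v}) * b (S - {v}) else 0)"
    unfolding gmul_def ggen_def by (rule sum.cong) auto
  also have "\<dots> = (if v \<in> S then reorder_sign {v} (S - {v}) * b (S - {v}) else 0)"
    using True by (simp add: sum.delta)
  finally show ?thesis
    using True by (simp add: reorder_sign_singleton conj_commute cong: conj_cong)
qed (simp add: gmul_infinite)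

section \<open>Parity, support and nilpotency\<close>

lemma geven_add: "geven a \<Longrightarrow> geven b \<Longrightarrow> geven (a + b)"
  and geven_diff: "geven a \<Longrightarrow> geven b \<Longrightarrow> geven (a - b)"
  and geven_scale: "geven a \<Longrightarrow> geven (gscale c a)"
  by (simp_all add: geven_def gscale_def)

lemma geven_sum: "(\<And>i. i \<in> I \<Longrightarrow> geven (a i)) \<Longrightarrow> geven (\<Sum>i\<in>I. a i)"
  by (simp add: geven_def sum_fun_eval)

lemma geven_gen_gen: "geven (gmul (ggen u) (ggen v))"
  unfolding geven_def
proof (intro allI impI)
  fix S :: "nat set" assume "odd (card S)"
  then have "S - {u} \<noteq> {v}" if "finite S" "u \<in> S"
    using card_Suc_Diff1[OF that] by (metis One_nat_def card.empty card_insert_disjoint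
        empty_iff even_Suc finite.emptyI odd_one)
  then show "gmul (ggen u) (ggen v) S = 0"
    unfolding gmul_gen_left by (simp add: ggen_def)
qed

lemma geven_mul:
  assumes "geven a" "geven b"
  shows "geven (gmul a b)"
  unfolding geven_def
proof (intro allI impI)
  fix S :: "nat set" assume odd: "odd (card S)"
  then have fin: "finite S" using card.infinite by fastforce
  have "a A = 0 \<or> b (S - A) = 0" if "A \<subseteq> S" for A
  proof -
    have "card S = card A + card (S - A)"
      using that fin by (metis card_Diff_subset card_mono finite_subset le_add_diff_inverse)
    then show ?thesis using assms odd unfolding geven_def by (metis odd_add)
  qed
  then show "gmul a b S = 0"
    unfolding gmul_def by (intro sum.neutral) auto
qed

lemma geven_pow: "geven a \<Longrightarrow> geven (gpow a k)"
  by (induction k) (simp_all add: geven_mul)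

lemma geven_exp: "geven a \<Longrightarrow> geven (gexp a)"
proof -
  assume "geven a"
  then have "geven (gpow (a - gconst (a {})) k)" for k
    by (intro geven_pow geven_diff) simp_all
  then show ?thesis by (simp add: geven_def gexp_def)
qed

lemma grass_on_add: "a \<in> grass_on V \<Longrightarrow> b \<in> grass_on V \<Longrightarrow> a + b \<in> grass_on V"
  and grass_on_diff: "a \<in> grass_on V \<Longrightarrow> b \<in> grass_on V \<Longrightarrow> a - b \<in> grass_on V"
  and grass_on_scale: "a \<in> grass_on V \<Longrightarrow> gscale c a \<in> grass_on V"
  and grass_on_deriv: "a \<in> grass_on V \<Longrightarrow> gderiv v a \<in> grass_on V"
  unfolding grass_on_def gscale_def gconst_def ggen_def gderiv_def by simp_all

lemma grass_on_const [simp]: "gconst c \<in> grass_on V"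
  by (auto simp: grass_on_def gconst_def)

lemma grass_on_gen: "v \<in> V \<Longrightarrow> ggen v \<in> grass_on V"
  by (auto simp: grass_on_def ggen_def)

lemma grass_on_sum: "(\<And>i. i \<in> I \<Longrightarrow> a i \<in> grass_on V) \<Longrightarrow> (\<Sum>i\<in>I. a i) \<in> grass_on V"
  by (simp add: grass_on_def sum_fun_eval)

lemma grass_on_mul:
  assumes "a \<in> grass_on V" "b \<in> grass_on V"
  shows "gmul a b \<in> grass_on V"
proof -
  have "reorder_sign A (S - A) * a A * b (S - A) = 0" if "A \<subseteq> S" "\<not> S \<subseteq> V" for A S
  proof -
    from that have "\<not> A \<subseteq> V \<or> \<not> S - A \<subseteq> V" by blast
    with assms show ?thesis by (metis grass_onD mult_zero_left mult_zero_right)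
  qed
  then show ?thesis unfolding gmul_def
    by (intro grass_onI sum.neutral ballI) blast
qed

lemma grass_on_pow: "a \<in> grass_on V \<Longrightarrow> gpow a k \<in> grass_on V"
  by (induction k) (simp_all add: grass_on_mul)

lemma grass_on_exp: "a \<in> grass_on V \<Longrightarrow> gexp a \<in> grass_on V"
proof -
  assume "a \<in> grass_on V"
  then have "gpow (a - gconst (a {})) k \<in> grass_on V" for k
    by (intro grass_on_pow grass_on_diff) simp_all
  then have "gpow (a - gconst (a {})) k S = 0" if "\<not> S \<subseteq> V" for k S
    using that by (rule grass_onD)
  then show ?thesis
    by (intro grass_onI) (simp add: gexp_def)
qed

text \<open>Without a scalar part every factor uses up at least one generator. At infinite
  \<open>S\<close>, where \<open>card S = 0\<close>, the claim rests on products being 0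
  there.\<close>

lemma gpow_nilpotent:
  assumes "a {} = 0" "card S < k"
  shows "gpow a k S = 0"
proof (cases "finite S")
  case True
  then show ?thesis using assms(2)
  proof (induction k arbitrary: S)
    case (Suc k)
    have "a A = 0 \<or> gpow a k (S - A) = 0" if "A \<subseteq> S" for A
    proof (cases "A = {}")
      case False
      then have "card (S - A) < card S"
        using that Suc.prems(1) by (intro psubset_card_mono) auto
      then show ?thesis using Suc by (simp add: finite_Diff)
    qed (use assms in simp)
    then show ?case by (auto simp: gmul_def intro!: sum.neutral)
  qed simp
next
  case False
  then show ?thesis using assms(2) by (cases k) (simp_all add: gmul_infinite)
qed

text \<open>\<open>gexp\<close> cuts its series off at \<open>card S\<close>, a bound that varies
  with the coefficient. A common bound \<open>N\<close> lets the series at different sets be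
  combined under one sum.\<close>

lemma gexp_nilpotent:
  assumes "a {} = 0" "card S \<le> N"
  shows "gexp a S = (\<Sum>k\<le>N. gpow a k S / fact k)"
proof -
  have "a - gconst (a {}) = a" using assms(1) by (intro ext) (simp add: gconst_def)
  moreover have "(\<Sum>k\<le>card S. gpow a k S / fact k) = (\<Sum>k\<le>N. gpow a k S / fact k)"
    using assms by (intro sum.mono_neutral_left) (simp_all add: gpow_nilpotent)
  ultimately show ?thesis using assms(1) by (simp add: gexp_def)
qed

text \<open>This separates the commuting from the anti-commuting variables: the exponents that occur
  depend on the points of \<open>real^'m\<close> only through their scalar part.\<close>

lemma gexp_const_add:
  assumes "a {} = 0"
  shows "gexp (gconst c + a) = gscale (exp c) (gexp a)"
proof -
  have "(gconst c + a) {} = c" using assms by (simp add: gconst_def)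
  moreover have "gconst c + a - gconst c = a" by (simp add: fun_eq_iff)
  moreover have "a - gconst (a {}) = a" using assms by (simp add: fun_eq_iff gconst_def)
  ultimately show ?thesis
    using assms unfolding gexp_def gscale_def by simp
qed

section \<open>The left derivative and its Leibniz rules\<close>

lemma gderiv_add: "gderiv v (a + b) = gderiv v a + gderiv v b"
  and gderiv_diff: "gderiv v (a - b) = gderiv v a - gderiv v b"
  and gderiv_scale: "gderiv v (gscale c a) = gscale c (gderiv v a)"
  and gderiv_zero [simp]: "gderiv v 0 = 0"
  and gderiv_const: "gderiv v (gconst c) = 0"
  by (auto simp: gderiv_def gscale_def gconst_def ggen_def algebra_simps)

lemma gderiv_gen: "gderiv v (ggen u) = (if u = v then gconst 1 else 0)"
proof
  fix S
  show "gderiv v (ggen u) S = (if u = v then gconst 1 else 0) S"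
    by (cases "S = {}") (auto simp: gderiv_def ggen_def gconst_def)
qed

lemma gderiv_sum: "gderiv v (\<Sum>i\<in>I. a i) = (\<Sum>i\<in>I. gderiv v (a i))"
  by (rule ext) (simp add: gderiv_def sum_fun_eval sum_distrib_left)

lemma gevenD: "geven a \<Longrightarrow> a S \<noteq> 0 \<Longrightarrow> even (card S)"
  by (auto simp: geven_def)

text \<open>Products vanish at infinite sets while \<open>gderiv\<close> keeps coefficients there.
  An identity in which an element stands next to products, such as \<open>gderiv_gen_mul\<close> for
  \<open>u = v\<close>, therefore holds only under this condition.\<close>

definition gfin :: "grass \<Rightarrow> bool" where
  "gfin a \<longleftrightarrow> (\<forall>S. infinite S \<longrightarrow> a S = 0)"

lemma gfin_mul [simp]: "gfin (gmul a b)"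
  by (simp add: gfin_def gmul_infinite)

lemma gfin_on: "a \<in> grass_on V \<Longrightarrow> finite V \<Longrightarrow> gfin a"
  by (simp add: gfin_def grass_on_infinite)

lemma gfin_deriv: "gfin a \<Longrightarrow> gfin (gderiv v a)"
  by (simp add: gfin_def gderiv_def)

lemma card_below_insert:
  assumes "finite S" "v \<notin> S"
  shows "card {w \<in> insert v S. w < (u::nat)} = card {w \<in> S. w < u} + (if v < u then 1 else 0)"
proof -
  have "{w \<in> insert v S. w < u} = (if v < u then insert v {w \<in> S. w < u} else {w \<in> S. w < u})"
    by auto
  then show ?thesis using assms by simp
qed

lemma sign_square: "(-1) ^ k * ((-1) ^ k * x) = (x::complex)"
  by (simp add: mult.assoc[symmetric] flip: power_mult_distrib)

text \<open>The canonical anticommutation relation. For \<open>u \<noteq> v\<close>, moving the two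
  generators to the front in one order or the other differs by a single transposition.\<close>

lemma gderiv_gen_mul:
  assumes "gfin b"
  shows "gderiv v (gmul (ggen u) b) = (if u = v then b else 0) - gmul (ggen u) (gderiv v b)"
proof
  fix S
  show "gderiv v (gmul (ggen u) b) S = ((if u = v then b else 0) - gmul (ggen u) (gderiv v b)) S"
  proof (cases "finite S")
    case False
    then show ?thesis using assms by (simp add: gderiv_def gmul_infinite gfin_def)
  next
    case True
    show ?thesis
    proof (cases "u = v")
      case True
      have eq: "{w \<in> S. w \<noteq> v \<and> w < v} = {w \<in> S. w < v}"
        "{w \<in> S - {v}. w < v} = {w \<in> S. w < v}" "{w \<in> insert v S. w < v} = {w \<in> S. w < v}"
        "{w. (w = v \<or> w \<in> S) \<and> w < v} = {w \<in> S. w < v}"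
        by auto
      show ?thesis
      proof (cases "v \<in> S")
        case v: True
        then show ?thesis using \<open>finite S\<close> True
          unfolding gderiv_def gmul_gen_left fun_diff_def eq
          by (simp add: insert_absorb sign_square eq(1))
      next
        case v: False
        then show ?thesis using \<open>finite S\<close> True
          unfolding gderiv_def gmul_gen_left fun_diff_def eq by (simp add: sign_square eq(4))
      qed
    next
      case False
      show ?thesis
      proof (cases "u \<in> S \<and> v \<notin> S")
        case True
        have "S = insert u (S - {u})" using True by auto
        then have 1: "card {w \<in> S. w < v} = card {w \<in> S - {u}. w < v} + (if u < v then 1 else 0)"
          using card_below_insert[of "S - {u}" u v] \<open>finite S\<close> by auto
        have 2: "card {w \<in> insert v S. w < u} = card {w \<in> S. w < u} + (if v < u then 1 else 0)"
          using card_below_insert[of S v u] \<open>finite S\<close> True by auto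
        have "insert v S - {u} = insert v (S - {u})" using False by auto
        then have L: "gderiv v (gmul (ggen u) b) S = (-1) ^ card {w \<in> S. w < v} *
            ((-1) ^ card {w \<in> insert v S. w < u} * b (insert v (S - {u})))"
          using True \<open>finite S\<close> unfolding gderiv_def gmul_gen_left by simp
        have R: "gmul (ggen u) (gderiv v b) S = (-1) ^ card {w \<in> S. w < u} *
            ((-1) ^ card {w \<in> S - {u}. w < v} * b (insert v (S - {u})))"
          using True \<open>finite S\<close> unfolding gderiv_def gmul_gen_left by simp
        show ?thesis
          unfolding fun_diff_def L R 1 2 using False by (cases "u < v") simp_all
      next
        case other: False
        then show ?thesis using False \<open>finite S\<close>
          unfolding gderiv_def gmul_gen_left fun_diff_def by simp
      qed
    qed
  qed
qed

text \<open>To reach \<open>b\<close>, the derivative has to pass all generators of a term of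
  \<open>c\<close>, and the sign of this is the same for all terms if they have the same parity. The
  parameter \<open>\<epsilon>\<close> covers even and odd factors at once.\<close>

lemma gderiv_free_mul:
  assumes free: "\<And>A. finite A \<Longrightarrow> v \<in> A \<Longrightarrow> c A = 0"
    and parity: "\<And>A. c A \<noteq> 0 \<Longrightarrow> (-1) ^ card A = \<epsilon>"
  shows "gderiv v (gmul c b) = gscale \<epsilon> (gmul c (gderiv v b))"
proof
  fix S
  show "gderiv v (gmul c b) S = gscale \<epsilon> (gmul c (gderiv v b)) S"
  proof (cases "finite S")
    case False
    then show ?thesis by (simp add: gderiv_def gscale_def gmul_infinite)
  next
    case True
    show ?thesis
    proof (cases "v \<in> S")
      case True
      have "reorder_sign A (S - A) * c A * gderiv v b (S - A) = 0" if "A \<subseteq> S" for A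
      proof (cases "v \<in> A")
        case True
        then show ?thesis using free[of A] that \<open>finite S\<close> finite_subset by auto
      next
        case False
        then show ?thesis using \<open>v \<in> S\<close> by (simp add: gderiv_def)
      qed
      then have "gmul c (gderiv v b) S = 0"
        unfolding gmul_def by (intro sum.neutral) blast
      with True show ?thesis by (simp add: gderiv_def gscale_def)
    next
      case False
      have "gmul c b (insert v S) = (\<Sum>A\<in>Pow S. reorder_sign A (insert v S - A) * c A * b (insert v S - A))"
        unfolding gmul_def
      proof (rule sum.mono_neutral_right)
        show "\<forall>A\<in>Pow (insert v S) - Pow S. reorder_sign A (insert v S - A) * c A * b (insert v S - A) = 0"
        proof
          fix A assume "A \<in> Pow (insert v S) - Pow S"
          then have "finite A" "v \<in> A" using \<open>finite S\<close> finite_subset[of A "insert v S"] by auto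
          then show "reorder_sign A (insert v S - A) * c A * b (insert v S - A) = 0"
            by (simp add: free)
        qed
      qed (use \<open>finite S\<close> in auto)
      also have "\<dots> = (\<Sum>A\<in>Pow S. (-1) ^ card {w \<in> S. w < v} * \<epsilon> * (reorder_sign A (S - A) * c A * gderiv v b (S - A)))"
      proof (rule sum.cong[OF refl])
        fix A assume "A \<in> Pow S"
        then have A: "A \<subseteq> S" "finite A" "v \<notin> A" "finite (S - A)" using \<open>finite S\<close> False finite_subset by auto
        show "reorder_sign A (insert v S - A) * c A * b (insert v S - A) =
          (-1) ^ card {w \<in> S. w < v} * \<epsilon> * (reorder_sign A (S - A) * c A * gderiv v b (S - A))"
        proof (cases "c A = 0")
          case c: False
          have ins: "insert v S - A = insert v (S - A)" using A by auto
          have "reorder_sign A (insert v (S - A)) = reorder_sign A {v} * reorder_sign A (S - A)"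
            using reorder_sign_union_right[of A "{v}" "S - A"] A False by auto
          moreover have "reorder_sign A {v} = (-1) ^ card {w \<in> A. w < v} * \<epsilon>"
          proof -
            have "reorder_sign A {v} * reorder_sign {v} A = (-1) ^ card A"
              using reorder_sign_swap[of A "{v}"] A by simp
            then show ?thesis
              using parity[OF c] by (metis mult.commute reorder_sign_singleton sign_square)
          qed
          moreover have "card {w \<in> S. w < v} = card {w \<in> A. w < v} + card {w \<in> S - A. w < v}"
          proof -
            have "{w \<in> S. w < v} = {w \<in> A. w < v} \<union> {w \<in> S - A. w < v}" using A by auto
            then show ?thesis using A by (simp add: card_Un_disjoint disjoint_iff)
          qed
          ultimately show ?thesis
            using A False by (simp add: ins gderiv_def power_add sign_square mult_ac)
        qed simp
      qed
      also have "\<dots> = (-1) ^ card {w \<in> S. w < v} * \<epsilon> * gmul c (gderiv v b) S"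
        by (simp add: gmul_def sum_distrib_left)
      finally show ?thesis
        using False by (simp add: gderiv_def gscale_def sign_square mult.assoc)
    qed
  qed
qed

lemma gscale_simps: "gscale 1 a = a" "gscale 0 a = 0" "gscale c (gscale d a) = gscale (c * d) a"
    "gscale c (a + b) = gscale c a + gscale c b" "gscale c (a - b) = gscale c a - gscale c b"
    "gscale (-1) a = - a"
  by (auto simp: gscale_def algebra_simps)

text \<open>The factor \<open>a\<close> splits into a part free of the generator \<open>v\<close>
  and \<open>ggen v\<close> times a cofactor free of it. Evenness of \<open>a\<close> makes the
  first part even and the cofactor odd, so \<open>gderiv_free_mul\<close> applies to both; the sign
  of passing the odd cofactor cancels that of passing \<open>ggen v\<close>.\<close>

lemma gderiv_even_mul:
  assumes a: "geven a" "gfin a"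
  shows "gderiv v (gmul a b) = gmul (gderiv v a) b + gmul a (gderiv v b)"
proof -
  define a1 where "a1 = gderiv v a"
  define a0 where "a0 = gderiv v (gmul (ggen v) a)"
  \<comment> \<open>The relation \<open>gderiv_gen_mul\<close> for \<open>u = v\<close>, solved for
    \<open>a\<close>.\<close>
  have split: "a = a0 + gmul (ggen v) a1"
    unfolding a0_def a1_def using gderiv_gen_mul[OF a(2), where u=v and v=v] by simp
  have d1: "gderiv v (gmul a1 c) = gscale (-1) (gmul a1 (gderiv v c))" for c
  proof (rule gderiv_free_mul)
    fix A assume "a1 A \<noteq> 0"
    then have "v \<notin> A" "a (insert v A) \<noteq> 0"
      unfolding a1_def gderiv_def by (simp_all split: if_splits)
    moreover from this have "finite A" using a(2) unfolding gfin_def by (metis finite_insert)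
    ultimately have "even (card A + 1)" using gevenD[OF a(1), of "insert v A"] by simp
    then show "(-1) ^ card A = (-1::complex)" by simp
  qed (simp add: a1_def gderiv_def)
  have d0: "gderiv v (gmul a0 c) = gscale 1 (gmul a0 (gderiv v c))" for c
  proof (rule gderiv_free_mul)
    fix A assume "a0 A \<noteq> 0"
    moreover from this have "v \<notin> A" unfolding a0_def gderiv_def by (simp split: if_splits)
    moreover have "a A = a0 A + gmul (ggen v) a1 A" by (metis split plus_fun_apply)
    ultimately have "a A \<noteq> 0" by (simp add: gmul_gen_left)
    then show "(-1) ^ card A = (1::complex)" using gevenD[OF a(1)] by simp
  qed (simp add: a0_def gderiv_def)
  have fin: "gfin (gmul a1 b)" by (simp add: gfin_def gmul_infinite)
  have "gderiv v (gmul a b) = gderiv v (gmul a0 b) + gderiv v (gmul (ggen v) (gmul a1 b))"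
    by (subst split) (simp add: gmul_add_left gderiv_add gmul_assoc)
  also have "gderiv v (gmul (ggen v) (gmul a1 b)) = gmul a1 b - gmul (ggen v) (gderiv v (gmul a1 b))"
    unfolding gderiv_gen_mul[OF fin] by simp
  also have "gderiv v (gmul a0 b) + \<dots> = gmul a1 b + gmul (a0 + gmul (ggen v) a1) (gderiv v b)"
    unfolding d0 d1 gmul_scale_right gmul_add_left gmul_assoc
    by (simp add: fun_eq_iff gscale_def)
  finally show ?thesis
    unfolding split[symmetric] by (simp only: a1_def)
qed

lemma gconst_infinite: "infinite S \<Longrightarrow> gconst c S = 0"
  unfolding gconst_def using finite.emptyI by metis

lemma gexp_infinite: "infinite S \<Longrightarrow> gexp a S = 0"
  by (simp add: gexp_def gconst_infinite)

lemma gderiv_pow: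
  assumes a: "geven a" "gfin a"
  shows "gderiv v (gpow a (Suc k)) = gscale (of_nat (Suc k)) (gmul (gderiv v a) (gpow a k))"
proof (induction k)
  case 0
  show ?case by (simp add: gderiv_even_mul[OF a] gderiv_const gscale_simps)
next
  case (Suc k)
  have swap: "gmul a (gmul (gderiv v a) (gpow a k)) = gmul (gderiv v a) (gpow a (Suc k))"
    using a(1) by (simp flip: gmul_assoc add: gmul_even_commute[of a "gderiv v a"])
  have "gderiv v (gpow a (Suc (Suc k))) = gderiv v (gmul a (gpow a (Suc k)))"
    by (subst gpow.simps(2)) (rule refl)
  also have "\<dots> = gmul (gderiv v a) (gpow a (Suc k)) + gmul a (gderiv v (gpow a (Suc k)))"
    by (rule gderiv_even_mul[OF a])
  also have "\<dots> = gscale (of_nat (Suc (Suc k))) (gmul (gderiv v a) (gpow a (Suc k)))"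
    unfolding Suc.IH gmul_scale_right swap
    by (rule ext) (simp add: gscale_def algebra_simps)
  finally show ?case .
qed

lemma gmul_exp_eval:
  assumes "a {} = 0" "finite S" "card S \<le> N"
  shows "gmul b (gexp a) S = (\<Sum>k\<le>N. gmul b (gpow a k) S / fact k)"
proof -
  have "card (S - A) \<le> N" for A
    using assms by (meson Diff_subset card_mono le_trans)
  then have "gmul b (gexp a) S =
      (\<Sum>A\<in>Pow S. \<Sum>k\<le>N. reorder_sign A (S - A) * b A * gpow a k (S - A) / fact k)"
    unfolding gmul_def by (simp add: gexp_nilpotent[of a _ N] assms(1) sum_distrib_left)
  also have "\<dots> = (\<Sum>k\<le>N. gmul b (gpow a k) S / fact k)"
    by (subst sum.swap) (simp add: gmul_def sum_divide_distrib)
  finally show ?thesis .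
qed

lemma gderiv_exp:
  assumes a: "geven a" "gfin a" "a {} = 0"
  shows "gderiv v (gexp a) = gmul (gderiv v a) (gexp a)"
proof
  fix S
  show "gderiv v (gexp a) S = gmul (gderiv v a) (gexp a) S"
  proof (cases "finite S")
    case True
    \<comment> \<open>\<open>gderiv\<close> looks at a set with one more generator, so the series
      runs one term further; lowering the exponent brings the bound back to
      \<open>card S\<close>.\<close>
    have "gexp a (insert v S) = (\<Sum>k\<le>Suc (card S). gpow a k (insert v S) / fact k)"
      using True by (intro gexp_nilpotent[of a, OF a(3)]) (simp add: card_insert_if)
    then have "gderiv v (gexp a) S = (\<Sum>k\<le>Suc (card S). gderiv v (gpow a k) S / fact k)"
      by (simp add: gderiv_def sum_distrib_left del: sum.atMost_Suc)
    also have "\<dots> = (\<Sum>k\<le>card S. gmul (gderiv v a) (gpow a k) S / fact k)"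
    proof -
      have "gderiv v (gpow a (Suc k)) S / fact (Suc k) = gmul (gderiv v a) (gpow a k) S / fact k" for k
        unfolding gderiv_pow[OF a(1,2)] by (simp add: gscale_def del: of_nat_Suc)
      then show ?thesis
        unfolding sum.atMost_Suc_shift by (simp add: gderiv_const del: gpow.simps(2) fact_Suc)
    qed
    also have "\<dots> = gmul (gderiv v a) (gexp a) S"
      by (rule gmul_exp_eval[symmetric, of a S "card S"]) (use a True in simp_all)
    finally show ?thesis .
  qed (simp add: gderiv_def gexp_infinite gmul_infinite)
qed

section \<open>The fermionic Fourier transform\<close>

lemma gscale_eval: "gscale c a S = c * a S"
  by (simp add: gscale_def)

text \<open>The fermionic quadratic form pairs the variables \<open>2*j - 1\<close> and
  \<open>2*j\<close> symplectically: \<open>partner v\<close> is the conjugate variable, and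
  \<open>psign v\<close> the sign with which it occurs in the derivative of the form with respect to
  \<open>v\<close>.\<close>

definition partner :: "nat \<Rightarrow> nat" where
  "partner v = (if odd v then v + 1 else v - 1)"

definition psign :: "nat \<Rightarrow> complex" where
  "psign v = (if odd v then 1 else -1)"

definition fermion_square :: "nat \<Rightarrow> grass" where
  "fermion_square n = (\<Sum>j=1..n. gmul (ggen (2*j - 1)) (ggen (2*j)))"

text \<open>The part of the exponent \<i> <x,y> in the anti-commuting variables, hence the factor
  \<open>\<i>/2\<close>.\<close>

definition fermion_pairing :: "nat \<Rightarrow> grass" where
  "fermion_pairing n = gscale (\<i>/2) (\<Sum>j=1..n. gmul (ggen (2*j - 1)) (ggen (2*n + 2*j))
      - gmul (ggen (2*j)) (ggen (2*n + (2*j - 1))))"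

definition fermion_gauss :: "nat \<Rightarrow> grass" where
  "fermion_gauss n = gexp (gscale (1/2) (fermion_square n))"

definition fermion_fourier :: "nat \<Rightarrow> grass \<Rightarrow> grass" where
  "fermion_fourier n a = (\<lambda>S. berezin n (gmul (gexp (fermion_pairing n)) a) ((\<lambda>j. 2*n + j) ` S))"

lemma index_cases:
  assumes "v \<in> {1..2*n}"
  obtains l where "l \<in> {1..n}" "v = 2*l - 1" "odd v" "partner v = 2*l" "psign v = 1"
    | l where "l \<in> {1..n}" "v = 2*l" "even v" "partner v = 2*l - 1" "psign v = -1"
proof (cases "odd v")
  case True
  then obtain q where "v = 2 * q + 1" by (elim oddE)
  with assms that(1)[of "Suc q"] show ?thesis by (simp add: partner_def psign_def)
next
  case False
  then obtain q where "v = 2 * q" by auto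
  with assms that(2)[of q] show ?thesis by (simp add: partner_def psign_def)
qed

lemma partner_in: "v \<in> {1..2*n} \<Longrightarrow> partner v \<in> {1..2*n}"
  by (erule index_cases) auto

lemma partner_partner: "v \<in> {1..2*n} \<Longrightarrow> partner (partner v) = v"
  by (erule index_cases) (auto simp: partner_def)

lemma psign_partner: "v \<in> {1..2*n} \<Longrightarrow> psign (partner v) = - psign v"
  by (erule index_cases) (auto simp: psign_def)

lemma psign_square [simp]: "psign v * psign v = 1" "psign v * (psign v * x) = x"
  by (auto simp: psign_def)

lemma gfin_gen [simp]: "gfin (ggen v)"
  by (auto simp: gfin_def ggen_def)

lemma gderiv_gen_gen:
  "gderiv v (gmul (ggen a) (ggen b)) = (if a = v then ggen b else 0) - (if b = v then ggen a else 0)"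
proof -
  have "gmul (ggen a) (gconst 1) = ggen a"
    unfolding gmul_const_right by (simp add: gmul_const_left_on[of _ "{a}"] grass_on_gen gscale_simps)
  then show ?thesis by (simp add: gderiv_gen_mul gderiv_gen)
qed

lemma sum_index_delta:
  fixes f :: "nat \<Rightarrow> 'a::comm_monoid_add"
  assumes "l \<in> {1..n}" "\<And>j. j \<in> {1..n} \<Longrightarrow> P j \<longleftrightarrow> j = l"
  shows "(\<Sum>j=1..n. if P j then f j else 0) = f l"
proof -
  have "(\<Sum>j=1..n. if P j then f j else 0) = (\<Sum>j=1..n. if j = l then f j else 0)"
    using assms by (intro sum.cong) auto
  then show ?thesis using assms by simp
qed

lemma sum_index_none:
  fixes f :: "nat \<Rightarrow> grass"
  assumes "\<And>j. j \<in> {1..n} \<Longrightarrow> \<not> P j"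
  shows "(\<Sum>j=1..n. if P j then f j else 0) = 0"
  using assms by (intro sum.neutral) auto

lemma gderiv_fermion_square:
  assumes "v \<in> {1..2*n}"
  shows "gderiv v (fermion_square n) = gscale (psign v) (ggen (partner v))"
proof -
  have *: "gderiv v (fermion_square n) =
      (\<Sum>j=1..n. if 2*j - 1 = v then ggen (2*j) else 0) - (\<Sum>j=1..n. if 2*j = v then ggen (2*j - 1) else 0)"
    unfolding fermion_square_def gderiv_sum gderiv_gen_gen sum_subtractf ..
  from assms show ?thesis
  proof (cases rule: index_cases)
    case (1 l)
    have "2*j - 1 = v \<longleftrightarrow> j = l" "2*j \<noteq> v" if "j \<in> {1..n}" for j
      using 1 that by (auto, presburger)
    then show ?thesis unfolding * using 1
      by (simp add: sum_index_delta[of l] sum_index_none gscale_simps)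
  next
    case (2 l)
    have "2*j = v \<longleftrightarrow> j = l" "2*j - 1 \<noteq> v" if "j \<in> {1..n}" for j
      using 2 that by (auto, presburger)
    then show ?thesis unfolding * using 2
      by (simp add: sum_index_delta[of l] sum_index_none gscale_simps)
  qed
qed

lemma gderiv_fermion_pairing_x:
  assumes "v \<in> {1..2*n}"
  shows "gderiv v (fermion_pairing n) = gscale (\<i>/2 * psign v) (ggen (2*n + partner v))"
proof -
  have "gderiv v (gmul (ggen (2*j - 1)) (ggen (2*n + 2*j))) - gderiv v (gmul (ggen (2*j)) (ggen (2*n + (2*j - 1)))) =
      (if 2*j - 1 = v then ggen (2*n + 2*j) else 0) - (if 2*j = v then ggen (2*n + (2*j - 1)) else 0)" if "j \<in> {1..n}" for j
    using assms that unfolding gderiv_gen_gen by auto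
  then have *: "gderiv v (fermion_pairing n) = gscale (\<i>/2)
      ((\<Sum>j=1..n. if 2*j - 1 = v then ggen (2*n + 2*j) else 0) -
       (\<Sum>j=1..n. if 2*j = v then ggen (2*n + (2*j - 1)) else 0))"
    unfolding fermion_pairing_def gderiv_scale gderiv_sum gderiv_diff sum_subtractf[symmetric]
    by (intro arg_cong2[where f = gscale] sum.cong refl)
  from assms show ?thesis
  proof (cases rule: index_cases)
    case (1 l)
    have "2*j - 1 = v \<longleftrightarrow> j = l" "2*j \<noteq> v" if "j \<in> {1..n}" for j
      using 1 that by (auto, presburger)
    then show ?thesis unfolding * using 1
      by (simp add: sum_index_delta[of l] sum_index_none gscale_simps)
  next
    case (2 l)
    have "2*j = v \<longleftrightarrow> j = l" "2*j - 1 \<noteq> v" if "j \<in> {1..n}" for j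
      using 2 that by (auto, presburger)
    then show ?thesis unfolding * using 2
      by (simp add: sum_index_delta[of l] sum_index_none) (simp add: gscale_eval fun_eq_iff)
  qed
qed

lemma gderiv_fermion_pairing_y:
  assumes "v \<in> {1..2*n}"
  shows "gderiv (2*n + v) (fermion_pairing n) = gscale (\<i>/2 * psign v) (ggen (partner v))"
proof -
  have "gderiv (2*n + v) (gmul (ggen (2*j - 1)) (ggen (2*n + 2*j))) - gderiv (2*n + v) (gmul (ggen (2*j)) (ggen (2*n + (2*j - 1)))) =
      (if 2*j - 1 = v then ggen (2*j) else 0) - (if 2*j = v then ggen (2*j - 1) else 0)" if "j \<in> {1..n}" for j
    using assms that unfolding gderiv_gen_gen by auto
  then have *: "gderiv (2*n + v) (fermion_pairing n) = gscale (\<i>/2)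
      ((\<Sum>j=1..n. if 2*j - 1 = v then ggen (2*j) else 0) -
       (\<Sum>j=1..n. if 2*j = v then ggen (2*j - 1) else 0))"
    unfolding fermion_pairing_def gderiv_scale gderiv_sum gderiv_diff sum_subtractf[symmetric]
    by (intro arg_cong2[where f = gscale] sum.cong refl)
  from assms show ?thesis
  proof (cases rule: index_cases)
    case (1 l)
    have "2*j - 1 = v \<longleftrightarrow> j = l" "2*j \<noteq> v" if "j \<in> {1..n}" for j
      using 1 that by (auto, presburger)
    then show ?thesis unfolding * using 1
      by (simp add: sum_index_delta[of l] sum_index_none gscale_simps)
  next
    case (2 l)
    have "2*j = v \<longleftrightarrow> j = l" "2*j - 1 \<noteq> v" if "j \<in> {1..n}" for j
      using 2 that by (auto, presburger)
    then show ?thesis unfolding * using 2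
      by (simp add: sum_index_delta[of l] sum_index_none) (simp add: gscale_eval fun_eq_iff)
  qed
qed

lemma gen_gen_empty: "gmul (ggen a) (ggen b) {} = 0"
  by (simp add: gmul_gen_left)

lemma fermion_square_props:
  "geven (fermion_square n)" "fermion_square n {} = 0" "fermion_square n \<in> grass_on {1..2*n}"
proof -
  show "geven (fermion_square n)" "fermion_square n \<in> grass_on {1..2*n}"
    unfolding fermion_square_def
    by (auto intro!: geven_sum geven_gen_gen grass_on_sum grass_on_mul grass_on_gen)
  show "fermion_square n {} = 0"
    by (simp add: fermion_square_def sum_fun_eval gen_gen_empty)
qed

lemma fermion_pairing_props:
  "geven (fermion_pairing n)" "fermion_pairing n {} = 0" "fermion_pairing n \<in> grass_on {1..4*n}"
proof -
  show "geven (fermion_pairing n)"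
    unfolding fermion_pairing_def by (intro geven_scale geven_sum geven_diff geven_gen_gen)
  show "fermion_pairing n {} = 0"
    by (simp add: fermion_pairing_def gscale_eval sum_fun_eval gen_gen_empty)
  show "fermion_pairing n \<in> grass_on {1..4*n}"
    unfolding fermion_pairing_def
    by (intro grass_on_scale grass_on_sum grass_on_diff grass_on_mul grass_on_gen) auto
qed

lemma geven_fermion_gauss: "geven (fermion_gauss n)"
  unfolding fermion_gauss_def by (intro geven_exp geven_scale fermion_square_props)

lemma fermion_gauss_on: "fermion_gauss n \<in> grass_on {1..2*n}"
  unfolding fermion_gauss_def by (intro grass_on_exp grass_on_scale fermion_square_props)

lemma gexp_empty: "a {} = 0 \<Longrightarrow> gexp a {} = 1"
  by (simp add: gexp_def gconst_def)

lemma gderiv_fermion_gauss: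
  assumes "v \<in> {1..2*n}"
  shows "gderiv v (fermion_gauss n) = gscale (psign v / 2) (gmul (ggen (partner v)) (fermion_gauss n))"
proof -
  have "gfin (gscale (1/2) (fermion_square n))"
    by (intro gfin_on[of _ "{1..2*n}"] grass_on_scale fermion_square_props) simp
  then have "gderiv v (fermion_gauss n) = gmul (gderiv v (gscale (1/2) (fermion_square n))) (fermion_gauss n)"
    unfolding fermion_gauss_def
    by (intro gderiv_exp geven_scale fermion_square_props) (simp_all add: gscale_eval fermion_square_props)
  then show ?thesis
    using assms by (simp add: gderiv_scale gderiv_fermion_square gmul_scale_left gscale_simps)
qed

lemma gderiv_fermion_kernel:
  assumes "v \<in> {1..2*n}"
  shows "gderiv v (gexp (fermion_pairing n)) =
      gscale (\<i>/2 * psign v) (gmul (ggen (2*n + partner v)) (gexp (fermion_pairing n)))"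
    and "gderiv (2*n + v) (gexp (fermion_pairing n)) =
      gscale (\<i>/2 * psign v) (gmul (ggen (partner v)) (gexp (fermion_pairing n)))"
proof -
  have "gfin (fermion_pairing n)"
    using fermion_pairing_props(3) by (rule gfin_on) simp
  from gderiv_exp[OF fermion_pairing_props(1) this fermion_pairing_props(2)]
  show "gderiv v (gexp (fermion_pairing n)) =
      gscale (\<i>/2 * psign v) (gmul (ggen (2*n + partner v)) (gexp (fermion_pairing n)))"
    and "gderiv (2*n + v) (gexp (fermion_pairing n)) =
      gscale (\<i>/2 * psign v) (gmul (ggen (partner v)) (gexp (fermion_pairing n)))"
    using assms by (simp_all add: gderiv_fermion_pairing_x gderiv_fermion_pairing_y gmul_scale_left)
qed

section \<open>Berezin integration and the fermionic exchange rules\<close>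

lemma fold_gderiv_eval:
  assumes "S \<subseteq> {m<..}"
  shows "fold gderiv [1..<m + 1] a S = a ({1..m} \<union> S)"
  using assms
proof (induction m arbitrary: S)
  case (Suc m)
  \<comment> \<open>The derivative applied last carries the largest index and is evaluated at a set
    above it, so no sign arises: up to the power of \<open>pi\<close>, Berezin integration reads off
    coefficients.\<close>
  have "{u \<in> S. u < Suc m} = {}" "Suc m \<notin> S" using Suc.prems by auto
  then have "gderiv (Suc m) (fold gderiv [1..<m + 1] a) S = fold gderiv [1..<m + 1] a (insert (Suc m) S)"
    unfolding gderiv_def \<open>{u \<in> S. u < Suc m} = {}\<close> using \<open>Suc m \<notin> S\<close> by simp
  moreover have "[1..<Suc m + 1] = [1..<m + 1] @ [Suc m]" by simp
  ultimately have "fold gderiv [1..<Suc m + 1] a S = fold gderiv [1..<m + 1] a (insert (Suc m) S)"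
    by (simp del: upt_Suc)
  also have "\<dots> = a ({1..m} \<union> insert (Suc m) S)"
    using Suc.prems by (intro Suc.IH) auto
  also have "{1..m} \<union> insert (Suc m) S = {1..Suc m} \<union> S" by auto
  finally show ?case .
qed simp

lemma fermion_fourier_eval:
  assumes "S \<subseteq> {1..2*n}"
  shows "fermion_fourier n a S =
      1 / of_real pi ^ n * gmul (gexp (fermion_pairing n)) a ({1..2*n} \<union> (\<lambda>j. 2*n + j) ` S)"
proof -
  have "(\<lambda>j. 2*n + j) ` S \<subseteq> {2*n<..}" using assms by auto
  then show ?thesis
    unfolding fermion_fourier_def berezin_def gscale_def by (simp only: fold_gderiv_eval)
qed

lemma fold_gderiv_on: "a \<in> grass_on V \<Longrightarrow> fold gderiv xs a \<in> grass_on V"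
  by (induction xs arbitrary: a) (simp_all add: grass_on_deriv)

lemma fermion_fourier_on:
  assumes "a \<in> grass_on {1..2*n}"
  shows "fermion_fourier n a \<in> grass_on {1..2*n}"
proof (rule grass_onI)
  fix S assume S: "\<not> S \<subseteq> {1..2*n}"
  let ?g = "gmul (gexp (fermion_pairing n)) a" and ?S = "(\<lambda>j. 2*n + j) ` S"
  have "a \<in> grass_on {1..4*n}"
    using assms by (intro grass_onI) (rule grass_onD, assumption, fastforce)
  then have on: "fold gderiv xs ?g \<in> grass_on {1..4*n}" for xs
    by (intro fold_gderiv_on grass_on_mul grass_on_exp fermion_pairing_props)
  show "fermion_fourier n a S = 0"
  \<comment> \<open>The shift sends the index 0 to \<open>2*n\<close>, an integrated variable, where
    the last derivative gives 0. An index above \<open>2*n\<close> is moved out of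
    \<open>{1..4*n}\<close>; for \<open>n = 0\<close> the index 0 stays outside the empty
    range.\<close>
  proof (cases "0 \<in> S \<and> n > 0")
    case True
    then have "2*n \<in> ?S" by force
    moreover have "[1..<2*n + 1] = [1..<2*n] @ [2*n]" using True by simp
    ultimately have "fold gderiv [1..<2*n + 1] ?g ?S = 0" by (simp add: gderiv_def)
    then show ?thesis by (simp add: fermion_fourier_def berezin_def gscale_eval)
  next
    case False
    then obtain s where "s \<in> S" "s > 2*n \<or> (n = 0 \<and> s = 0)"
      using S by (metis One_nat_def Suc_leI atLeastAtMost_iff gr0I not_le subsetI)
    then have "\<not> ?S \<subseteq> {1..4*n}" by (auto simp: image_subset_iff intro!: bexI[of _ s])
    then show ?thesis
      using grass_onD[OF on] by (simp add: fermion_fourier_def berezin_def gscale_eval)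
  qed
qed

text \<open>The integrated variables contribute \<open>2*n\<close> to the count, an even
  number.\<close>

lemma card_below_shift:
  fixes n w :: nat
  assumes "S \<subseteq> {1..2*n}" "w \<in> {1..2*n}"
  shows "(-1::complex) ^ card {u \<in> {1..2*n} \<union> (\<lambda>j. 2*n + j) ` S. u < 2*n + w} = (-1) ^ card {u \<in> S. u < w}"
proof -
  have eq: "{u \<in> {1..2*n} \<union> (\<lambda>j. 2*n + j) ` S. u < 2*n + w} = {1..2*n} \<union> (\<lambda>j. 2*n + j) ` {u \<in> S. u < w}"
    using assms by auto
  have "finite S" using assms finite_subset by blast
  then have "card ({1..2*n} \<union> (\<lambda>j. 2*n + j) ` {u \<in> S. u < w}) = 2*n + card {u \<in> S. u < w}"
    using assms by (subst card_Un_disjoint) (auto simp: card_image)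
  then show ?thesis unfolding eq by (simp add: power_add)
qed

text \<open>Multiplication by a variable of the second set, and differentiation in it, pass an even
  number of Berezin derivatives and so cross the integral without a sign.\<close>

lemma fermion_fourier_shift:
  assumes "S \<subseteq> {1..2*n}" "w \<in> {1..2*n}"
  shows "gmul (ggen w) (fermion_fourier n a) S = 1 / of_real pi ^ n *
      gmul (ggen (2*n + w)) (gmul (gexp (fermion_pairing n)) a) ({1..2*n} \<union> (\<lambda>j. 2*n + j) ` S)" (is ?mul)
    and "gderiv w (fermion_fourier n a) S = 1 / of_real pi ^ n *
      gderiv (2*n + w) (gmul (gexp (fermion_pairing n)) a) ({1..2*n} \<union> (\<lambda>j. 2*n + j) ` S)" (is ?deriv)
proof -
  let ?U = "{1..2*n} \<union> (\<lambda>j. 2*n + j) ` S"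
  have fin: "finite S" "finite ?U" using assms finite_subset by auto
  have mem: "2*n + w \<in> ?U \<longleftrightarrow> w \<in> S" using assms by auto
  have rem: "?U - {2*n + w} = {1..2*n} \<union> (\<lambda>j. 2*n + j) ` (S - {w})" using assms by auto
  have ins: "insert (2*n + w) ?U = {1..2*n} \<union> (\<lambda>j. 2*n + j) ` (insert w S)" by auto
  have "S - {w} \<subseteq> {1..2*n}" "insert w S \<subseteq> {1..2*n}" using assms by auto
  note ev = this[THEN fermion_fourier_eval]
  show ?mul
    unfolding gmul_gen_left[of "2*n + w"] gmul_gen_left[of w] mem rem ev card_below_shift[OF assms(1,2)]
    using fin by simp
  show ?deriv
    unfolding gderiv_def mem ins ev card_below_shift[OF assms(1,2)] by simp
qed

text \<open>Integration by parts: the Berezin integral of a derivative in an integrated variable is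
  0, and the Leibniz rule moves the derivative onto the even kernel.\<close>

lemma fermion_fourier_deriv:
  assumes "a \<in> grass_on {1..2*n}" "v \<in> {1..2*n}"
  shows "fermion_fourier n (gderiv v a) =
      gscale (- (\<i>/2) * psign v) (gmul (ggen (partner v)) (fermion_fourier n a))"
proof
  fix S
  let ?K = "gexp (fermion_pairing n)" and ?U = "{1..2*n} \<union> (\<lambda>j. 2*n + j) ` S"
  have on: "gmul (ggen (partner v)) (fermion_fourier n a) \<in> grass_on {1..2*n}"
    using assms partner_in by (intro grass_on_mul grass_on_gen fermion_fourier_on) auto
  show "fermion_fourier n (gderiv v a) S =
      gscale (- (\<i>/2) * psign v) (gmul (ggen (partner v)) (fermion_fourier n a)) S"
  proof (cases "S \<subseteq> {1..2*n}")
    case True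
    have K: "geven ?K" "gfin ?K"
      using gfin_on[OF grass_on_exp[OF fermion_pairing_props(3)]] by (simp_all add: geven_exp fermion_pairing_props)
    \<comment> \<open>\<open>?U\<close> contains \<open>v\<close>, and a derivative with respect to
      \<open>v\<close> has no coefficient at such sets.\<close>
    have "0 = gderiv v (gmul ?K a) ?U" using assms by (simp add: gderiv_def)
    also have "\<dots> = gmul (gderiv v ?K) a ?U + gmul ?K (gderiv v a) ?U"
      by (simp add: gderiv_even_mul[OF K])
    finally have "gmul ?K (gderiv v a) ?U = - gmul (gderiv v ?K) a ?U"
      by (metis add.commute add.inverse_unique)
    also have "gmul (gderiv v ?K) a ?U = \<i>/2 * psign v * gmul (ggen (2*n + partner v)) (gmul ?K a) ?U"
      unfolding gderiv_fermion_kernel(1)[OF assms(2)] gmul_scale_left gmul_assoc gscale_eval ..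
    finally have "gmul ?K (gderiv v a) ?U = - (\<i>/2 * psign v * gmul (ggen (2*n + partner v)) (gmul ?K a) ?U)" .
    then show ?thesis
      using fermion_fourier_shift(1)[OF True partner_in[OF assms(2)], of a]
      by (simp add: fermion_fourier_eval[OF True] gscale_eval)
  next
    case False
    then show ?thesis
      using grass_onD[OF on False] grass_onD[OF fermion_fourier_on[OF grass_on_deriv[OF assms(1)]] False]
      by (simp add: gscale_eval)
  qed
qed

text \<open>The factor \<open>ggen v\<close> is produced by differentiating the kernel in the
  variable of the second set conjugate to \<open>v\<close>; \<open>a\<close> contains no variables
  of that set. The constant is the inverse of \<open>\<i>/2 * psign (partner v)\<close>.\<close>

lemma fermion_fourier_gen_mul:
  assumes "a \<in> grass_on {1..2*n}" "v \<in> {1..2*n}"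
  shows "fermion_fourier n (gmul (ggen v) a) = gscale (2 * \<i> * psign v) (gderiv (partner v) (fermion_fourier n a))"
proof
  fix S
  let ?K = "gexp (fermion_pairing n)" and ?U = "{1..2*n} \<union> (\<lambda>j. 2*n + j) ` S"
  have on: "gmul (ggen v) a \<in> grass_on {1..2*n}"
    using assms by (intro grass_on_mul grass_on_gen)
  show "fermion_fourier n (gmul (ggen v) a) S =
      gscale (2 * \<i> * psign v) (gderiv (partner v) (fermion_fourier n a)) S"
  proof (cases "S \<subseteq> {1..2*n}")
    case True
    have K: "geven ?K" "gfin ?K"
      using gfin_on[OF grass_on_exp[OF fermion_pairing_props(3)]] by (simp_all add: geven_exp fermion_pairing_props)
    have p: "partner v \<in> {1..2*n}" using assms partner_in by blast
    have "gderiv (2*n + partner v) a = 0"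
    proof
      fix T
      have "\<not> insert (2*n + partner v) T \<subseteq> {1..2*n}" using p by auto
      then show "gderiv (2*n + partner v) a T = 0 T"
        using grass_onD[OF assms(1)] by (simp add: gderiv_def)
    qed
    then have "gderiv (2*n + partner v) (gmul ?K a) = gmul (gderiv (2*n + partner v) ?K) a"
      by (simp add: gderiv_even_mul[OF K])
    also have "\<dots> = gscale (- (\<i>/2 * psign v)) (gmul (gmul (ggen v) ?K) a)"
      by (simp add: gderiv_fermion_kernel(2)[OF p] partner_partner[OF assms(2)] psign_partner[OF assms(2)] gmul_scale_left)
    also have "gmul (gmul (ggen v) ?K) a = gmul ?K (gmul (ggen v) a)"
      by (simp add: gmul_assoc flip: gmul_even_commute[OF K(1)])
    finally have "gmul ?K (gmul (ggen v) a) ?U = 2 * \<i> * psign v * gderiv (2*n + partner v) (gmul ?K a) ?U"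
      by (simp add: gscale_eval psign_def)
    then show ?thesis
      using fermion_fourier_shift(2)[OF True p, of a]
      by (simp add: fermion_fourier_eval[OF True] gscale_eval)
  next
    case False
    then show ?thesis
      using grass_onD[OF grass_on_deriv[OF fermion_fourier_on[OF assms(1)]] False] grass_onD[OF fermion_fourier_on[OF on] False]
      by (simp add: gscale_eval)
  qed
qed

section \<open>The fermionic Gaussian and its transform\<close>

lemma fold_gderiv_scale: "fold gderiv xs (gscale c a) = gscale c (fold gderiv xs a)"
  by (induction xs arbitrary: a) (simp_all add: gderiv_scale)

lemma fermion_fourier_scale: "fermion_fourier n (gscale c a) = gscale c (fermion_fourier n a)"
  by (rule ext) (simp add: fermion_fourier_def berezin_def gmul_scale_right fold_gderiv_scale, simp add: gscale_eval)

text \<open>The first-order system expresses the coefficient at \<open>S\<close> through one at a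
  smaller set, so a solution is determined by its scalar part. The induction is run on the
  difference of two solutions, whose scalar part is 0.\<close>

lemma fermion_gauss_unique:
  assumes "u \<in> grass_on {1..2*n}"
    and "\<And>v. v \<in> {1..2*n} \<Longrightarrow> gderiv v u = gscale (psign v / 2) (gmul (ggen (partner v)) u)"
  shows "u = gscale (u {}) (fermion_gauss n)"
proof -
  define d where "d = u - gscale (u {}) (fermion_gauss n)"
  have on: "d \<in> grass_on {1..2*n}"
    unfolding d_def by (intro grass_on_diff grass_on_scale assms fermion_gauss_on)
  have deriv: "gderiv v d = gscale (psign v / 2) (gmul (ggen (partner v)) d)" if "v \<in> {1..2*n}" for v
  proof -
    have "d = u + gscale (- u {}) (fermion_gauss n)" by (rule ext) (simp add: d_def gscale_eval)
    then show ?thesis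
      using that by (simp add: gderiv_add gderiv_scale assms(2) gderiv_fermion_gauss gmul_add_right
        gmul_scale_right gscale_simps mult.commute)
  qed
  have "d S = 0" for S
  proof (induction "card S" arbitrary: S rule: less_induct)
    case less
    show ?case
    proof (cases "S \<subseteq> {1..2*n} \<and> S \<noteq> {}")
      case True
      then obtain v where v: "v \<in> S" "v \<in> {1..2*n}" by blast
      have fin: "finite S" using True finite_subset by blast
      have "d (S - {v} - {partner v}) = 0"
      proof (rule less)
        show "card (S - {v} - {partner v}) < card S"
          using v fin by (intro psubset_card_mono) auto
      qed
      then have "gderiv v d (S - {v}) = 0"
        using v by (simp add: deriv gscale_eval gmul_gen_left)
      then show ?thesis using v by (simp add: gderiv_def insert_absorb)
    next
      case False
      then show ?thesis
      proof (cases "S = {}")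
        case True
        then show ?thesis
          by (simp add: d_def gscale_eval fermion_gauss_def gexp_empty fermion_square_props)
      qed (use False grass_onD[OF on] in blast)
    qed
  qed
  then have "u S = gscale (u {}) (fermion_gauss n) S" for S
    by (metis d_def eq_iff_diff_eq_0 fun_diff_def)
  then show ?thesis by blast
qed

text \<open>For \<open>j = n\<close> this is the coefficient that the Berezin integral extracts. The
  first-order system in the variable \<open>2*j + 1\<close> yields one factor 1/2 for each pair of
  variables.\<close>

lemma fermion_gauss_top: "j \<le> n \<Longrightarrow> fermion_gauss n {1..2*j} = (1/2) ^ j"
proof (induction j)
  case 0
  then show ?case by (simp add: fermion_gauss_def gexp_empty gscale_eval fermion_square_props)
next
  case (Suc j)
  let ?v = "2*j + 1"
  let ?S = "{1..2*j} \<union> {2*j + 2}"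
  have v: "?v \<in> {1..2*n}" "partner ?v = 2*j + 2" "psign ?v = 1" using Suc.prems by (auto simp: partner_def psign_def)
  have "{u \<in> ?S. u < ?v} = {1..2*j}" "{u \<in> ?S. u < 2*j + 2} = {1..2*j}" "insert ?v ?S = {1..2 * Suc j}" "?S - {2*j + 2} = {1..2*j}"
    by auto
  then have "gderiv ?v (fermion_gauss n) ?S = fermion_gauss n {1..2 * Suc j}"
    "gmul (ggen (2*j + 2)) (fermion_gauss n) ?S = fermion_gauss n {1..2*j}"
    unfolding gderiv_def gmul_gen_left by simp_all
  moreover have "gderiv ?v (fermion_gauss n) ?S = 1/2 * gmul (ggen (2*j + 2)) (fermion_gauss n) ?S"
    unfolding gderiv_fermion_gauss[OF v(1)] v(2,3) gscale_eval ..
  ultimately show ?case using Suc by simp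
qed

text \<open>Every term of the exponent joins a variable of the first set to one of the second, so no
  product of variables of the first set alone survives.\<close>

lemma fermion_kernel_bosonic:
  assumes "A \<subseteq> {1..2*n}" "A \<noteq> {}"
  shows "gexp (fermion_pairing n) A = 0"
proof -
  obtain v where v: "v \<in> A" "v \<in> {1..2*n}" using assms by blast
  have "2*n + partner v \<notin> A" using assms partner_in[OF v(2)] by auto
  then have "gderiv v (gexp (fermion_pairing n)) (A - {v}) = 0"
    by (simp add: gderiv_fermion_kernel(1)[OF v(2)] gscale_eval gmul_gen_left)
  then show ?thesis using v by (simp add: gderiv_def insert_absorb)
qed

text \<open>The two exchange rules map the first-order system of \<open>fermion_gauss\<close> to
  itself, so the transform is a multiple of \<open>fermion_gauss\<close>. The factor is the scalar
  part of the transform: \<open>1 / pi ^ n\<close> from \<open>berezin\<close> times the top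
  coefficient \<open>(1/2) ^ n\<close>.\<close>

lemma fermion_fourier_gauss:
  "fermion_fourier n (fermion_gauss n) = gscale (1 / (2 * of_real pi) ^ n) (fermion_gauss n)"
proof -
  let ?\<Phi> = "fermion_fourier n (fermion_gauss n)" and ?K = "gexp (fermion_pairing n)"
  have "gderiv v ?\<Phi> = gscale (psign v / 2) (gmul (ggen (partner v)) ?\<Phi>)" if v: "v \<in> {1..2*n}" for v
  proof -
    have p: "partner v \<in> {1..2*n}" using v partner_in by blast
    have "gmul (ggen (partner v)) (fermion_gauss n) = gscale (2 * psign v) (gderiv v (fermion_gauss n))"
      by (simp add: gderiv_fermion_gauss[OF v] gscale_simps)
    then have "fermion_fourier n (gmul (ggen (partner v)) (fermion_gauss n)) =
        gscale (2 * psign v) (fermion_fourier n (gderiv v (fermion_gauss n)))"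
      by (simp only: fermion_fourier_scale)
    then have *: "gscale (2 * \<i> * psign (partner v)) (gderiv v ?\<Phi>) = gscale (- \<i>) (gmul (ggen (partner v)) ?\<Phi>)"
      by (simp add: fermion_fourier_gen_mul[OF fermion_gauss_on p] fermion_fourier_deriv[OF fermion_gauss_on v]
          partner_partner[OF v] gscale_simps) (simp add: psign_def)
    have "gderiv v ?\<Phi> = gscale (\<i> * psign v / 2) (gscale (2 * \<i> * psign (partner v)) (gderiv v ?\<Phi>))"
      by (simp add: gscale_simps psign_partner[OF v]) (simp add: psign_def gscale_simps)
    also have "\<dots> = gscale (psign v / 2) (gmul (ggen (partner v)) ?\<Phi>)"
      unfolding * by (simp add: gscale_simps psign_def)
    finally show ?thesis .
  qed
  then have "?\<Phi> = gscale (?\<Phi> {}) (fermion_gauss n)"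
    by (intro fermion_gauss_unique fermion_fourier_on fermion_gauss_on)
  moreover have "?\<Phi> {} = 1 / (2 * of_real pi) ^ n"
  proof -
    have "gmul ?K (fermion_gauss n) {1..2*n} = (\<Sum>A\<in>Pow {1..2*n}. if A = {} then fermion_gauss n {1..2*n} else 0)"
      unfolding gmul_def
      by (rule sum.cong) (auto simp: fermion_kernel_bosonic gexp_empty fermion_pairing_props)
    then show ?thesis
      using fermion_gauss_top[of n n] by (simp add: fermion_fourier_eval power_mult_distrib power_one_over)
  qed
  ultimately show ?thesis by simp
qed

section \<open>Gaussian moments on the line\<close>

text \<open>The integral over r of r^t exp(\<i> p r - v r^2/2), given by the recursion that
  integration by parts yields. In this form the derivatives in \<open>v\<close> and \<open>p\<close>
  can be found by induction, without differentiating under the integral sign.\<close>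

fun gauss_moment :: "nat \<Rightarrow> real \<Rightarrow> real \<Rightarrow> complex" where
  "gauss_moment 0 v p = of_real (sqrt (2 * pi) / sqrt v * exp (- p\<^sup>2 / (2 * v)))"
| "gauss_moment (Suc 0) v p = \<i> * of_real p / of_real v * gauss_moment 0 v p"
| "gauss_moment (Suc (Suc t)) v p =
     (of_nat (Suc t) * gauss_moment t v p + \<i> * of_real p * gauss_moment (Suc t) v p) / of_real v"

definition gauss_integrand :: "nat \<Rightarrow> real \<Rightarrow> real \<Rightarrow> real \<Rightarrow> complex" where
  "gauss_integrand t v p r = exp (\<i> * of_real (p * r)) * of_real (r ^ t * exp (- (v * r\<^sup>2 / 2)))"

lemma norm_gauss_integrand: "norm (gauss_integrand t v p r) = \<bar>r ^ t * exp (- (v * r\<^sup>2 / 2))\<bar>"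
  unfolding gauss_integrand_def by (simp only: norm_mult norm_of_real norm_exp_i_times mult_1)

lemma integrable_gauss_moment:
  fixes v :: real
  assumes "v > 0"
  shows "integrable lborel (\<lambda>r. r ^ t * exp (- (v * r\<^sup>2 / 2)))"
proof -
  have "integrable lborel (\<lambda>r. std_normal_density (0 + sqrt v * r) * (0 + sqrt v * r) ^ t)"
    using assms by (intro lborel_integrable_real_affine[OF integrable_std_normal_moment]) auto
  then have "integrable lborel (\<lambda>r. sqrt (2 * pi) / sqrt v ^ t * (std_normal_density (0 + sqrt v * r) * (0 + sqrt v * r) ^ t))"
    by (rule integrable_mult_right)
  also have "(\<lambda>r. sqrt (2 * pi) / sqrt v ^ t * (std_normal_density (0 + sqrt v * r) * (0 + sqrt v * r) ^ t)) =
      (\<lambda>r. r ^ t * exp (- (v * r\<^sup>2 / 2)))"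
    using assms by (simp add: fun_eq_iff std_normal_density_def power_mult_distrib)
  finally show ?thesis .
qed

lemma integrable_gauss_integrand:
  assumes "v > 0"
  shows "integrable lborel (gauss_integrand t v p)"
proof (rule Bochner_Integration.integrable_bound)
  show "integrable lborel (\<lambda>r. complex_of_real (r ^ t * exp (- (v * r\<^sup>2 / 2))))"
    using integrable_gauss_moment[OF assms] by (rule integrable_of_real)
  show "gauss_integrand t v p \<in> borel_measurable lborel"
    unfolding gauss_integrand_def by measurable
  show "AE r in lborel. norm (gauss_integrand t v p r) \<le> norm (complex_of_real (r ^ t * exp (- (v * r\<^sup>2 / 2))))"
    unfolding norm_gauss_integrand norm_of_real by simp
qed

lemma gauss_integral_0:
  assumes "v > 0"
  shows "(\<integral>r. gauss_integrand 0 v p r \<partial>lborel) = gauss_moment 0 v p"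
proof -
  \<comment> \<open>The substitution x = sqrt v * r turns the frequency \<open>p\<close> into
    \<open>p / sqrt v\<close> and reduces the integral to the characteristic function of the
    standard normal law.\<close>
  define s where "s = p / sqrt v"
  have "(\<integral>x. std_normal_density x *\<^sub>R iexp (s * x) \<partial>lborel) = char std_normal_distribution s"
    unfolding char_def by (subst integral_density) (auto simp: normal_density_nonneg)
  also have "\<dots> = of_real (exp (- s\<^sup>2 / 2))"
    by (simp add: char_std_normal_distribution)
  also have "s\<^sup>2 = p\<^sup>2 / v" using assms by (simp add: s_def power_divide)
  finally have 1: "(\<integral>x. std_normal_density x *\<^sub>R iexp (s * x) \<partial>lborel) = of_real (exp (- p\<^sup>2 / (2 * v)))"
    by simp
  have "(\<integral>x. std_normal_density x *\<^sub>R iexp (s * x) \<partial>lborel) =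
      \<bar>sqrt v\<bar> *\<^sub>R (\<integral>r. std_normal_density (0 + sqrt v * r) *\<^sub>R iexp (s * (0 + sqrt v * r)) \<partial>lborel)"
    using assms by (intro lborel_integral_real_affine) simp
  also have "(\<lambda>r. std_normal_density (0 + sqrt v * r) *\<^sub>R iexp (s * (0 + sqrt v * r))) =
      (\<lambda>r. (1 / sqrt (2 * pi)) *\<^sub>R gauss_integrand 0 v p r)"
    using assms by (simp add: fun_eq_iff std_normal_density_def s_def gauss_integrand_def scaleR_conv_of_real power_mult_distrib mult_ac)
  finally have "of_real (exp (- p\<^sup>2 / (2 * v))) = (sqrt v / sqrt (2 * pi)) *\<^sub>R (\<integral>r. gauss_integrand 0 v p r \<partial>lborel)"
    unfolding 1 using assms by simp
  then have "(sqrt (2 * pi) / sqrt v) *\<^sub>R of_real (exp (- p\<^sup>2 / (2 * v))) = (\<integral>r. gauss_integrand 0 v p r \<partial>lborel)"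
    using assms by simp
  then show ?thesis by (simp add: scaleR_conv_of_real)
qed

lemma gauss_integrand_tendsto:
  assumes "v > 0"
  shows "(gauss_integrand t v p \<longlongrightarrow> 0) at_top" "(gauss_integrand t v p \<longlongrightarrow> 0) at_bot"
proof -
  have "((\<lambda>r. r ^ t * exp (- (v * r\<^sup>2 / 2))) \<longlongrightarrow> 0) at_top"
    "((\<lambda>r. r ^ t * exp (- (v * r\<^sup>2 / 2))) \<longlongrightarrow> 0) at_bot"
    using assms by real_asymp+
  from this[THEN tendsto_norm_zero] show "(gauss_integrand t v p \<longlongrightarrow> 0) at_top" "(gauss_integrand t v p \<longlongrightarrow> 0) at_bot"
    unfolding tendsto_norm_zero_iff[of "gauss_integrand t v p", symmetric] norm_gauss_integrand
    by simp_all
qed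

text \<open>For \<open>t = 0\<close> the truncated \<open>t - 1\<close> does no harm because of the
  factor \<open>of_nat t\<close>; likewise in the recursions below.\<close>

lemma gauss_integrand_deriv:
  "(gauss_integrand t v p has_vector_derivative of_nat t * gauss_integrand (t - 1) v p r
    + \<i> * of_real p * gauss_integrand t v p r - of_real v * gauss_integrand (Suc t) v p r) (at r)"
proof -
  have 1: "((\<lambda>r. r ^ t * exp (- (v * r\<^sup>2 / 2))) has_real_derivative
    (of_nat t * r ^ (t - 1) * exp (- (v * r\<^sup>2 / 2)) - v * r ^ Suc t * exp (- (v * r\<^sup>2 / 2)))) (at r)"
    by (auto intro!: derivative_eq_intros simp: algebra_simps)
  have 2: "((\<lambda>r. exp (\<i> * of_real (p * r))) has_vector_derivative (\<i> * of_real p * exp (\<i> * of_real (p * r)))) (at r)"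
  proof -
    have "((\<lambda>z. exp (\<i> * of_real p * z)) has_field_derivative (\<i> * of_real p * exp (\<i> * of_real p * of_real r))) (at (of_real r))"
      by (auto intro!: derivative_eq_intros)
    from has_vector_derivative_real_field[OF this] show ?thesis by (simp add: o_def mult_ac)
  qed
  have 3: "((\<lambda>r. complex_of_real (r ^ t * exp (- (v * r\<^sup>2 / 2)))) has_vector_derivative
    of_real (of_nat t * r ^ (t - 1) * exp (- (v * r\<^sup>2 / 2)) - v * r ^ Suc t * exp (- (v * r\<^sup>2 / 2)))) (at r)"
    using 1 by (intro has_vector_derivative_of_real) (simp add: has_real_derivative_iff_has_vector_derivative)
  have f: "gauss_integrand t v p = (\<lambda>r. exp (\<i> * of_real (p * r)) * complex_of_real (r ^ t * exp (- (v * r\<^sup>2 / 2))))"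
    by (rule ext) (rule gauss_integrand_def)
  have g: "of_nat t * gauss_integrand (t - 1) v p r
    + \<i> * of_real p * gauss_integrand t v p r - of_real v * gauss_integrand (Suc t) v p r = exp (\<i> * of_real (p * r)) * of_real (of_nat t * r ^ (t - 1) * exp (- (v * r\<^sup>2 / 2)) - v * r ^ Suc t * exp (- (v * r\<^sup>2 / 2)))
      + \<i> * of_real p * exp (\<i> * of_real (p * r)) * of_real (r ^ t * exp (- (v * r\<^sup>2 / 2)))"
  proof -
    have "of_nat t * (e * of_real (a * E)) + I * (e * of_real (b * E)) - of_real v * (e * of_real (c * E)) =
        e * complex_of_real (of_nat t * a * E - v * c * E) + I * e * of_real (b * E)" for e I a b c E
      by (simp add: algebra_simps)
    then show ?thesis unfolding gauss_integrand_def by this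
  qed
  show ?thesis
    unfolding g unfolding f by (rule has_vector_derivative_mult[OF 2 3])
qed

text \<open>The derivative of the integrand integrates to 0 over the line, because the integrand
  tends to 0 at both ends.\<close>

lemma gauss_integrand_recursion:
  assumes "v > 0"
  shows "of_real v * (\<integral>r. gauss_integrand (Suc t) v p r \<partial>lborel) =
    of_nat t * (\<integral>r. gauss_integrand (t - 1) v p r \<partial>lborel) + \<i> * of_real p * (\<integral>r. gauss_integrand t v p r \<partial>lborel)"
proof -
  define g where "g r = of_nat t * gauss_integrand (t - 1) v p r + \<i> * of_real p * gauss_integrand t v p r
      - of_real v * gauss_integrand (Suc t) v p r" for r
  have int: "integrable lborel (gauss_integrand t v p)" for t
    using integrable_gauss_integrand[OF assms] .
  have g_int: "integrable lborel g"
    unfolding g_def by (intro Bochner_Integration.integrable_diff Bochner_Integration.integrable_add integrable_mult_right int)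
  have deriv: "(gauss_integrand t v p has_vector_derivative g r) (at r)" for r
    unfolding g_def by (rule gauss_integrand_deriv)
  have cont: "isCont g r" for r
    unfolding g_def by (intro continuous_intros has_vector_derivative_continuous[OF gauss_integrand_deriv])
  have "(LBINT r=-\<infinity>..\<infinity>. g r) = 0 - 0"
  proof (rule interval_integral_FTC_integrable)
    show "set_integrable lborel (einterval (-\<infinity>) \<infinity>) g"
      using g_int by (simp add: set_integrable_def)
    show "((gauss_integrand t v p \<circ> real_of_ereal) \<longlongrightarrow> 0) (at_right (-\<infinity>))"
      "((gauss_integrand t v p \<circ> real_of_ereal) \<longlongrightarrow> 0) (at_left \<infinity>)"
      using gauss_integrand_tendsto[OF assms] by (simp_all add: ereal_tendsto_simps1)
  qed (auto intro: deriv cont)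
  then have "(\<integral>r. g r \<partial>lborel) = 0"
    by (simp add: interval_lebesgue_integral_def set_lebesgue_integral_def)
  moreover have "(\<integral>r. g r \<partial>lborel) = of_nat t * (\<integral>r. gauss_integrand (t - 1) v p r \<partial>lborel)
      + \<i> * of_real p * (\<integral>r. gauss_integrand t v p r \<partial>lborel) - of_real v * (\<integral>r. gauss_integrand (Suc t) v p r \<partial>lborel)"
    unfolding g_def by (simp add: int)
  ultimately show ?thesis by simp
qed

lemma gauss_integral:
  assumes "v > 0"
  shows "(\<integral>r. gauss_integrand t v p r \<partial>lborel) = gauss_moment t v p"
  using assms
proof (induction t v p rule: gauss_moment.induct)
  case (2 v p)
  then show ?case
    using gauss_integrand_recursion[of v 0 p] by (simp add: gauss_integral_0 field_simps)
next
  case (3 t v p)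
  then show ?case
    using gauss_integrand_recursion[of v "Suc t" p] by (simp add: field_simps)
qed (simp add: gauss_integral_0)

lemma gauss_moment_recursion:
  assumes "v > 0"
  shows "of_real v * gauss_moment (Suc t) v p = of_nat t * gauss_moment (t - 1) v p + \<i> * of_real p * gauss_moment t v p"
  using gauss_integrand_recursion[OF assms] by (simp add: gauss_integral[OF assms])

text \<open>The quotient rule for the shape in which \<open>gauss_moment\<close> is built from the
  two preceding moments, with the partial derivatives kept as explicit coefficients of
  \<open>fst h\<close> and \<open>snd h\<close>.\<close>

lemma moment_step:
  fixes A B :: "real \<times> real \<Rightarrow> complex"
  assumes "v > 0"
    and "(A has_derivative (\<lambda>h. of_real (fst h) * A1 + of_real (snd h) * A2)) (at (v, p))"
    and "(B has_derivative (\<lambda>h. of_real (fst h) * B1 + of_real (snd h) * B2)) (at (v, p))"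
  shows "((\<lambda>z. (c * A z + \<i> * of_real (snd z) * B z) / of_real (fst z)) has_derivative
    (\<lambda>h. of_real (fst h) * ((c * A1 + \<i> * of_real p * B1) / of_real v - (c * A (v, p) + \<i> * of_real p * B (v, p)) / of_real v / of_real v)
      + of_real (snd h) * ((c * A2 + \<i> * of_real p * B2 + \<i> * B (v, p)) / of_real v))) (at (v, p))"
proof -
  have N: "((\<lambda>z. c * A z + (\<i> * of_real (snd z)) * B z) has_derivative
     (\<lambda>h. c * (of_real (fst h) * A1 + of_real (snd h) * A2) +
       ((\<i> * of_real (snd (v, p))) * (of_real (fst h) * B1 + of_real (snd h) * B2) + (\<i> * of_real (snd h)) * B (v, p)))) (at (v, p))"
    by (intro has_derivative_add has_derivative_mult has_derivative_mult_right has_derivative_of_real has_derivative_snd has_derivative_ident assms)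
  have "((\<lambda>z. 1 / fst z) has_derivative (\<lambda>h. - fst h / v\<^sup>2)) (at (v, p))"
    using assms(1) by (auto intro!: derivative_eq_intros simp: fun_eq_iff power2_eq_square divide_simps)
  then have r: "((\<lambda>z. complex_of_real (1 / fst z)) has_derivative (\<lambda>h. of_real (- fst h / v\<^sup>2))) (at (v, p))"
    by (rule has_derivative_of_real)
  have f: "(\<lambda>z. (c * A z + \<i> * of_real (snd z) * B z) / of_real (fst z)) =
      (\<lambda>z. (c * A z + (\<i> * of_real (snd z)) * B z) * complex_of_real (1 / fst z))"
    by simp
  show ?thesis
    unfolding f
    by (rule has_derivative_eq_rhs[OF has_derivative_mult[OF N r]])
      (use assms(1) in \<open>simp add: fun_eq_iff field_simps power2_eq_square\<close>)
qed

text \<open>Under the integral sign, d/dv brings down -r^2/2 and d/dp brings down \<i> r; these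
  shifts of the index are verified here from the recursion.\<close>

lemma has_derivative_gauss_moment:
  assumes "v > 0"
  shows "((\<lambda>z. gauss_moment t (fst z) (snd z)) has_derivative
    (\<lambda>h. of_real (fst h) * (- gauss_moment (t + 2) v p / 2) + of_real (snd h) * (\<i> * gauss_moment (t + 1) v p))) (at (v, p))"
  using assms
proof (induction t v p rule: gauss_moment.induct)
  case (1 v p)
  let ?g = "sqrt (2 * pi) / sqrt v * exp (- p\<^sup>2 / (2 * v))"
  have d1: "((\<lambda>z. sqrt (2 * pi) / sqrt (fst z)) has_derivative (\<lambda>h. - sqrt (2 * pi) / (2 * v * sqrt v) * fst h)) (at (v, p))"
  proof -
    have "((\<lambda>v. sqrt (2 * pi) / sqrt v) has_real_derivative - sqrt (2 * pi) / (2 * v * sqrt v)) (at v)"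
      using 1 by (auto intro!: derivative_eq_intros simp: divide_simps)
    then have "((\<lambda>v. sqrt (2 * pi) / sqrt v) has_derivative (\<lambda>x. - sqrt (2 * pi) / (2 * v * sqrt v) * x)) (at (fst (v, p)))"
      by (simp only: has_field_derivative_def fst_conv)
    from has_derivative_compose[OF has_derivative_fst[OF has_derivative_ident] this] show ?thesis .
  qed
  have d2: "((\<lambda>z. exp (- (snd z)\<^sup>2 / (2 * fst z))) has_derivative
      (\<lambda>h. (fst h * (p\<^sup>2 / (2 * v\<^sup>2)) - snd h * (p / v)) * exp (- p\<^sup>2 / (2 * v)))) (at (v, p))"
  proof -
    have "((\<lambda>z. - (snd z)\<^sup>2 / (2 * fst z)) has_derivative (\<lambda>h. fst h * (p\<^sup>2 / (2 * v\<^sup>2)) - snd h * (p / v))) (at (v, p))"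
      using 1 by (auto intro!: derivative_eq_intros simp: fun_eq_iff field_simps power2_eq_square)
    from has_derivative_exp[OF this] show ?thesis by (simp add: mult.commute)
  qed
  have eq: "(\<lambda>h. (sqrt (2 * pi) / sqrt v) * ((fst h * (p\<^sup>2 / (2 * v\<^sup>2)) - snd h * (p / v)) * exp (- p\<^sup>2 / (2 * v))) +
       (- sqrt (2 * pi) / (2 * v * sqrt v) * fst h) * exp (- p\<^sup>2 / (2 * v))) =
      (\<lambda>h. fst h * ((p\<^sup>2 / v - 1) / (2 * v) * ?g) - snd h * (p / v * ?g))"
    using 1 by (intro ext) (simp add: field_simps power2_eq_square)
  have "((\<lambda>z. sqrt (2 * pi) / sqrt (fst z) * exp (- (snd z)\<^sup>2 / (2 * fst z))) has_derivative
      (\<lambda>h. fst h * ((p\<^sup>2 / v - 1) / (2 * v) * ?g) - snd h * (p / v * ?g))) (at (v, p))"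
    using has_derivative_mult[OF d1 d2] by (simp only: eq fst_conv snd_conv)
  note real_deriv = this
  have "((\<lambda>z. gauss_moment 0 (fst z) (snd z)) has_derivative
      (\<lambda>h. complex_of_real (fst h * ((p\<^sup>2 / v - 1) / (2 * v) * ?g) - snd h * (p / v * ?g)))) (at (v, p))"
    unfolding gauss_moment.simps(1) by (rule has_derivative_of_real[OF real_deriv])
  moreover have "gauss_moment (0 + 2) v p = - (p\<^sup>2 / v - 1) / v * of_real ?g"
    "gauss_moment (0 + 1) v p = \<i> * p / v * of_real ?g"
    using 1 by (simp_all add: numeral_2_eq_2 field_simps power2_eq_square)
  moreover from this have "(\<lambda>h. complex_of_real (fst h * ((p\<^sup>2 / v - 1) / (2 * v) * ?g) - snd h * (p / v * ?g))) =
      (\<lambda>h. of_real (fst h) * (- gauss_moment (0 + 2) v p / 2) + of_real (snd h) * (\<i> * gauss_moment (0 + 1) v p))"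
    using 1 by (intro ext) (simp add: field_simps)
  ultimately show ?case by (simp only:)
next
  case (2 v p)
  have F: "gauss_moment (Suc (Suc (Suc 0))) v p = (2 * gauss_moment (Suc 0) v p + \<i> * p * gauss_moment (Suc (Suc 0)) v p) / v"
    "gauss_moment (Suc (Suc 0)) v p = (gauss_moment 0 v p + \<i> * p * gauss_moment (Suc 0) v p) / v"
    "gauss_moment (Suc 0) v p = \<i> * of_real p / of_real v * gauss_moment 0 v p"
    by (simp_all add: numeral_2_eq_2 del: gauss_moment.simps(1))
  have T: "0 + 2 = Suc (Suc 0)" "0 + 1 = Suc 0" "Suc 0 + 2 = Suc (Suc (Suc 0))" "Suc 0 + 1 = Suc (Suc 0)" by simp_all
  \<comment> \<open>The case \<open>Suc 0\<close> is brought into the shape of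
    \<open>moment_step\<close>, with a first summand multiplied by 0.\<close>
  have "(\<lambda>z. gauss_moment (Suc 0) (fst z) (snd z)) =
      (\<lambda>z. (0 * gauss_moment 0 (fst z) (snd z) + \<i> * of_real (snd z) * gauss_moment 0 (fst z) (snd z)) / of_real (fst z))"
    by (simp del: gauss_moment.simps(1))
  then show ?case
    apply (elim ssubst)
    apply (rule has_derivative_eq_rhs[OF moment_step[OF 2(2) 2(1)[OF 2(2)] 2(1)[OF 2(2)], of 0]])
    unfolding T F fst_conv snd_conv
    using 2(2) by (simp add: fun_eq_iff field_simps del: gauss_moment.simps)
next
  case (3 t v p)
  have F: "gauss_moment (Suc (Suc t) + 2) v p = (of_nat (Suc (Suc (Suc t))) * gauss_moment (Suc (Suc t)) v p + \<i> * p * gauss_moment (Suc (Suc (Suc t))) v p) / v"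
    "gauss_moment (Suc (Suc t) + 1) v p = (of_nat (Suc (Suc t)) * gauss_moment (Suc t) v p + \<i> * p * gauss_moment (Suc (Suc t)) v p) / v"
    by (simp_all only: add_2_eq_Suc' add_Suc_right add_0_right One_nat_def gauss_moment.simps(3))
  have T: "t + 2 = Suc (Suc t)" "t + 1 = Suc t" "Suc t + 2 = Suc (Suc (Suc t))" "Suc t + 1 = Suc (Suc t)" by simp_all
  show ?case
    unfolding gauss_moment.simps(3)[of t "fst z" "snd z" for z]
    apply (rule has_derivative_eq_rhs[OF moment_step[OF 3(3) 3(1,2)[OF 3(3)], of "of_nat (Suc t)"]])
    unfolding F T fst_conv snd_conv gauss_moment.simps(3)[of t v p, symmetric]
    using 3(3) by (simp add: fun_eq_iff field_simps del: gauss_moment.simps)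
qed

text \<open>Differentiation in \<open>p\<close> multiplies by \<i> and raises the index, so at
  \<open>v = 1\<close> the moments are, up to powers of \<i> and the constant sqrt(2 pi), the
  successive derivatives of the Gaussian.\<close>

lemma hermite_gauss_moment:
  "gauss_moment t 1 p = of_real (sqrt (2 * pi)) * \<i> ^ t * of_real (hermite t p * exp (- p\<^sup>2 / 2))"
proof -
  define c where "c t p = \<i> ^ t * gauss_moment t 1 p / of_real (sqrt (2 * pi))" for t p
  have d: "(c t has_vector_derivative c (Suc t) p) (at p)" for t p
  proof -
    have "((\<lambda>p. gauss_moment t 1 p) has_derivative (\<lambda>h. of_real h * (\<i> * gauss_moment (t + 1) 1 p))) (at p)"
      using has_derivative_compose[OF has_derivative_Pair[OF has_derivative_const has_derivative_ident]
          has_derivative_gauss_moment[of 1 t p]]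
      by simp
    then have "(gauss_moment t 1 has_vector_derivative (\<i> * gauss_moment (t + 1) 1 p)) (at p)"
      by (simp add: has_vector_derivative_def scaleR_conv_of_real)
    from has_vector_derivative_mult_right[OF this, of "\<i> ^ t / of_real (sqrt (2 * pi))"] show ?thesis
      by (simp add: mult_ac c_def[abs_def])
  qed
  \<comment> \<open>\<open>hermite\<close> is built from derivatives of real functions, so the
    moments enter through their real parts, and the vanishing of the imaginary parts is carried
    along in the induction.\<close>
  have "(deriv ^^ t) (\<lambda>q. exp (- (q\<^sup>2) / 2)) = (\<lambda>p. Re (c t p)) \<and> (\<forall>p. Im (c t p) = 0)"
  proof (induction t)
    case 0
    show ?case by (simp add: c_def)
  next
    case (Suc t)
    have "((\<lambda>p. Re (c t p)) has_real_derivative Re (c (Suc t) p)) (at p)" for p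
      using bounded_linear.has_vector_derivative[OF bounded_linear_Re d]
      by (simp only: has_real_derivative_iff_has_vector_derivative)
    moreover have "Im (c (Suc t) p) = 0" for p
    proof -
      have "((\<lambda>p. Im (c t p)) has_real_derivative Im (c (Suc t) p)) (at p)"
        using bounded_linear.has_vector_derivative[OF bounded_linear_Im d]
        by (simp only: has_real_derivative_iff_has_vector_derivative)
      moreover have "((\<lambda>p. Im (c t p)) has_real_derivative 0) (at p)"
        using Suc by simp
      ultimately show ?thesis by (rule DERIV_unique)
    qed
    ultimately show ?case using Suc by (auto simp: DERIV_imp_deriv)
  qed
  then have "of_real ((deriv ^^ t) (\<lambda>q. exp (- (q\<^sup>2) / 2)) p) = c t p"
    by (simp add: complex_eq_iff)
  then have "of_real ((deriv ^^ t) (\<lambda>q. exp (- (q\<^sup>2) / 2)) p) = \<i> ^ t * gauss_moment t 1 p / of_real (sqrt (2 * pi))"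
    by (simp only: c_def)
  then have "gauss_moment t 1 p = of_real (sqrt (2 * pi)) * (- \<i>) ^ t * of_real ((deriv ^^ t) (\<lambda>q. exp (- (q\<^sup>2) / 2)) p)"
    by (simp add: flip: power_mult_distrib mult.assoc)
  moreover have "(- \<i>) ^ t = \<i> ^ t * (-1) ^ t" by (simp flip: power_mult_distrib)
  moreover have "hermite t p * exp (- p\<^sup>2 / 2) = (-1) ^ t * (deriv ^^ t) (\<lambda>q. exp (- (q\<^sup>2) / 2)) p"
    by (simp add: hermite_def exp_minus field_simps)
  ultimately show ?thesis by simp
qed

section \<open>Complex polynomials on Euclidean space and their Gaussian integrals\<close>

text \<open>Generated by monomials and sums, so that a linear statement need only be checked on
  monomials, whose Gaussian integrals factor into one-dimensional moments.\<close>

inductive cpoly :: "(real^'m::finite \<Rightarrow> complex) \<Rightarrow> bool" where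
  monomial: "cpoly (\<lambda>x. c * (\<Prod>i\<in>UNIV. of_real (x $ i) ^ \<alpha> i))"
| add: "cpoly p \<Longrightarrow> cpoly q \<Longrightarrow> cpoly (\<lambda>x. p x + q x)"

definition pd :: "'m::finite \<Rightarrow> (real^'m \<Rightarrow> complex) \<Rightarrow> real^'m \<Rightarrow> complex" where
  "pd i p x = vector_derivative (\<lambda>t. p (x + t *\<^sub>R axis i 1)) (at 0)"

lemma prod_upd:
  fixes f :: "'m::finite \<Rightarrow> nat \<Rightarrow> 'a::comm_monoid_mult"
  shows "(\<Prod>l\<in>UNIV. f l ((\<alpha>(i := k)) l)) = f i k * (\<Prod>l\<in>UNIV - {i}. f l (\<alpha> l))"
proof -
  have "(\<Prod>l\<in>UNIV. f l ((\<alpha>(i := k)) l)) = f i ((\<alpha>(i := k)) i) * (\<Prod>l\<in>UNIV - {i}. f l ((\<alpha>(i := k)) l))"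
    by (rule prod.remove) auto
  also have "(\<Prod>l\<in>UNIV - {i}. f l ((\<alpha>(i := k)) l)) = (\<Prod>l\<in>UNIV - {i}. f l (\<alpha> l))"
    by (rule prod.cong) auto
  finally show ?thesis by simp
qed

lemma prod_split:
  fixes f :: "'m::finite \<Rightarrow> 'a::comm_monoid_mult"
  shows "(\<Prod>l\<in>UNIV. f l) = f i * (\<Prod>l\<in>UNIV - {i}. f l)"
  by (rule prod.remove) auto

lemma cpoly_const: "cpoly (\<lambda>x. c)"
  using cpoly.monomial[of c "\<lambda>_. 0"] by simp

lemma cpoly_scale: "cpoly p \<Longrightarrow> cpoly (\<lambda>x. c * p x)"
proof (induction rule: cpoly.induct)
  case (monomial d \<alpha>)
  then show ?case using cpoly.monomial[of "c * d" \<alpha>] by (simp add: mult.assoc)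
next
  case (add p q)
  then show ?case using cpoly.add by (simp add: ring_distribs)
qed

lemma cpoly_coord: "cpoly p \<Longrightarrow> cpoly (\<lambda>x. of_real (x $ i) * p x)"
proof (induction rule: cpoly.induct)
  case (monomial d \<alpha>)
  have "(\<lambda>x. of_real (x $ i) * (d * (\<Prod>l\<in>UNIV. of_real (x $ l) ^ \<alpha> l))) =
      (\<lambda>x. d * (\<Prod>l\<in>UNIV. of_real (x $ l) ^ (\<alpha>(i := Suc (\<alpha> i))) l))"
    unfolding prod_upd by (simp add: prod_split[of _ i] mult_ac)
  then show ?case by (simp only: cpoly.monomial)
next
  case (add p q)
  then show ?case using cpoly.add by (simp add: ring_distribs)
qed

lemma cpoly_sum: "(\<And>i. i \<in> I \<Longrightarrow> cpoly (p i)) \<Longrightarrow> cpoly (\<lambda>x. \<Sum>i\<in>I. p i x)"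
  by (induction I rule: infinite_finite_induct) (auto intro: cpoly_const cpoly.add)

lemma cpoly_coord_power: "cpoly p \<Longrightarrow> cpoly (\<lambda>x. of_real (x $ i) ^ k * p x)"
  by (induction k) (auto simp: mult.assoc intro: cpoly_coord)

lemma cpoly_mult:
  assumes "cpoly p" "cpoly q"
  shows "cpoly (\<lambda>x. p x * q x)"
  using assms(1)
proof (induction rule: cpoly.induct)
  case (monomial c \<alpha>)
  have "cpoly (\<lambda>x. (\<Prod>l\<in>L. of_real (x $ l) ^ \<alpha> l) * q x)" for L
    by (induction L rule: infinite_finite_induct) (auto simp: mult.assoc assms intro: cpoly_coord_power)
  from cpoly_scale[OF this, of c] show ?case by (simp add: mult.assoc)
next
  case (add p p')
  then show ?case using cpoly.add by (simp add: ring_distribs)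
qed

lemma cpoly_of_real_polynomial:
  assumes "real_polynomial_function p"
  shows "cpoly (\<lambda>x::real^'m::finite. of_real (p x))"
  using assms
proof (induction rule: real_polynomial_function.induct)
  case (linear f)
  have "f x = (\<Sum>i\<in>UNIV. x $ i * f (axis i 1))" for x :: "real^'m"
  proof -
    have "x = (\<Sum>i\<in>UNIV. (x $ i) *\<^sub>R axis i 1)"
      by (simp add: vec_eq_iff axis_def if_distrib[of "\<lambda>y. _ * y"] cong: if_cong)
    then have "f x = f (\<Sum>i\<in>UNIV. (x $ i) *\<^sub>R axis i 1)" by simp
    also have "\<dots> = (\<Sum>i\<in>UNIV. x $ i * f (axis i 1))"
      using bounded_linear.linear[OF linear] by (simp add: linear_sum linear_scale)
    finally show ?thesis .
  qed
  then have "complex_of_real (f x) = (\<Sum>i\<in>UNIV. of_real (x $ i) * of_real (f (axis i 1)))" for x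
    using arg_cong[of _ _ complex_of_real] by (metis (no_types, lifting) of_real_mult of_real_sum sum.cong)
  then have "(\<lambda>x. complex_of_real (f x)) = (\<lambda>x. \<Sum>i\<in>UNIV. of_real (x $ i) * of_real (f (axis i 1)))"
    by blast
  moreover have "cpoly (\<lambda>x. \<Sum>i\<in>UNIV. complex_of_real (x $ i) * of_real (f (axis i 1)))"
    by (intro cpoly_sum cpoly_coord cpoly_const)
  ultimately show ?case by simp
next
  case (mult f g)
  then show ?case by (simp add: cpoly_mult)
qed (simp_all add: cpoly_const cpoly.add)

lemma cpoly_polynomial_function:
  assumes "polynomial_function (p :: real^'m::finite \<Rightarrow> complex)"
  shows "cpoly p"
proof -
  have "real_polynomial_function (\<lambda>x. Re (p x))" "real_polynomial_function (\<lambda>x. Im (p x))"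
    using assms bounded_linear_Re bounded_linear_Im unfolding polynomial_function_def by (auto simp: o_def)
  then have "cpoly (\<lambda>x. of_real (Re (p x)) + \<i> * of_real (Im (p x)))"
    by (intro cpoly.add cpoly_scale cpoly_of_real_polynomial)
  then show ?thesis by (simp add: complex_eq[symmetric])
qed

lemma monomial_deriv:
  fixes c :: complex and x :: "real^'m::finite"
  shows "((\<lambda>t. c * (\<Prod>l\<in>UNIV. of_real ((x + t *\<^sub>R axis i 1) $ l) ^ \<alpha> l)) has_vector_derivative
    c * of_nat (\<alpha> i) * (\<Prod>l\<in>UNIV. of_real (x $ l) ^ (\<alpha>(i := \<alpha> i - 1)) l)) (at 0)"
proof -
  have "(\<lambda>t. c * (\<Prod>l\<in>UNIV. of_real ((x + t *\<^sub>R axis i 1) $ l) ^ \<alpha> l)) =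
      (\<lambda>t. c * (\<Prod>l\<in>UNIV - {i}. of_real (x $ l) ^ \<alpha> l) * of_real ((x $ i + t) ^ \<alpha> i))"
    by (simp add: prod_split[of _ i] axis_def mult_ac)
  moreover have "((\<lambda>t. (x $ i + t) ^ \<alpha> i) has_real_derivative of_nat (\<alpha> i) * (x $ i) ^ (\<alpha> i - 1)) (at 0)"
    by (auto intro!: derivative_eq_intros)
  then have "((\<lambda>t. complex_of_real ((x $ i + t) ^ \<alpha> i)) has_vector_derivative of_real (of_nat (\<alpha> i) * (x $ i) ^ (\<alpha> i - 1))) (at 0)"
    by (intro has_vector_derivative_of_real) (simp add: has_real_derivative_iff_has_vector_derivative)
  from has_vector_derivative_mult_right[OF this, of "c * (\<Prod>l\<in>UNIV - {i}. of_real (x $ l) ^ \<alpha> l)"]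
  have "((\<lambda>t. c * (\<Prod>l\<in>UNIV - {i}. of_real (x $ l) ^ \<alpha> l) * of_real ((x $ i + t) ^ \<alpha> i)) has_vector_derivative
      c * of_nat (\<alpha> i) * (\<Prod>l\<in>UNIV. of_real (x $ l) ^ (\<alpha>(i := \<alpha> i - 1)) l)) (at 0)"
    unfolding prod_upd[of "\<lambda>l k. of_real (x $ l) ^ k"] by (simp add: mult_ac)
  ultimately show ?thesis by simp
qed

lemma pd_monomial:
  "pd i (\<lambda>x. c * (\<Prod>l\<in>UNIV. of_real (x $ l) ^ \<alpha> l)) =
    (\<lambda>x. c * of_nat (\<alpha> i) * (\<Prod>l\<in>UNIV. of_real (x $ l) ^ (\<alpha>(i := \<alpha> i - 1)) l))"
  unfolding pd_def by (rule ext) (rule vector_derivative_at[OF monomial_deriv])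

lemma cpoly_pd:
  assumes "cpoly p"
  shows "((\<lambda>t. p (x + t *\<^sub>R axis i 1)) has_vector_derivative pd i p x) (at 0)" (is ?d)
    and "cpoly (pd i p)"
proof -
  have "(\<forall>x. ((\<lambda>t. p (x + t *\<^sub>R axis i 1)) has_vector_derivative pd i p x) (at 0)) \<and> cpoly (pd i p)"
    using assms
  proof (induction rule: cpoly.induct)
    case (monomial c \<alpha>)
    show ?case unfolding pd_monomial by (intro conjI allI monomial_deriv cpoly.monomial)
  next
    case (add p q)
    then have d: "((\<lambda>t. p (x + t *\<^sub>R axis i 1) + q (x + t *\<^sub>R axis i 1)) has_vector_derivative pd i p x + pd i q x) (at 0)" for x
      by (intro has_vector_derivative_add) auto
    then have "pd i (\<lambda>x. p x + q x) = (\<lambda>x. pd i p x + pd i q x)"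
      unfolding pd_def by (intro ext vector_derivative_at) (simp add: pd_def)
    then show ?case using d add by (auto intro: cpoly.add)
  qed
  then show ?d "cpoly (pd i p)" by auto
qed

lemma pd_eqI: "(\<And>x. ((\<lambda>t. p (x + t *\<^sub>R axis i 1)) has_vector_derivative p' x) (at 0)) \<Longrightarrow> pd i p = p'"
  unfolding pd_def by (rule ext) (rule vector_derivative_at)

lemma pd_add: "cpoly p \<Longrightarrow> cpoly q \<Longrightarrow> pd i (\<lambda>x. p x + q x) = (\<lambda>x. pd i p x + pd i q x)"
  by (intro pd_eqI has_vector_derivative_add cpoly_pd)

lemma pd_scale: "cpoly p \<Longrightarrow> pd i (\<lambda>x. c * p x) = (\<lambda>x. c * pd i p x)"
  by (intro pd_eqI has_vector_derivative_mult_right cpoly_pd)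

lemma pd_const: "pd i (\<lambda>x. c) = (\<lambda>x. 0)"
  by (intro pd_eqI) simp

lemma pd_sum: "(\<And>j. j \<in> I \<Longrightarrow> cpoly (p j)) \<Longrightarrow> pd i (\<lambda>x. \<Sum>j\<in>I. p j x) = (\<lambda>x. \<Sum>j\<in>I. pd i (p j) x)"
  by (intro pd_eqI has_vector_derivative_sum cpoly_pd)

lemma coord_deriv:
  "((\<lambda>t. complex_of_real ((x + t *\<^sub>R axis i 1) $ l)) has_vector_derivative (if l = i then 1 else 0)) (at 0)"
proof -
  have "((\<lambda>t. (x + t *\<^sub>R axis i 1) $ l) has_real_derivative (if l = i then 1 else 0)) (at 0)"
    by (auto intro!: derivative_eq_intros simp: axis_def)
  from has_vector_derivative_of_real[OF this] show ?thesis by (simp split: if_splits)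
qed

lemma pd_coord:
  assumes "cpoly p"
  shows "pd i (\<lambda>x. of_real (x $ l) * p x) = (\<lambda>x. of_real (x $ l) * pd i p x + (if l = i then p x else 0))"
proof (rule pd_eqI)
  fix x
  show "((\<lambda>t. of_real ((x + t *\<^sub>R axis i 1) $ l) * p (x + t *\<^sub>R axis i 1)) has_vector_derivative
      of_real (x $ l) * pd i p x + (if l = i then p x else 0)) (at 0)"
    using has_vector_derivative_mult[OF coord_deriv cpoly_pd(1)[OF assms], of x i l x i]
    by (simp split: if_splits)
qed

lemma pd_commute:
  assumes "cpoly p"
  shows "pd i (pd l p) = pd l (pd i p)"
  using assms
proof (induction rule: cpoly.induct)
  case (monomial c \<alpha>)
  show ?case
  proof (cases "i = l")
    case False
    then show ?thesis
      by (simp only: pd_monomial fun_upd_other[OF False] fun_upd_other[OF False[symmetric]])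
        (simp only: fun_upd_twist[OF False] mult_ac)
  qed simp
next
  case (add p q)
  then show ?case by (simp add: pd_add cpoly_pd)
qed

section \<open>Gaussian integrals of polynomials in several variables\<close>

lemma lborel_prod_integral:
  fixes g :: "'m::finite \<Rightarrow> real \<Rightarrow> complex"
  assumes int: "\<And>i. integrable lborel (g i)"
  shows "integrable lborel (\<lambda>x::real^'m. \<Prod>i\<in>UNIV. g i (x $ i))" (is ?int)
    and "(\<integral>x. (\<Prod>i\<in>UNIV. g i ((x::real^'m) $ i)) \<partial>lborel) = (\<Prod>i\<in>UNIV. (\<integral>r. g i r \<partial>lborel))" (is ?eq)
proof -
  interpret product_sigma_finite "\<lambda>_::real^'m. lborel :: real measure" by standard
  \<comment> \<open>\<open>lborel\<close> on \<open>real^'m\<close> is an image of a product measure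
    indexed by the basis vectors, so the factors are re-indexed from \<open>i\<close> to
    \<open>axis i 1\<close>.\<close>
  define h where "h b = g (SOME i. b = axis i (1::real))" for b :: "real^'m"
  have h: "h (axis i 1) = g i" for i
    unfolding h_def by (metis (mono_tags, lifting) axis_eq_axis someI_ex zero_neq_one)
  have basis: "(Basis :: (real^'m) set) = range (\<lambda>i. axis i 1)"
    by (auto simp: Basis_vec_def)
  have inj: "inj (\<lambda>i. axis i (1::real) :: real^'m)"
    by (auto simp: inj_on_def axis_eq_axis)
  have prod: "(\<Prod>b\<in>Basis. F b) = (\<Prod>i\<in>UNIV. F (axis i 1))" for F :: "real^'m \<Rightarrow> complex"
    unfolding basis by (subst prod.reindex[OF inj]) simp
  have hint: "integrable lborel (h b)" if "b \<in> Basis" for b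
    using that h int unfolding basis by auto
  have coord: "(\<Sum>b\<in>Basis. f b *\<^sub>R b) $ i = f (axis i 1)" for f :: "real^'m \<Rightarrow> real" and i
    unfolding basis by (subst sum.reindex[OF inj])
      (simp add: axis_def if_distrib[of "\<lambda>y. _ * y"] cong: if_cong)
  have pull: "(\<lambda>f. \<Prod>i\<in>UNIV. g i ((\<Sum>b\<in>Basis. f b *\<^sub>R b) $ i)) = (\<lambda>f. \<Prod>b\<in>Basis. h b (f b))"
    unfolding prod by (simp only: coord h)
  have [measurable]: "g i \<in> borel_measurable borel" for i
    using borel_measurable_integrable[OF int[of i]] by simp
  have meas: "(\<lambda>x::real^'m. \<Prod>i\<in>UNIV. g i (x $ i)) \<in> borel_measurable borel"
    by measurable
  have mmap: "(\<lambda>f. \<Sum>b\<in>Basis. f b *\<^sub>R b) \<in> measurable (Pi\<^sub>M (Basis :: (real^'m) set) (\<lambda>_. lborel)) borel"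
    by measurable
  have lb: "(lborel :: (real^'m) measure) = distr (Pi\<^sub>M Basis (\<lambda>_. lborel)) borel (\<lambda>f. \<Sum>b\<in>Basis. f b *\<^sub>R b)"
    by (rule lborel_eq)
  show ?int
    unfolding lb integrable_distr_eq[OF mmap meas] pull
    by (intro product_integrable_prod hint) auto
  show ?eq
    unfolding lb integral_distr[OF mmap meas] pull
    by (subst product_integral_prod) (auto simp: hint prod h)
qed

text \<open>The commuting part of exp(\<i> <x,y>) exp(x^2/2). Both minus signs come from <x,y> and
  x^2 being the negatives of the Euclidean products there.\<close>

definition gauss_kernel :: "real^'m::finite \<Rightarrow> real^'m \<Rightarrow> complex" where
  "gauss_kernel y x = exp (- \<i> * (\<Sum>i\<in>UNIV. of_real (x $ i * y $ i))) * exp (- (\<Sum>i\<in>UNIV. of_real ((x $ i)\<^sup>2)) / 2)"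

definition gauss_fourier :: "(real^'m::finite \<Rightarrow> complex) \<Rightarrow> real^'m \<Rightarrow> complex" where
  "gauss_fourier p y = (\<integral>x. gauss_kernel y x * p x \<partial>lborel)"

lemma gauss_kernel_monomial:
  "gauss_kernel y x * (c * (\<Prod>i\<in>UNIV. of_real (x $ i) ^ \<alpha> i)) =
    c * (\<Prod>i\<in>UNIV. gauss_integrand (\<alpha> i) 1 (- y $ i) (x $ i))"
proof -
  have "gauss_kernel y x = (\<Prod>i\<in>UNIV. exp (\<i> * of_real (- (y $ i) * x $ i)) * of_real (exp (- ((x $ i)\<^sup>2 / 2))))"
  proof -
    have "exp (- \<i> * (\<Sum>i\<in>UNIV. of_real (x $ i * y $ i))) = (\<Prod>i\<in>UNIV. exp (\<i> * of_real (- (y $ i) * x $ i)))"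
      by (simp add: exp_sum[symmetric] sum_distrib_left sum_negf mult.commute)
    moreover have "exp (- (\<Sum>i\<in>UNIV. complex_of_real ((x $ i)\<^sup>2)) / 2) = (\<Prod>i\<in>UNIV. of_real (exp (- ((x $ i)\<^sup>2 / 2))))"
      by (simp add: exp_sum[symmetric] exp_of_real[symmetric] sum_divide_distrib sum_negf)
    ultimately show ?thesis by (simp add: gauss_kernel_def prod.distrib)
  qed
  then show ?thesis
    by (simp add: gauss_integrand_def prod.distrib mult_ac)
qed

lemma gauss_fourier_monomial:
  "integrable lborel (\<lambda>x. gauss_kernel y x * (c * (\<Prod>i\<in>UNIV. of_real (x $ i) ^ \<alpha> i)))"
  "gauss_fourier (\<lambda>x. c * (\<Prod>i\<in>UNIV. of_real (x $ i) ^ \<alpha> i)) y = c * (\<Prod>i\<in>UNIV. gauss_moment (\<alpha> i) 1 (- y $ i))"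
  unfolding gauss_fourier_def gauss_kernel_monomial
  by (simp_all only: integral_mult_right_zero lborel_prod_integral[OF integrable_gauss_integrand[OF zero_less_one]]
      gauss_integral[OF zero_less_one] integrable_mult_right)

lemma integrable_gauss_kernel: "cpoly p \<Longrightarrow> integrable lborel (\<lambda>x. gauss_kernel y x * p x)"
  by (induction rule: cpoly.induct) (simp_all only: gauss_fourier_monomial ring_distribs Bochner_Integration.integrable_add)

lemma gauss_fourier_add:
  "cpoly p \<Longrightarrow> cpoly q \<Longrightarrow> gauss_fourier (\<lambda>x. p x + q x) y = gauss_fourier p y + gauss_fourier q y"
  by (simp add: gauss_fourier_def ring_distribs integrable_gauss_kernel)

lemma gauss_fourier_scale: "gauss_fourier (\<lambda>x. c * p x) y = c * gauss_fourier p y"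
  by (simp add: gauss_fourier_def mult.left_commute)

lemma gauss_fourier_diff:
  "cpoly p \<Longrightarrow> cpoly q \<Longrightarrow> gauss_fourier (\<lambda>x. p x - q x) y = gauss_fourier p y - gauss_fourier q y"
  by (simp add: gauss_fourier_def ring_distribs integrable_gauss_kernel)

lemma coord_monomial:
  "(\<lambda>x::real^'m::finite. of_real (x $ i) * (c * (\<Prod>l\<in>UNIV. of_real (x $ l) ^ \<alpha> l))) =
    (\<lambda>x. c * (\<Prod>l\<in>UNIV. complex_of_real (x $ l) ^ (\<alpha>(i := Suc (\<alpha> i))) l))"
  unfolding prod_upd by (simp add: prod_split[of _ i] mult_ac)

lemma gauss_moment_line_deriv:
  "((\<lambda>s. gauss_moment t 1 (- (r + s))) has_vector_derivative (- \<i> * gauss_moment (Suc t) 1 (- r))) (at 0)"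
proof -
  have "((\<lambda>s. (1::real, - (r + s))) has_derivative (\<lambda>h. (0, - h))) (at 0)"
    by (auto intro!: derivative_eq_intros)
  moreover have "((\<lambda>z. gauss_moment t (fst z) (snd z)) has_derivative
      (\<lambda>h. of_real (fst h) * (- gauss_moment (t + 2) 1 (- r) / 2) + of_real (snd h) * (\<i> * gauss_moment (t + 1) 1 (- r)))) (at (1, - (r + 0)))"
    using has_derivative_gauss_moment[of 1 t "- r"] by (simp del: gauss_moment.simps)
  ultimately show ?thesis
    using has_derivative_compose[of "\<lambda>s. (1::real, - (r + s))" _ 0 UNIV]
    by (fastforce simp: has_vector_derivative_def scaleR_conv_of_real simp del: gauss_moment.simps)
qed

text \<open>On monomials the transform is a product of moments at \<open>p = - y $ i\<close>, whose
  derivative in \<open>p\<close> is known; so no limit is taken under the integral.\<close>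

lemma gauss_fourier_line_deriv:
  assumes "cpoly p"
  shows "((\<lambda>t. gauss_fourier p (y + t *\<^sub>R axis i 1)) has_vector_derivative
    (- \<i> * gauss_fourier (\<lambda>x. of_real (x $ i) * p x) y)) (at 0)"
  using assms
proof (induction rule: cpoly.induct)
  case (monomial c \<alpha>)
  have "(\<lambda>t. c * (\<Prod>l\<in>UNIV. gauss_moment (\<alpha> l) 1 (- (y + t *\<^sub>R axis i 1) $ l))) =
      (\<lambda>t. c * (\<Prod>l\<in>UNIV - {i}. gauss_moment (\<alpha> l) 1 (- y $ l)) * gauss_moment (\<alpha> i) 1 (- (y $ i + t)))"
    by (simp add: prod_split[of _ i] axis_def mult_ac)
  then show ?case
    unfolding coord_monomial gauss_fourier_monomial prod_upd[of "\<lambda>l k. gauss_moment k 1 (- y $ l)"]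
    using has_vector_derivative_mult_right[OF gauss_moment_line_deriv[of "\<alpha> i" "y $ i"], of "c * (\<Prod>l\<in>UNIV - {i}. gauss_moment (\<alpha> l) 1 (- y $ l))"]
    by (simp add: mult_ac)
next
  case (add p q)
  then show ?case
    using has_vector_derivative_add[OF add.IH]
    by (simp add: gauss_fourier_add cpoly_coord ring_distribs)
qed

text \<open>The polynomial on the left is what the derivative in x_i makes of \<open>p\<close> times
  the Gaussian. On monomials the rule is the recursion of the moments at
  \<open>v = 1\<close>.\<close>

lemma gauss_fourier_pd:
  assumes "cpoly p"
  shows "gauss_fourier (\<lambda>x. pd i p x - of_real (x $ i) * p x) y = \<i> * of_real (y $ i) * gauss_fourier p y"
proof -
  have "gauss_fourier (pd i p) y - gauss_fourier (\<lambda>x. of_real (x $ i) * p x) y = \<i> * of_real (y $ i) * gauss_fourier p y"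
    using assms
  proof (induction rule: cpoly.induct)
    case (monomial c \<alpha>)
    have "gauss_moment (Suc (\<alpha> i)) 1 (- y $ i) = of_nat (\<alpha> i) * gauss_moment (\<alpha> i - 1) 1 (- y $ i) - \<i> * of_real (y $ i) * gauss_moment (\<alpha> i) 1 (- y $ i)"
      using gauss_moment_recursion[of 1 "\<alpha> i" "- y $ i"] by simp
    then show ?case
      unfolding coord_monomial pd_monomial gauss_fourier_monomial prod_upd[of "\<lambda>l k. gauss_moment k 1 (- y $ l)"]
        prod_split[of "\<lambda>l. gauss_moment (\<alpha> l) 1 (- y $ l)" i]
      by (simp only:) (simp add: algebra_simps del: gauss_moment.simps)
  next
    case (add p q)
    then show ?case
      by (simp add: pd_add gauss_fourier_add cpoly_pd cpoly_coord ring_distribs) (simp add: algebra_simps)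
  qed
  then show ?thesis
    using assms by (simp add: gauss_fourier_diff cpoly_pd cpoly_coord)
qed

lemma gauss_fourier_const:
  "gauss_fourier (\<lambda>x::real^'m::finite. c) y =
    c * of_real ((2 * pi) powr (real CARD('m) / 2)) * exp (- (\<Sum>i\<in>UNIV. of_real ((y $ i)\<^sup>2)) / 2)"
proof -
  have "gauss_fourier (\<lambda>x. c) y = c * (\<Prod>i\<in>UNIV. gauss_moment 0 1 (- y $ i))"
    using gauss_fourier_monomial(2)[of c "\<lambda>_. 0" y] by simp
  also have "(\<Prod>i\<in>UNIV. gauss_moment 0 1 (- y $ i)) = of_real (sqrt (2 * pi)) ^ CARD('m) * exp (- (\<Sum>i\<in>UNIV. of_real ((y $ i)\<^sup>2)) / 2)"
    by (simp add: prod.distrib exp_sum[symmetric] exp_of_real[symmetric] sum_divide_distrib sum_negf)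
  also have "complex_of_real (sqrt (2 * pi)) ^ CARD('m) = of_real ((2 * pi) powr (real CARD('m) / 2))"
    unfolding of_real_power[symmetric]
    by (simp add: powr_half_sqrt[symmetric] powr_realpow[symmetric] powr_powr)
  finally show ?thesis by (simp add: mult_ac)
qed

declare One_nat_def [simp del]

section \<open>Fourier transforms of polynomials times the Gaussian\<close>

definition spoly :: "nat \<Rightarrow> (real^'m::finite \<Rightarrow> grass) \<Rightarrow> bool" where
  "spoly n P \<longleftrightarrow> (\<forall>S. cpoly (\<lambda>x. P x S)) \<and> (\<forall>x. P x \<in> grass_on {1..2*n})"

definition super_gauss :: "nat \<Rightarrow> (real^'m::finite \<Rightarrow> grass) \<Rightarrow> real^'m \<Rightarrow> grass" where
  "super_gauss n P = (\<lambda>x. gmul (P x) (gexp (gscale (1/2) (super_square n x))))"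

text \<open>Each coefficient of a product or of \<open>fermion_fourier\<close> is a combination of
  finitely many coefficients of its argument; such a functional preserves polynomials and commutes
  with the derivatives in x. The formula is demanded on \<open>grass_on {1..2*n}\<close> only, where
  \<open>fermion_fourier\<close> vanishes at all sets outside \<open>{1..2*n}\<close>.\<close>

definition fin_functional :: "nat \<Rightarrow> (grass \<Rightarrow> complex) \<Rightarrow> bool" where
  "fin_functional n L \<longleftrightarrow> (\<exists>I c \<tau>. finite (I :: nat set set) \<and>
     (\<forall>a\<in>grass_on {1..2*n}. L a = (\<Sum>A\<in>I. c A * a (\<tau> A))))"

lemma cpoly_has_derivative:
  assumes "cpoly p"
  shows "(p has_derivative (\<lambda>h. \<Sum>i\<in>UNIV. of_real (h $ i) * pd i p x)) (at x)"
  using assms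
proof (induction rule: cpoly.induct)
  case (monomial c \<alpha>)
  have coord: "((\<lambda>x. complex_of_real (x $ l) ^ \<alpha> l) has_derivative
      (\<lambda>h. of_real (h $ l) * (of_nat (\<alpha> l) * of_real (x $ l) ^ (\<alpha> l - 1)))) (at x)" for l
  proof -
    have "((\<lambda>x. complex_of_real (x $ l)) has_derivative (\<lambda>h. of_real (h $ l))) (at x)"
      by (intro has_derivative_of_real bounded_linear_imp_has_derivative bounded_linear_vec_nth)
    from has_derivative_power[OF this, of "\<alpha> l"] show ?thesis by (simp add: mult_ac)
  qed
  have "((\<lambda>x. \<Prod>l\<in>UNIV. complex_of_real (x $ l) ^ \<alpha> l) has_derivative
      (\<lambda>h. \<Sum>l\<in>UNIV. of_real (h $ l) * (of_nat (\<alpha> l) * of_real (x $ l) ^ (\<alpha> l - 1)) *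
        (\<Prod>j\<in>UNIV - {l}. of_real (x $ j) ^ \<alpha> j))) (at x)"
    by (rule has_derivative_prod) (rule coord)
  from has_derivative_mult_right[OF this, of c] show ?case
    unfolding pd_monomial prod_upd[of "\<lambda>l k. of_real (x $ l) ^ k"]
    by (simp add: sum_distrib_left mult_ac)
next
  case (add p q)
  from has_derivative_add[OF add.IH] show ?case
    by (simp add: pd_add add.hyps ring_distribs sum.distrib)
qed

lemma spolyD: "spoly n P \<Longrightarrow> cpoly (\<lambda>x. P x S)" "spoly n P \<Longrightarrow> P x \<in> grass_on {1..2*n}"
  by (simp_all add: spoly_def)

lemma spolyI: "(\<And>S. cpoly (\<lambda>x. P x S)) \<Longrightarrow> (\<And>x. P x \<in> grass_on {1..2*n}) \<Longrightarrow> spoly n P"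
  by (simp add: spoly_def)

lemma pderiv_x_pd: "pderiv_x i P x S = pd i (\<lambda>x. P x S) x"
  by (simp add: pderiv_x_def pd_def)

lemma spoly_pderiv_x: "spoly n P \<Longrightarrow> spoly n (pderiv_x i P)"
proof (rule spolyI)
  assume P: "spoly n P"
  show "cpoly (\<lambda>x. pderiv_x i P x S)" for S
    unfolding pderiv_x_pd by (intro cpoly_pd spolyD[OF P])
  show "pderiv_x i P x \<in> grass_on {1..2*n}" for x
  proof (rule grass_onI)
    fix S assume "\<not> S \<subseteq> {1..2*n}"
    then have "(\<lambda>x. P x S) = (\<lambda>x. 0)" using grass_onD[OF spolyD(2)[OF P]] by auto
    then show "pderiv_x i P x S = 0" unfolding pderiv_x_pd by (simp add: pd_const)
  qed
qed

lemma spoly_pderiv_g: "spoly n P \<Longrightarrow> spoly n (pderiv_g v P)"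
proof (rule spolyI)
  assume P: "spoly n P"
  show "cpoly (\<lambda>x. pderiv_g v P x S)" for S
    unfolding pderiv_g_def gderiv_def
    by (cases "v \<in> S") (simp_all add: cpoly_const cpoly_scale spolyD(1)[OF P])
  show "pderiv_g v P x \<in> grass_on {1..2*n}" for x
    unfolding pderiv_g_def by (intro grass_on_deriv spolyD(2)[OF P])
qed

lemma spoly_gen: "spoly n P \<Longrightarrow> v \<in> {1..2*n} \<Longrightarrow> spoly n (\<lambda>x. gmul (ggen v) (P x))"
proof (rule spolyI)
  assume P: "spoly n P"
  show "cpoly (\<lambda>x. gmul (ggen v) (P x) S)" for S
  proof (cases "finite S \<and> v \<in> S")
    case True
    then show ?thesis unfolding gmul_gen_left by (simp add: cpoly_scale spolyD(1)[OF P])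
  next
    case False
    then have "gmul (ggen v) (P x) S = 0" for x by (auto simp: gmul_gen_left)
    then show ?thesis by (simp add: cpoly_const)
  qed
qed (intro grass_on_mul grass_on_gen spolyD)

lemma spoly_scale: "spoly n P \<Longrightarrow> spoly n (\<lambda>x. gscale c (P x))"
  unfolding spoly_def by (auto intro: grass_on_scale) (simp add: gscale_eval cpoly_scale)

lemma spoly_add: "spoly n P \<Longrightarrow> spoly n Q \<Longrightarrow> spoly n (\<lambda>x. P x + Q x)"
  unfolding spoly_def by (auto intro: grass_on_add cpoly.add)

lemma spoly_sum: "(\<And>i. i \<in> I \<Longrightarrow> spoly n (P i)) \<Longrightarrow> spoly n (\<lambda>x. \<Sum>i\<in>I. P i x)"
  unfolding spoly_def by (auto intro!: grass_on_sum cpoly_sum simp: sum_fun_eval)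

lemma spoly_coord: "spoly n P \<Longrightarrow> spoly n (\<lambda>x. gscale (of_real (x $ i)) (P x))"
  unfolding spoly_def by (auto intro: grass_on_scale) (simp add: gscale_eval cpoly_coord)

lemma spoly_diff: "spoly n P \<Longrightarrow> spoly n Q \<Longrightarrow> spoly n (\<lambda>x. P x - Q x)"
  using spoly_add[OF _ spoly_scale[of n Q "-1"], of P] by (simp add: gscale_simps)

lemmas spoly_intros = spoly_pderiv_x spoly_pderiv_g spoly_gen spoly_scale spoly_add spoly_sum spoly_coord spoly_diff

lemma fin_functional_mul: "fin_functional n (\<lambda>a. k * gmul b a U)"
proof (cases "finite U")
  case True
  then show ?thesis unfolding fin_functional_def gmul_def
    by (intro exI[of _ "Pow U"] exI[of _ "\<lambda>A. k * (reorder_sign A (U - A) * b A)"] exI[of _ "\<lambda>A. U - A"])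
      (simp add: sum_distrib_left mult.assoc)
next
  case False
  then show ?thesis unfolding fin_functional_def
    by (intro exI[of _ "{}"]) (simp add: gmul_infinite)
qed

lemma fin_functional_fourier: "fin_functional n (\<lambda>a. fermion_fourier n (gmul (fermion_gauss n) a) S)"
proof (cases "S \<subseteq> {1..2*n}")
  case True
  show ?thesis unfolding fermion_fourier_eval[OF True] gmul_assoc[symmetric] by (rule fin_functional_mul)
next
  case False
  have "fermion_fourier n (gmul (fermion_gauss n) a) S = 0" if "a \<in> grass_on {1..2*n}" for a
    using False by (rule grass_onD[OF fermion_fourier_on[OF grass_on_mul[OF fermion_gauss_on that]]])
  then show ?thesis unfolding fin_functional_def by (intro exI[of _ "{}"]) simp
qed

lemma fin_functional_poly:
  assumes "fin_functional n L" "spoly n P"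
  shows "cpoly (\<lambda>x. L (P x))" "pd i (\<lambda>x. L (P x)) = (\<lambda>x. L (pderiv_x i P x))"
proof -
  obtain I c \<tau> where L: "finite (I :: nat set set)" "\<And>a. a \<in> grass_on {1..2*n} \<Longrightarrow> L a = (\<Sum>A\<in>I. c A * a (\<tau> A))"
    using assms(1) unfolding fin_functional_def by blast
  have eq: "L (Q x) = (\<Sum>A\<in>I. c A * Q x (\<tau> A))" if "spoly n Q" for Q :: "real^'a \<Rightarrow> grass" and x
    using spolyD(2)[OF that] by (rule L)
  show "cpoly (\<lambda>x. L (P x))"
    unfolding eq[OF assms(2)] by (intro cpoly_sum cpoly_scale spolyD[OF assms(2)])
  show "pd i (\<lambda>x. L (P x)) = (\<lambda>x. L (pderiv_x i P x))"
    unfolding eq[OF assms(2)] eq[OF spoly_pderiv_x[OF assms(2)]] pderiv_x_pd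
    by (simp add: pd_sum pd_scale cpoly_scale spolyD[OF assms(2)])
qed

lemma fin_functional_linear:
  assumes "fin_functional n L" "a \<in> grass_on {1..2*n}"
  shows "L (gscale k a) = k * L a"
    and "b \<in> grass_on {1..2*n} \<Longrightarrow> L (a + b) = L a + L b"
    and "b \<in> grass_on {1..2*n} \<Longrightarrow> L (a - b) = L a - L b"
proof -
  obtain I c \<tau> where L: "finite (I :: nat set set)" "\<And>a. a \<in> grass_on {1..2*n} \<Longrightarrow> L a = (\<Sum>A\<in>I. c A * a (\<tau> A))"
    using assms(1) unfolding fin_functional_def by blast
  show "L (gscale k a) = k * L a"
    using assms(2) by (simp add: L grass_on_scale gscale_eval sum_distrib_left mult.left_commute)
  show "b \<in> grass_on {1..2*n} \<Longrightarrow> L (a + b) = L a + L b"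
    using assms(2) by (simp add: L grass_on_add ring_distribs sum.distrib)
  show "b \<in> grass_on {1..2*n} \<Longrightarrow> L (a - b) = L a - L b"
    using assms(2) by (simp add: L grass_on_diff ring_distribs sum_subtractf)
qed

lemma half_super_square:
  "gscale (1/2) (super_square n x) = gconst (- (\<Sum>i\<in>UNIV. of_real ((x $ i)\<^sup>2)) / 2) + gscale (1/2) (fermion_square n)"
  by (rule ext) (simp add: super_square_def fermion_square_def gscale_def gconst_def algebra_simps)

lemma gexp_half_super_square:
  "gexp (gscale (1/2) (super_square n x)) = gscale (exp (- (\<Sum>i\<in>UNIV. of_real ((x $ i)\<^sup>2)) / 2)) (fermion_gauss n)"
  unfolding half_super_square fermion_gauss_def
  by (rule gexp_const_add) (simp add: gscale_def fermion_square_props)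

lemma super_gauss_eq:
  "super_gauss n P x = gscale (exp (- (\<Sum>i\<in>UNIV. of_real ((x $ i)\<^sup>2)) / 2)) (gmul (fermion_gauss n) (P x))"
  unfolding super_gauss_def gexp_half_super_square gmul_scale_right
  by (simp only: gmul_even_commute[OF geven_fermion_gauss])

lemma gexp_super_pairing:
  "gexp (gscale \<i> (super_pairing n x y)) = gscale (exp (- \<i> * (\<Sum>i\<in>UNIV. of_real (x $ i * y $ i)))) (gexp (fermion_pairing n))"
proof -
  have "gscale \<i> (super_pairing n x y) = gconst (- \<i> * (\<Sum>i\<in>UNIV. of_real (x $ i * y $ i))) + fermion_pairing n"
    unfolding super_pairing_def fermion_pairing_def
    by (rule ext) (simp add: gscale_def gconst_def algebra_simps)
  then show ?thesis
    using gexp_const_add[of "fermion_pairing n", OF fermion_pairing_props(2)] by simp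
qed

definition fourier_const :: "'m::finite itself \<Rightarrow> nat \<Rightarrow> complex" where
  "fourier_const _ n = of_real ((2 * pi) powr (- of_int (superdim TYPE('m) n) / 2))"

text \<open>Kernel and Gaussian both split into a scalar exponential of the commuting variables and
  a fixed fermionic element, so the Lebesgue and the Berezin integral separate.\<close>

lemma super_fourier_super_gauss:
  fixes P :: "real^'m::finite \<Rightarrow> grass"
  shows "super_fourier n (super_gauss n P) y S =
    fourier_const TYPE('m) n * gauss_fourier (\<lambda>x. fermion_fourier n (gmul (fermion_gauss n) (P x)) S) y"
proof -
  have "berezin n (gmul (gexp (gscale \<i> (super_pairing n x y))) (super_gauss n P x)) ((\<lambda>j. 2*n + j) ` S) =
      gauss_kernel y x * fermion_fourier n (gmul (fermion_gauss n) (P x)) S" for x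
    unfolding gexp_super_pairing super_gauss_eq gmul_scale_left gmul_scale_right fermion_fourier_def gauss_kernel_def
      berezin_def fold_gderiv_scale by (simp add: gscale_eval)
  then show ?thesis
    unfolding super_fourier_def gauss_fourier_def fourier_const_def by simp
qed

lemma gauss_fourier_gen:
  "C * gauss_fourier (\<lambda>x. c * gmul (ggen w) (F x) S) y = c * gmul (ggen w) (\<lambda>S. C * gauss_fourier (\<lambda>x. F x S) y) S"
proof (cases "finite S \<and> w \<in> S")
  case True
  then show ?thesis
    unfolding gmul_gen_left mult.assoc[symmetric] by (simp add: gauss_fourier_scale)
next
  case False
  then show ?thesis
    unfolding gmul_gen_left by (auto simp: gauss_fourier_const)
qed

lemma gauss_fourier_gderiv:
  "C * gauss_fourier (\<lambda>x. c * gderiv w (F x) S) y = c * gderiv w (\<lambda>S. C * gauss_fourier (\<lambda>x. F x S) y) S"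
proof (cases "w \<in> S")
  case True
  then show ?thesis unfolding gderiv_def by (simp add: gauss_fourier_const)
next
  case False
  then show ?thesis
    unfolding gderiv_def mult.assoc[symmetric] by (simp add: gauss_fourier_scale)
qed

section \<open>Exchange rules for the super Fourier transform\<close>

lemmas fourier_poly = fin_functional_poly[OF fin_functional_fourier]
lemmas fourier_linear = fin_functional_linear[OF fin_functional_fourier]

lemma super_fourier_add:
  assumes "spoly n P" "spoly n Q"
  shows "super_fourier n (super_gauss n (\<lambda>x. P x + Q x)) y S = super_fourier n (super_gauss n P) y S + super_fourier n (super_gauss n Q) y S"
  using assms by (simp add: super_fourier_super_gauss fourier_linear spolyD gauss_fourier_add fourier_poly ring_distribs)

lemma super_fourier_scale:
  assumes "spoly n P"
  shows "super_fourier n (super_gauss n (\<lambda>x. gscale c (P x))) y S = c * super_fourier n (super_gauss n P) y S"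
  using assms by (simp add: super_fourier_super_gauss fourier_linear spolyD gauss_fourier_scale)

lemma super_fourier_zero: "super_fourier n (super_gauss n (\<lambda>x. 0)) y S = 0"
  by (simp add: super_fourier_def super_gauss_def berezin_def gscale_def)
    (metis (no_types, lifting) fold_gderiv_scale gscale_eval gscale_simps(2) integral_zero mult_zero_left)

lemma super_fourier_sum:
  assumes "\<And>i. i \<in> I \<Longrightarrow> spoly n (P i)"
  shows "super_fourier n (super_gauss n (\<lambda>x. \<Sum>i\<in>I. P i x)) y S = (\<Sum>i\<in>I. super_fourier n (super_gauss n (P i)) y S)"
  using assms
proof (induction I rule: infinite_finite_induct)
  case (insert j I)
  then have "super_fourier n (super_gauss n (\<lambda>x. P j x + (\<Sum>i\<in>I. P i x))) y S =
      super_fourier n (super_gauss n (P j)) y S + (\<Sum>i\<in>I. super_fourier n (super_gauss n (P i)) y S)"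
    by (subst super_fourier_add) (auto intro: spoly_sum)
  then show ?case unfolding sum.insert[OF insert.hyps] .
qed (simp_all only: sum.infinite sum.empty super_fourier_zero if_True not_False_eq_True)

lemma super_fourier_coord:
  assumes "spoly n P"
  shows "super_fourier n (super_gauss n (\<lambda>x. gscale (of_real (x $ i)) (P x))) y S =
    \<i> * pderiv_x i (super_fourier n (super_gauss n P)) y S"
proof -
  let ?q = "\<lambda>x. fermion_fourier n (gmul (fermion_gauss n) (P x)) S"
  have "pderiv_x i (super_fourier n (super_gauss n P)) y S =
      fourier_const TYPE('a) n * (- \<i> * gauss_fourier (\<lambda>x. of_real (x $ i) * ?q x) y)"
    unfolding pderiv_x_def super_fourier_super_gauss
    by (intro vector_derivative_at has_vector_derivative_mult_right gauss_fourier_line_deriv fourier_poly assms)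
  then show ?thesis
    using assms by (simp add: super_fourier_super_gauss fourier_linear spolyD) (simp add: algebra_simps)
qed

lemma super_fourier_pderiv_x:
  assumes "spoly n P"
  shows "super_fourier n (super_gauss n (\<lambda>x. pderiv_x i P x - gscale (of_real (x $ i)) (P x))) y S =
    \<i> * of_real (y $ i) * super_fourier n (super_gauss n P) y S"
  using assms gauss_fourier_pd[OF fourier_poly(1)[OF assms], of i S y]
  by (simp add: super_fourier_super_gauss fourier_linear spolyD spoly_intros grass_on_scale fourier_poly(2))

lemma super_fourier_gen:
  assumes "spoly n P" "v \<in> {1..2*n}"
  shows "super_fourier n (super_gauss n (\<lambda>x. gmul (ggen v) (P x))) y S =
    2 * \<i> * psign v * gderiv (partner v) (super_fourier n (super_gauss n P) y) S"
proof -
  have "gmul (fermion_gauss n) (gmul (ggen v) (P x)) = gmul (ggen v) (gmul (fermion_gauss n) (P x))" for x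
    by (simp add: gmul_assoc[symmetric] gmul_even_commute[OF geven_fermion_gauss, where b = "ggen v"])
  then have "fermion_fourier n (gmul (fermion_gauss n) (gmul (ggen v) (P x))) S =
      2 * \<i> * psign v * gderiv (partner v) (fermion_fourier n (gmul (fermion_gauss n) (P x))) S" for x
    using assms by (simp add: fermion_fourier_gen_mul grass_on_mul fermion_gauss_on spolyD gscale_eval)
  then show ?thesis
    unfolding super_fourier_super_gauss[abs_def] by (simp only: gauss_fourier_gderiv)
qed

text \<open>The derivative of \<open>fermion_gauss\<close> contributes \<open>psign v / 2\<close>
  times the partner variable: the fermionic counterpart of replacing d/dx_i by d/dx_i - x_i when the
  Gaussian is pulled out.\<close>

lemma gauss_gderiv:
  assumes "v \<in> {1..2*n}"
  shows "gderiv v (gmul (fermion_gauss n) a) =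
    gmul (fermion_gauss n) (gderiv v a + gscale (psign v / 2) (gmul (ggen (partner v)) a))"
proof -
  have "gderiv v (gmul (fermion_gauss n) a) = gmul (gderiv v (fermion_gauss n)) a + gmul (fermion_gauss n) (gderiv v a)"
    by (rule gderiv_even_mul[OF geven_fermion_gauss gfin_on[OF fermion_gauss_on finite_atLeastAtMost]])
  also have "gmul (gderiv v (fermion_gauss n)) a = gmul (fermion_gauss n) (gscale (psign v / 2) (gmul (ggen (partner v)) a))"
    unfolding gderiv_fermion_gauss[OF assms] gmul_scale_left gmul_scale_right
    by (simp add: gmul_assoc[symmetric] gmul_even_commute[OF geven_fermion_gauss, where b = "ggen (partner v)"])
  finally show ?thesis unfolding gmul_add_right by (simp only: add.commute)
qed

lemma super_fourier_pderiv_g: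
  assumes "spoly n P" "v \<in> {1..2*n}"
  shows "super_fourier n (super_gauss n (\<lambda>x. gderiv v (P x) + gscale (psign v / 2) (gmul (ggen (partner v)) (P x)))) y S =
    - (\<i> / 2) * psign v * gmul (ggen (partner v)) (super_fourier n (super_gauss n P) y) S"
proof -
  have "fermion_fourier n (gmul (fermion_gauss n) (gderiv v (P x) + gscale (psign v / 2) (gmul (ggen (partner v)) (P x)))) S =
      - (\<i> / 2) * psign v * gmul (ggen (partner v)) (fermion_fourier n (gmul (fermion_gauss n) (P x))) S" for x
    using assms by (simp only: gauss_gderiv[symmetric] fermion_fourier_deriv grass_on_mul fermion_gauss_on spolyD gscale_eval)
  then show ?thesis
    unfolding super_fourier_super_gauss[abs_def] by (simp only: gauss_fourier_gen)
qed

lemma super_gauss_pderiv_g: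
  assumes "v \<in> {1..2*n}"
  shows "gderiv v (super_gauss n P x) = super_gauss n (\<lambda>x. gderiv v (P x) + gscale (psign v / 2) (gmul (ggen (partner v)) (P x))) x"
  unfolding super_gauss_eq gderiv_scale gauss_gderiv[OF assms] ..

lemma super_gauss_pderiv_x:
  assumes "spoly n P"
  shows "pderiv_x i (super_gauss n P) = super_gauss n (\<lambda>x. pderiv_x i P x - gscale (of_real (x $ i)) (P x))"
proof (intro ext)
  fix x :: "real^'a" and S
  have L: "fin_functional n (\<lambda>a. gmul (fermion_gauss n) a S)"
    using fin_functional_mul[of n 1] by simp
  let ?q = "\<lambda>x. gmul (fermion_gauss n) (P x) S"
  let ?s = "\<Sum>l\<in>UNIV. (x $ l)\<^sup>2"
  have "((\<lambda>t. exp (- (\<Sum>l\<in>UNIV. ((x + t *\<^sub>R axis i 1) $ l)\<^sup>2) / 2)) has_real_derivative - (x $ i) * exp (- ?s / 2)) (at 0)"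
  proof -
    define c where "c = (\<Sum>l\<in>UNIV - {i}. (x $ l)\<^sup>2)"
    have 1: "(\<Sum>l\<in>UNIV. ((x + t *\<^sub>R axis i 1) $ l)\<^sup>2) = (x $ i + t)\<^sup>2 + c" for t
      unfolding c_def by (subst sum.remove[of UNIV i]) (simp_all add: axis_def)
    have 2: "?s = (x $ i)\<^sup>2 + c" unfolding c_def by (rule sum.remove) simp_all
    have "((\<lambda>t. exp (- ((x $ i + t)\<^sup>2 + c) / 2)) has_real_derivative - (x $ i) * exp (- ((x $ i)\<^sup>2 + c) / 2)) (at 0)"
      by (auto intro!: derivative_eq_intros)
    then show ?thesis unfolding 1 2 .
  qed
  then have e: "((\<lambda>t. complex_of_real (exp (- (\<Sum>l\<in>UNIV. ((x + t *\<^sub>R axis i 1) $ l)\<^sup>2) / 2))) has_vector_derivative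
      of_real (- (x $ i) * exp (- ?s / 2))) (at 0)"
    by (rule has_vector_derivative_of_real)
  have ex: "exp (- (\<Sum>l\<in>UNIV. complex_of_real ((x $ l)\<^sup>2)) / 2) = of_real (exp (- (\<Sum>l\<in>UNIV. (x $ l)\<^sup>2) / 2))" for x :: "real^'a"
    by (simp add: exp_of_real[symmetric])
  have q: "((\<lambda>t. ?q (x + t *\<^sub>R axis i 1)) has_vector_derivative gmul (fermion_gauss n) (pderiv_x i P x) S) (at 0)"
    using cpoly_pd(1)[OF fin_functional_poly(1)[OF L assms]] by (simp add: fin_functional_poly(2)[OF L assms])
  have lin: "gmul (fermion_gauss n) (pderiv_x i P x - gscale (of_real (x $ i)) (P x)) S =
      gmul (fermion_gauss n) (pderiv_x i P x) S - of_real (x $ i) * ?q x"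
    by (subst fin_functional_linear(3)[OF L spolyD(2)[OF spoly_pderiv_x[OF assms]] grass_on_scale[OF spolyD(2)[OF assms]]])
      (simp only: fin_functional_linear(1)[OF L spolyD(2)[OF assms]])
  show "pderiv_x i (super_gauss n P) x S = super_gauss n (\<lambda>x. pderiv_x i P x - gscale (of_real (x $ i)) (P x)) x S"
    unfolding pderiv_x_def[of i "super_gauss n P"] super_gauss_eq gscale_eval ex lin
    by (rule trans[OF vector_derivative_at[OF has_vector_derivative_mult[OF e q]]]) (simp add: algebra_simps)
qed

section \<open>The Fourier transform of spherical harmonics\<close>

text \<open>The fermionic Euler operator multiplies the coefficient at \<open>S\<close> by
  \<open>card S\<close>, so Euler's identity becomes one equation for each coefficient, in the
  commuting variables alone.\<close>

definition harmonic :: "nat \<Rightarrow> nat \<Rightarrow> (real^'m::finite \<Rightarrow> grass) \<Rightarrow> bool" where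
  "harmonic n k H \<longleftrightarrow> spoly n H \<and> laplace n H = 0 \<and>
     (\<forall>x S. (\<Sum>i\<in>UNIV. of_real (x $ i) * pd i (\<lambda>x. H x S) x) + of_nat (card S) * H x S = of_nat k * H x S)"

lemma gen_gderiv_diag:
  "gmul (ggen u) (gderiv u a) S = (if finite S \<and> u \<in> S then a S else 0)"
proof (cases "finite S \<and> u \<in> S")
  case True
  have "{w \<in> S - {u}. w < u} = {w \<in> S. w < u}" by auto
  then show ?thesis
    using True unfolding gmul_gen_left gderiv_def by (simp add: sign_square insert_absorb)
next
  case False
  then show ?thesis unfolding gmul_gen_left by (simp only: if_False)
qed

lemma number_operator:
  assumes "a \<in> grass_on {1..2*n}"
  shows "(\<Sum>u=1..2*n. gmul (ggen u) (gderiv u a) S) = of_nat (card S) * a S"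
proof (cases "S \<subseteq> {1..2*n}")
  case True
  then have "finite S" using finite_subset by blast
  then have "(\<Sum>u=1..2*n. gmul (ggen u) (gderiv u a) S) = (\<Sum>u\<in>{1..2*n} \<inter> S. a S)"
    unfolding gen_gderiv_diag by (subst sum.inter_restrict) simp_all
  also have "{1..2*n} \<inter> S = S" using True by auto
  finally show ?thesis by simp
next
  case False
  then have "a S = 0" using assms grass_onD by blast
  then show ?thesis unfolding gen_gderiv_diag by (simp only: if_cancel sum.neutral_const mult_zero_right)
qed

lemma spherical_harmonic_harmonic:
  assumes "spherical_harmonic n k H"
  shows "harmonic n k H"
proof -
  have on: "H x \<in> grass_on {1..2*n}" for x
    using assms unfolding spherical_harmonic_def by (intro grass_onI) blast
  have sp: "spoly n H"
    using assms on unfolding spherical_harmonic_def by (intro spolyI cpoly_polynomial_function) auto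
  have "euler_op n H x S = of_nat k * H x S" for x S
    using assms unfolding spherical_harmonic_def by (metis (no_types))
  then show ?thesis
    using assms sp unfolding harmonic_def spherical_harmonic_def euler_op_def pderiv_x_pd pderiv_g_def number_operator[OF on]
    by blast
qed

section \<open>Derivatives and homogeneity of spherical harmonics\<close>

lemma gderiv_anticommute:
  assumes "gfin a"
  shows "gderiv u (gderiv v a) = gscale (-1) (gderiv v (gderiv u a))"
proof
  fix S
  show "gderiv u (gderiv v a) S = gscale (-1) (gderiv v (gderiv u a)) S"
  proof (cases "finite S \<and> u \<noteq> v \<and> u \<notin> S \<and> v \<notin> S")
    case True
    have "card {w \<in> insert u S. w < v} = card {w \<in> S. w < v} + (if u < v then 1 else 0)"
      "card {w \<in> insert v S. w < u} = card {w \<in> S. w < u} + (if v < u then 1 else 0)"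
      using True by (intro card_below_insert; simp)+
    then show ?thesis
      using True unfolding gderiv_def gscale_eval by (cases "u < v") (simp_all add: insert_commute power_add)
  next
    case False
    then show ?thesis
      using assms unfolding gderiv_def gscale_eval gfin_def by auto
  qed
qed

lemma pderiv_x_g:
  assumes "spoly n f"
  shows "pderiv_x i (pderiv_g v f) = pderiv_g v (pderiv_x i f)"
proof (intro ext)
  fix x S
  show "pderiv_x i (pderiv_g v f) x S = pderiv_g v (pderiv_x i f) x S"
    unfolding pderiv_x_pd pderiv_g_def gderiv_def
    by (cases "v \<in> S") (simp_all add: pd_const pd_scale spolyD[OF assms])
qed

lemma laplace_eval:
  "laplace n f x S = 4 * (\<Sum>j=1..n. pderiv_g (2*j - 1) (pderiv_g (2*j) f) x S) -
     (\<Sum>i\<in>UNIV. pd i (pd i (\<lambda>x. f x S)) x)"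
  unfolding laplace_def by (simp add: pderiv_x_pd[abs_def])

lemma laplace_cpoly:
  assumes "spoly n f"
  shows "pd l (\<lambda>x. laplace n f x S) = (\<lambda>x. laplace n (pderiv_x l f) x S)"
proof -
  have c: "cpoly (\<lambda>x. pderiv_g (2*j - 1) (pderiv_g (2*j) f) x S)" for j
    by (intro spolyD(1)[of n] spoly_pderiv_g assms)
  have c2: "cpoly (\<lambda>x. pd i (pd i (\<lambda>x. f x S)) x)" for i
    by (intro cpoly_pd spolyD(1)[OF assms])
  have 1: "pd l (\<lambda>x. pderiv_g (2*j - 1) (pderiv_g (2*j) f) x S) = (\<lambda>x. pderiv_g (2*j - 1) (pderiv_g (2*j) (pderiv_x l f)) x S)" for j
    unfolding pderiv_x_pd[symmetric, abs_def] pderiv_x_g[OF spoly_pderiv_g[OF assms]] pderiv_x_g[OF assms] ..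
  have 2: "pd l (pd i (pd i (\<lambda>x. f x S))) = pd i (pd i (pd l (\<lambda>x. f x S)))" for i
    by (simp only: pd_commute[of _ l i] cpoly_pd spolyD(1)[OF assms])
  have "(\<lambda>x. laplace n f x S) = (\<lambda>x. 4 * (\<Sum>j=1..n. pderiv_g (2*j - 1) (pderiv_g (2*j) f) x S) + (-1) *
     (\<Sum>i\<in>UNIV. pd i (pd i (\<lambda>x. f x S)) x))" by (simp add: laplace_eval)
  then have "pd l (\<lambda>x. laplace n f x S) = (\<lambda>x. 4 * (\<Sum>j=1..n. pderiv_g (2*j - 1) (pderiv_g (2*j) (pderiv_x l f)) x S) + (-1) *
     (\<Sum>i\<in>UNIV. pd i (pd i (pd l (\<lambda>x. f x S))) x))"
    by (simp only: pd_add pd_scale pd_sum cpoly_scale cpoly_sum c c2 1 2)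
  then show ?thesis by (simp add: laplace_eval pderiv_x_pd[abs_def])
qed

text \<open>In each fermionic summand an odd derivative passes two others, and the two signs
  cancel.\<close>

lemma laplace_pderiv_g:
  assumes "spoly n f"
  shows "laplace n (pderiv_g v f) x = gderiv v (laplace n f x)"
proof
  fix S
  have g: "gfin (f x)" using spolyD(2)[OF assms] by (rule gfin_on) simp
  have 1: "pderiv_g a (pderiv_g b (pderiv_g v f)) x = gderiv v (pderiv_g a (pderiv_g b f) x)" for a b
  proof -
    have "gderiv a (gderiv b (gderiv v (f x))) = gderiv v (gderiv a (gderiv b (f x)))"
      unfolding gderiv_anticommute[OF g, of b v] gderiv_scale gderiv_anticommute[OF gfin_deriv[OF g], of a v]
      by (simp add: gscale_simps(1,3))
    then show ?thesis by (simp add: pderiv_g_def)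
  qed
  show "laplace n (pderiv_g v f) x S = gderiv v (laplace n f x) S"
  proof (cases "v \<in> S")
    case True
    then have "gderiv v h S = 0" "pderiv_g v f = (\<lambda>x. gderiv v (f x))" for h by (simp_all add: gderiv_def pderiv_g_def)
    then show ?thesis unfolding laplace_eval 1 by (simp add: pd_const)
  next
    case False
    then have "(\<lambda>x. pderiv_g v f x S) = (\<lambda>x. (-1) ^ card {u \<in> S. u < v} * f x (insert v S))"
      by (simp add: pderiv_g_def gderiv_def)
    then have "pd i (pd i (\<lambda>x. pderiv_g v f x S)) = (\<lambda>x. (-1) ^ card {u \<in> S. u < v} * pd i (pd i (\<lambda>x. f x (insert v S))) x)" for i
      by (simp add: pd_scale cpoly_pd spolyD(1)[OF assms])
    then show ?thesis
      using False unfolding laplace_eval 1 gderiv_def by (simp add: right_diff_distrib sum_distrib_left mult_ac)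
  qed
qed

lemma harmonicD:
  assumes "harmonic n k H"
  shows "spoly n H" "laplace n H x S = 0"
    "(\<Sum>i\<in>UNIV. of_real (x $ i) * pd i (\<lambda>x. H x S) x) + of_nat (card S) * H x S = of_nat k * H x S"
  using assms by (auto simp: harmonic_def)

text \<open>Differentiating Euler's identity yields one extra copy of the derivative, from the
  coordinate factor, which lowers the degree by one.\<close>

lemma harmonic_pderiv_x:
  assumes H: "harmonic n (Suc k) H"
  shows "harmonic n k (pderiv_x l H)"
  unfolding harmonic_def
proof (intro conjI allI)
  note sp = harmonicD(1)[OF H]
  show "spoly n (pderiv_x l H)" by (rule spoly_pderiv_x[OF sp])
  show "laplace n (pderiv_x l H) = 0"
  proof (intro ext)
    fix x S
    show "laplace n (pderiv_x l H) x S = 0 x S"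
      using fun_cong[OF laplace_cpoly[OF sp, of l S], of x] by (simp add: harmonicD(2)[OF H] pd_const)
  qed
  fix x S
  let ?h = "\<lambda>x. H x S"
  have c: "cpoly ?h" by (rule spolyD(1)[OF sp])
  have "pd l (\<lambda>x. (\<Sum>i\<in>UNIV. of_real (x $ i) * pd i ?h x) + of_nat (card S) * ?h x) = pd l (\<lambda>x. of_nat (Suc k) * ?h x)"
    using harmonicD(3)[OF H] by simp
  then have "(\<lambda>x. (\<Sum>i\<in>UNIV. of_real (x $ i) * pd l (pd i ?h) x + (if i = l then pd i ?h x else 0)) + of_nat (card S) * pd l ?h x) =
      (\<lambda>x. of_nat (Suc k) * pd l ?h x)"
    by (simp only: pd_add pd_sum pd_scale pd_coord cpoly_sum cpoly_scale cpoly_coord cpoly_pd c)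
  from fun_cong[OF this, of x]
  show "(\<Sum>i\<in>UNIV. of_real (x $ i) * pd i (\<lambda>x. pderiv_x l H x S) x) + of_nat (card S) * pderiv_x l H x S =
      of_nat k * pderiv_x l H x S"
    unfolding pderiv_x_pd[abs_def] by (simp add: sum.distrib pd_commute[OF c, of l] algebra_simps)
qed

text \<open>Up to sign, the coefficient at \<open>S\<close> is that of \<open>H\<close> at
  \<open>insert v S\<close>; one generator fewer in the count accounts for the drop in
  degree.\<close>

lemma harmonic_pderiv_g:
  assumes H: "harmonic n (Suc k) H"
  shows "harmonic n k (pderiv_g v H)"
  unfolding harmonic_def
proof (intro conjI allI)
  note sp = harmonicD(1)[OF H]
  show "spoly n (pderiv_g v H)" by (rule spoly_pderiv_g[OF sp])
  show "laplace n (pderiv_g v H) = 0"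
  proof (intro ext)
    fix x S
    have "laplace n H x = 0" using harmonicD(2)[OF H] by auto
    then show "laplace n (pderiv_g v H) x S = 0 x S"
      unfolding laplace_pderiv_g[OF sp] by simp
  qed
  fix x S
  show "(\<Sum>i\<in>UNIV. of_real (x $ i) * pd i (\<lambda>x. pderiv_g v H x S) x) + of_nat (card S) * pderiv_g v H x S =
      of_nat k * pderiv_g v H x S"
  proof (cases "v \<in> S \<or> infinite S")
    case True
    then have "(\<lambda>x. pderiv_g v H x S) = (\<lambda>x. 0)"
      using grass_on_infinite[OF spolyD(2)[OF sp]] by (auto simp: pderiv_g_def gderiv_def)
    then show ?thesis by (simp add: pd_const fun_eq_iff)
  next
    case False
    let ?s = "(-1) ^ card {u \<in> S. u < v} :: complex"
    have eq: "(\<lambda>x. pderiv_g v H x S) = (\<lambda>x. ?s * H x (insert v S))"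
      using False by (simp add: pderiv_g_def gderiv_def)
    have "(\<Sum>i\<in>UNIV. of_real (x $ i) * pd i (\<lambda>x. H x (insert v S)) x) + of_nat (card S) * H x (insert v S) = of_nat k * H x (insert v S)"
      using harmonicD(3)[OF H, of x "insert v S"] False by (simp add: algebra_simps)
    then have "?s * ((\<Sum>i\<in>UNIV. of_real (x $ i) * pd i (\<lambda>x. H x (insert v S)) x) + of_nat (card S) * H x (insert v S)) = ?s * (of_nat k * H x (insert v S))"
      by simp
    then show ?thesis
      unfolding eq fun_cong[OF eq] pd_scale[OF spolyD(1)[OF sp]]
      by (simp add: ring_distribs sum_distrib_left mult_ac)
  qed
qed

text \<open>Degree 0 makes each coefficient, multiplied by the power \<open>t ^ card S\<close>,
  constant along the ray through \<open>x\<close>, so that it can be compared with its value at the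
  origin.\<close>

lemma harmonic_0:
  assumes H: "harmonic n 0 H"
  shows "H x = gconst (H 0 {})"
proof
  fix S
  note sp = harmonicD(1)[OF H]
  let ?h = "\<lambda>x. H x S"
  have c: "cpoly ?h" by (rule spolyD(1)[OF sp])
  define \<phi> where "\<phi> t = of_real t ^ card S * ?h (t *\<^sub>R x)" for t :: real
  have line: "((\<lambda>t. ?h (t *\<^sub>R x)) has_vector_derivative (\<Sum>i\<in>UNIV. of_real (x $ i) * pd i ?h (t *\<^sub>R x))) (at t)" for t
  proof -
    have ray: "((\<lambda>t. t *\<^sub>R x) has_derivative (\<lambda>s. s *\<^sub>R x)) (at t)"
      by (auto intro!: derivative_eq_intros)
    have "(\<Sum>i\<in>UNIV. complex_of_real ((s *\<^sub>R x) $ i) * pd i ?h (t *\<^sub>R x)) =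
        s *\<^sub>R (\<Sum>i\<in>UNIV. of_real (x $ i) * pd i ?h (t *\<^sub>R x))" for s
      by (simp add: scaleR_conv_of_real[where 'a = complex] sum_distrib_left mult.assoc)
    with has_derivative_compose[OF ray cpoly_has_derivative[OF c]] show ?thesis
      unfolding has_vector_derivative_def by (simp only:)
  qed
  have pow: "((\<lambda>t. complex_of_real t ^ card S) has_vector_derivative of_nat (card S) * of_real t ^ (card S - 1)) (at t)" for t
  proof -
    have "((\<lambda>t. t ^ card S) has_real_derivative of_nat (card S) * t ^ (card S - 1)) (at t)"
      by (auto intro!: derivative_eq_intros simp: One_nat_def)
    from has_vector_derivative_of_real[OF this, where 'a = complex] show ?thesis by (simp only: of_real_mult of_real_power of_real_of_nat_eq)
  qed
  have deriv: "(\<phi> has_vector_derivative (of_real t ^ card S * (\<Sum>i\<in>UNIV. of_real (x $ i) * pd i ?h (t *\<^sub>R x)) +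
      of_nat (card S) * of_real t ^ (card S - 1) * ?h (t *\<^sub>R x))) (at t)" for t
    unfolding \<phi>_def by (rule has_vector_derivative_mult[OF pow line])
  \<comment> \<open>Euler's identity gives \<open>t\<close> times the derivative, hence the
    exception \<open>t = 0\<close>; a continuous function on the line is still constant if one point
    is exempted.\<close>
  have zero: "of_real t ^ card S * (\<Sum>i\<in>UNIV. of_real (x $ i) * pd i ?h (t *\<^sub>R x)) +
      of_nat (card S) * of_real t ^ (card S - 1) * ?h (t *\<^sub>R x) = 0" if "t \<noteq> 0" for t :: real
  proof -
    let ?D = "\<Sum>i\<in>UNIV. of_real (x $ i) * pd i ?h (t *\<^sub>R x)"
    have "of_real t * ?D + of_nat (card S) * ?h (t *\<^sub>R x) = 0"
      using harmonicD(3)[OF H, of "t *\<^sub>R x" S] by (simp add: sum_distrib_left mult.assoc)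
    then have z: "of_real t ^ card S * (of_real t * ?D + of_nat (card S) * ?h (t *\<^sub>R x)) = 0" by simp
    have n: "of_real t * (of_nat (card S) * of_real t ^ (card S - 1)) = of_nat (card S) * complex_of_real t ^ card S"
      by (cases "card S") simp_all
    have "of_real t * (of_real t ^ card S * ?D + of_nat (card S) * of_real t ^ (card S - 1) * ?h (t *\<^sub>R x)) =
        of_real t ^ card S * (of_real t * ?D) + (of_real t * (of_nat (card S) * of_real t ^ (card S - 1))) * ?h (t *\<^sub>R x)"
      by (simp only: ring_distribs mult_ac)
    also have "\<dots> = of_real t ^ card S * (of_real t * ?D + of_nat (card S) * ?h (t *\<^sub>R x))"
      unfolding n by (simp only: ring_distribs mult_ac)
    finally have "of_real t * (of_real t ^ card S * ?D + of_nat (card S) * of_real t ^ (card S - 1) * ?h (t *\<^sub>R x)) = 0"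
      by (simp only: z)
    then show ?thesis using that by simp
  qed
  have cont: "continuous_on UNIV \<phi>"
    using has_vector_derivative_continuous[OF deriv] by (simp add: continuous_on_eq_continuous_at)
  have const: "(\<phi> has_derivative (\<lambda>h. 0)) (at t within UNIV)" if "t \<in> UNIV - {0}" for t
  proof -
    have "(\<phi> has_vector_derivative 0) (at t)" using deriv[of t] zero[of t] that by simp
    then show ?thesis by (simp add: has_vector_derivative_def)
  qed
  have "\<phi> 1 = \<phi> 0"
    by (rule has_derivative_zero_unique_strong_convex[of UNIV "{0}" \<phi> 0 "\<phi> 0" 1]) (use cont const in auto)
  \<comment> \<open>The power \<open>0 ^ card S\<close> is 1 at the empty set, but also at infinite
    sets, whose cardinality is 0; these are treated apart.\<close>
  then have eq: "H x S = 0 ^ card S * H 0 S" by (simp add: \<phi>_def)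
  show "H x S = gconst (H 0 {}) S"
  proof (cases "S = {}")
    case True
    then show ?thesis using eq by (simp add: gconst_def)
  next
    case False
    have "H x S = 0"
    proof (cases "finite S")
      case True
      with False have "card S > 0" by (simp add: card_gt_0_iff)
      with eq show ?thesis by (simp only: zero_power mult_zero_left)
    next
      case False
      then show ?thesis using grass_on_infinite[OF spolyD(2)[OF sp]] by simp
    qed
    with False show ?thesis by (simp add: gconst_def)
  qed
qed

text \<open>A derivative lowers the degree: the coefficient at a nonempty \<open>S\<close> is, up to
  sign, one of a fermionic derivative, and Euler's identity recovers the coefficient at
  \<open>{}\<close> from the derivatives in the commuting variables.\<close>

lemma harmonic_homogeneous:
  assumes "harmonic n k H"
  shows "of_real r ^ card S * H (r *\<^sub>R x) S = of_real r ^ k * H x S"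
  using assms
proof (induction k arbitrary: H x S)
  case 0
  have 1: "H (r *\<^sub>R x) S = gconst (H 0 {}) S" and 2: "H x S = gconst (H 0 {}) S"
    by (rule fun_cong[OF harmonic_0[OF 0]])+
  show ?case unfolding 1 2 by (cases "S = {}") (simp_all add: gconst_def)
next
  case (Suc k)
  note sp = harmonicD(1)[OF Suc.prems]
  consider "S = {}" | "infinite S" | v where "finite S" "v \<in> S" by blast
  then show ?case
  proof cases
    case 1
    have e: "(\<Sum>i\<in>UNIV. of_real (x $ i) * pderiv_x i H x {}) = of_nat (Suc k) * H x {}" for x
      using harmonicD(3)[OF Suc.prems, of x "{}"] by (simp add: pderiv_x_pd)
    have "pderiv_x i H (r *\<^sub>R x) {} = of_real r ^ k * pderiv_x i H x {}" for i
      using Suc.IH[OF harmonic_pderiv_x[OF Suc.prems], of "{}" i x] by simp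
    then have "(\<Sum>i\<in>UNIV. of_real ((r *\<^sub>R x) $ i) * pderiv_x i H (r *\<^sub>R x) {}) =
        of_real r ^ Suc k * (\<Sum>i\<in>UNIV. of_real (x $ i) * pderiv_x i H x {})"
      unfolding sum_distrib_left by (intro sum.cong refl) (simp add: mult_ac)
    then have "of_nat (Suc k) * H (r *\<^sub>R x) {} = of_nat (Suc k) * (of_real r ^ Suc k * H x {})"
      unfolding e by (simp only: mult.left_commute)
    then show ?thesis using 1 by (simp del: of_nat_Suc)
  next
    case 2
    then show ?thesis using grass_on_infinite[OF spolyD(2)[OF sp]] by simp
  next
    case 3
    have "pderiv_g v H y (S - {v}) = (-1) ^ card {u \<in> S - {v}. u < v} * H y S" for y
      using 3 unfolding pderiv_g_def gderiv_def by (simp add: insert_absorb)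
    with Suc.IH[OF harmonic_pderiv_g[OF Suc.prems], of "S - {v}" v x]
    have "of_real r ^ card (S - {v}) * H (r *\<^sub>R x) S = of_real r ^ k * H x S"
      by (simp add: mult.left_commute)
    moreover have "card S = Suc (card (S - {v}))" using 3 by (simp only: card_Suc_Diff1)
    ultimately show ?thesis by simp
  qed
qed

text \<open>As M = m - 2n, the prefactor (2 pi)^(-M/2) cancels (2 pi)^(m/2) from the bosonic
  Gaussian and (2 pi)^(-n) from the fermionic one.\<close>

lemma fourier_const_mult:
  "fourier_const TYPE('m::finite) n * (of_real ((2 * pi) powr (real CARD('m) / 2)) * (1 / (2 * of_real pi) ^ n)) = 1"
proof -
  have "(2 * pi) powr (- of_int (superdim TYPE('m) n) / 2) * (2 * pi) powr (real CARD('m) / 2) = (2 * pi) powr (real n)"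
    unfolding superdim_def powr_add[symmetric] by (simp add: field_simps)
  also have "\<dots> = (2 * pi) ^ n" by (simp add: powr_realpow)
  finally have "complex_of_real ((2 * pi) powr (- of_int (superdim TYPE('m) n) / 2) * (2 * pi) powr (real CARD('m) / 2)) = (2 * of_real pi) ^ n"
    by simp
  then show ?thesis by (simp add: fourier_const_def)
qed

lemma sum_pairs:
  fixes f :: "nat \<Rightarrow> complex"
  shows "(\<Sum>v=1..2*n. f v) = (\<Sum>j=1..n. f (2*j - 1) + f (2*j))"
  by (induction n) (simp_all add: One_nat_def)

text \<open>By anticommutation both members of a pair contribute the same second derivative; the sum
  is minus the fermionic part of \<open>laplace\<close>.\<close>

lemma sum_partner:
  "(\<Sum>v=1..2*n. 2 * psign v * gderiv (partner v) (gderiv v a) S) = - 4 * (\<Sum>j=1..n. gderiv (2*j - 1) (gderiv (2*j) a) S)"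
  if "gfin a"
proof -
  have "(\<Sum>v=1..2*n. 2 * psign v * gderiv (partner v) (gderiv v a) S) =
      (\<Sum>j=1..n. 2 * psign (2*j - 1) * gderiv (partner (2*j - 1)) (gderiv (2*j - 1) a) S + 2 * psign (2*j) * gderiv (partner (2*j)) (gderiv (2*j) a) S)"
    by (rule sum_pairs)
  also have "\<dots> = (\<Sum>j=1..n. - 4 * gderiv (2*j - 1) (gderiv (2*j) a) S)"
  proof (rule sum.cong[OF refl])
    fix j assume "j \<in> {1..n}"
    then have "psign (2*j - 1) = 1" "psign (2*j) = -1" "partner (2*j - 1) = 2*j" "partner (2*j) = 2*j - 1"
      by (auto simp: psign_def partner_def)
    then show "2 * psign (2*j - 1) * gderiv (partner (2*j - 1)) (gderiv (2*j - 1) a) S + 2 * psign (2*j) * gderiv (partner (2*j)) (gderiv (2*j) a) S =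
        - 4 * gderiv (2*j - 1) (gderiv (2*j) a) S"
      using gderiv_anticommute[OF that, of "2*j" "2*j - 1"] by (simp add: gscale_eval)
  qed
  finally show ?thesis by (simp add: sum_distrib_left)
qed

text \<open>In the step, Euler's identity writes (k+1) H as a sum of variables times derivatives of
  \<open>H\<close>, which are harmonic of degree \<open>k\<close>. The transform turns the variables
  into derivatives acting on these times the Gaussian: the second-order terms add up to
  \<open>- laplace n H = 0\<close>, the first-order ones to -(k+1) H. The factor
  \<open>\<i> * (- \<i>) ^ k * (-1)\<close> is \<open>(- \<i>) ^ Suc k\<close>.\<close>

lemma super_fourier_harmonic:
  fixes H :: "real^'m::finite \<Rightarrow> grass"
  assumes "harmonic n k H"
  shows "super_fourier n (super_gauss n H) y S = (- \<i>) ^ k * super_gauss n H y S"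
  using assms
proof (induction k arbitrary: H y S)
  case 0
  have "fermion_fourier n (gmul (fermion_gauss n) (H x)) = gscale (H 0 {} / (2 * of_real pi) ^ n) (fermion_gauss n)" for x
    unfolding harmonic_0[OF 0, of x] gmul_const_right gmul_const_left_on[OF fermion_gauss_on finite_atLeastAtMost]
    by (simp add: fermion_fourier_scale fermion_fourier_gauss gscale_simps)
  then have "super_fourier n (super_gauss n H) y S = fourier_const TYPE('m) n * (of_real ((2 * pi) powr (real CARD('m) / 2)) * (1 / (2 * of_real pi) ^ n)) *
      (H 0 {} * fermion_gauss n S * exp (- (\<Sum>i\<in>UNIV. of_real ((y $ i)\<^sup>2)) / 2))"
    by (simp add: super_fourier_super_gauss gscale_eval gauss_fourier_const)
  also have "\<dots> = super_gauss n H y S"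
    unfolding super_gauss_eq harmonic_0[OF 0, of y] fourier_const_mult gmul_const_right
      gmul_const_left_on[OF fermion_gauss_on finite_atLeastAtMost] gscale_eval by simp
  finally show ?case by simp
next
  case (Suc k)
  note H = Suc.prems
  note sp = harmonicD(1)[OF H]
  let ?F = "\<lambda>P. super_fourier n (super_gauss n P) y S" and ?c = "(- \<i>) ^ k"
  \<comment> \<open>The coefficient at \<open>S\<close> of \<open>a\<close> times the Gaussian, at
    the fixed point \<open>y\<close>: a linear functional, so all terms can be summed in the
    Grassmann algebra before it is evaluated.\<close>
  define G where "G a = super_gauss n (\<lambda>_. a) y S" for a
  have G_scale: "G (gscale d a) = d * G a" and G_add: "G (a + b) = G a + G b" for d a b
    unfolding G_def super_gauss_def gmul_scale_left gmul_add_left by (simp_all add: gscale_eval)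
  have G_sum: "G (\<Sum>i\<in>I. f i) = (\<Sum>i\<in>I. G (f i))" for I :: "'i set" and f
    unfolding G_def super_gauss_def gmul_sum_left sum_fun_eval ..
  have G_eq: "super_gauss n P y S = G (P y)" for P by (simp add: G_def super_gauss_def)
  have scale: "(\<lambda>y S. c * super_gauss n P y S) = super_gauss n (\<lambda>x. gscale c (P x))" for c and P :: "real^'m \<Rightarrow> grass"
    by (intro ext) (simp add: super_gauss_def gmul_scale_left gscale_eval)
  have IH: "super_fourier n (super_gauss n (pderiv_x i H)) = super_gauss n (\<lambda>x. gscale ?c (pderiv_x i H x))"
    "super_fourier n (super_gauss n (pderiv_g v H)) = super_gauss n (\<lambda>x. gscale ?c (pderiv_g v H x))" for i v
    unfolding scale[symmetric] by (intro ext Suc.IH harmonic_pderiv_x[OF H] harmonic_pderiv_g[OF H])+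
  have euler: "gscale (of_nat (Suc k)) (H x) = (\<Sum>i\<in>UNIV. gscale (of_real (x $ i)) (pderiv_x i H x)) + (\<Sum>v=1..2*n. gmul (ggen v) (pderiv_g v H x))" for x
    using harmonicD(3)[OF H, of x]
    by (intro ext) (simp only: gscale_eval plus_fun_apply sum_fun_eval pderiv_x_pd pderiv_g_def number_operator[OF spolyD(2)[OF sp]])
  have Fx: "?F (\<lambda>x. gscale (of_real (x $ i)) (pderiv_x i H x)) =
      \<i> * ?c * G (pderiv_x i (pderiv_x i H) y + gscale (- of_real (y $ i)) (pderiv_x i H y))" for i
  proof -
    have "pderiv_x i (\<lambda>x. gscale ?c (pderiv_x i H x)) = (\<lambda>x. gscale ?c (pderiv_x i (pderiv_x i H) x))"
      by (intro ext) (simp only: gscale_eval pderiv_x_pd pd_scale[OF cpoly_pd(2)[OF spolyD(1)[OF sp]]])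
    then have "?F (\<lambda>x. gscale (of_real (x $ i)) (pderiv_x i H x)) =
        \<i> * G (gscale ?c (pderiv_x i (pderiv_x i H) y) - gscale (of_real (y $ i)) (gscale ?c (pderiv_x i H y)))"
      unfolding super_fourier_coord[OF spoly_pderiv_x[OF sp]] IH
      by (simp only: super_gauss_pderiv_x[OF spoly_scale[OF spoly_pderiv_x[OF sp]]] G_eq)
    also have "gscale ?c (pderiv_x i (pderiv_x i H) y) - gscale (of_real (y $ i)) (gscale ?c (pderiv_x i H y)) =
        gscale ?c (pderiv_x i (pderiv_x i H) y + gscale (- of_real (y $ i)) (pderiv_x i H y))"
      by (rule ext) (simp add: gscale_eval algebra_simps)
    finally show ?thesis by (simp only: G_scale mult.assoc)
  qed
  have Fg: "?F (\<lambda>x. gmul (ggen v) (pderiv_g v H x)) =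
      \<i> * ?c * G (gscale (2 * psign v) (gderiv (partner v) (gderiv v (H y))) + gscale (-1) (gmul (ggen v) (gderiv v (H y))))"
    if v: "v \<in> {1..2*n}" for v
  proof -
    have p: "partner v \<in> {1..2*n}" using partner_in[OF v] .
    have "?F (\<lambda>x. gmul (ggen v) (pderiv_g v H x)) = 2 * \<i> * psign v *
        G (gderiv (partner v) (gscale ?c (gderiv v (H y))) + gscale (psign (partner v) / 2) (gmul (ggen (partner (partner v))) (gscale ?c (gderiv v (H y)))))"
      unfolding super_fourier_gen[OF spoly_pderiv_g[OF sp] v] IH super_gauss_pderiv_g[OF p] G_eq
      unfolding pderiv_g_def ..
    also have "\<dots> = \<i> * ?c * G (gscale (2 * psign v) (gderiv (partner v) (gderiv v (H y)) + gscale (psign (partner v) / 2) (gmul (ggen v) (gderiv v (H y)))))"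
      unfolding gderiv_scale gmul_scale_right partner_partner[OF v] G_scale G_add
      by (simp add: algebra_simps)
    also have "gscale (2 * psign v) (gderiv (partner v) (gderiv v (H y)) + gscale (psign (partner v) / 2) (gmul (ggen v) (gderiv v (H y)))) =
        gscale (2 * psign v) (gderiv (partner v) (gderiv v (H y))) + gscale (-1) (gmul (ggen v) (gderiv v (H y)))"
      by (rule ext) (simp add: gscale_eval psign_partner[OF v] algebra_simps)
    finally show ?thesis .
  qed
  have total: "(\<Sum>i\<in>UNIV. pderiv_x i (pderiv_x i H) y + gscale (- of_real (y $ i)) (pderiv_x i H y)) +
      (\<Sum>v=1..2*n. gscale (2 * psign v) (gderiv (partner v) (gderiv v (H y))) + gscale (-1) (gmul (ggen v) (gderiv v (H y)))) =
      gscale (- of_nat (Suc k)) (H y)" (is "?l = ?r")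
  proof
    fix S
    have fin: "gfin (H y)" by (rule gfin_on[OF spolyD(2)[OF sp]]) simp
    have "?l S = (\<Sum>i\<in>UNIV. pd i (pd i (\<lambda>x. H x S)) y) - (\<Sum>i\<in>UNIV. of_real (y $ i) * pd i (\<lambda>x. H x S) y)
        + ((\<Sum>v=1..2*n. 2 * psign v * gderiv (partner v) (gderiv v (H y)) S) - (\<Sum>v=1..2*n. gmul (ggen v) (gderiv v (H y)) S))"
      by (simp add: sum_fun_eval gscale_eval pderiv_x_pd[abs_def] sum.distrib sum_negf sum_subtractf)
    also have "\<dots> = - laplace n H y S - ((\<Sum>i\<in>UNIV. of_real (y $ i) * pd i (\<lambda>x. H x S) y) + of_nat (card S) * H y S)"
      unfolding sum_partner[OF fin] number_operator[OF spolyD(2)[OF sp]] laplace_eval pderiv_g_def by simp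
    also have "\<dots> = ?r S"
      unfolding harmonicD(2,3)[OF H] by (simp add: gscale_eval algebra_simps)
    finally show "?l S = ?r S" .
  qed
  have "of_nat (Suc k) * ?F H = ?F (\<lambda>x. gscale (of_nat (Suc k)) (H x))"
    by (rule super_fourier_scale[OF sp, symmetric])
  also have "\<dots> = (\<Sum>i\<in>UNIV. ?F (\<lambda>x. gscale (of_real (x $ i)) (pderiv_x i H x))) + (\<Sum>v=1..2*n. ?F (\<lambda>x. gmul (ggen v) (pderiv_g v H x)))"
    unfolding euler
    by (simp only: super_fourier_add super_fourier_sum spoly_sum spoly_coord spoly_gen spoly_pderiv_x[OF sp] spoly_pderiv_g[OF sp])
  also have "\<dots> = \<i> * ?c * G (gscale (- of_nat (Suc k)) (H y))"
    unfolding total[symmetric] G_add G_sum by (simp add: Fx Fg G_add sum_distrib_left ring_distribs)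
  also have "\<dots> = of_nat (Suc k) * ((- \<i>) ^ Suc k * super_gauss n H y S)"
    unfolding G_scale G_eq by (simp add: algebra_simps)
  finally show ?case
    by (simp only: mult_cancel_left of_nat_eq_0_iff nat.simps simp_thms)
qed

section \<open>Powers of the Dirac operator\<close>

definition gens :: "nat \<Rightarrow> 'm::finite cgen set" where
  "gens n = range Gen_e \<union> Gen_eg ` {1..2*n}"

text \<open>\<open>dirac_gen g\<close> transported to the polynomial factor of \<open>P\<close>
  times the Gaussian.\<close>

fun gen_op :: "nat \<Rightarrow> 'm::finite cgen \<Rightarrow> (real^'m \<Rightarrow> grass) \<Rightarrow> real^'m \<Rightarrow> grass" where
  "gen_op n (Gen_e i) P = (\<lambda>x. gscale (-1) (pderiv_x i P x - gscale (of_real (x $ i)) (P x)))"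
| "gen_op n (Gen_eg v) P = (\<lambda>x. gscale (- 2 * psign v)
     (gderiv (partner v) (P x) + gscale (psign (partner v) / 2) (gmul (ggen v) (P x))))"

text \<open>The operator that stands next to the generator \<open>g\<close> in the Dirac operator.
  The factor \<open>- 2 * psign v\<close> is +2 at \<open>Gen_eg (2*j)\<close> and -2 at
  \<open>Gen_eg (2*j - 1)\<close>, each with the derivative in the partner variable.\<close>

fun dirac_gen :: "'m::finite cgen \<Rightarrow> (real^'m \<Rightarrow> grass) \<Rightarrow> real^'m \<Rightarrow> grass" where
  "dirac_gen (Gen_e i) f = (\<lambda>x. gscale (-1) (pderiv_x i f x))"
| "dirac_gen (Gen_eg v) f = (\<lambda>x. gscale (- 2 * psign v) (pderiv_g (partner v) f x))"

fun gen_val :: "real^'m::finite \<Rightarrow> 'm cgen \<Rightarrow> grass" where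
  "gen_val y (Gen_e i) = gconst (of_real (y $ i))"
| "gen_val y (Gen_eg v) = ggen v"

primrec word_op :: "nat \<Rightarrow> 'm::finite cgen list \<Rightarrow> (real^'m \<Rightarrow> grass) \<Rightarrow> real^'m \<Rightarrow> grass" where
  "word_op n [] P = P"
| "word_op n (g # w) P = gen_op n g (word_op n w P)"

primrec word_mul :: "real^'m::finite \<Rightarrow> 'm cgen list \<Rightarrow> grass \<Rightarrow> grass" where
  "word_mul y [] a = a"
| "word_mul y (g # w) a = gmul (gen_val y g) (word_mul y w a)"

lemma gens_cases:
  assumes "g \<in> gens n"
  obtains i where "g = Gen_e i" | v where "g = Gen_eg v" "v \<in> {1..2*n}"
  using assms by (auto simp: gens_def)

lemma spoly_gen_op: "spoly n P \<Longrightarrow> g \<in> gens n \<Longrightarrow> spoly n (gen_op n g P)"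
proof (erule gens_cases)
  assume P: "spoly n P"
  show "spoly n (gen_op n g P)" if "g = Gen_e i" for i
    unfolding that gen_op.simps by (intro spoly_scale spoly_diff spoly_pderiv_x spoly_coord P)
  show "spoly n (gen_op n g P)" if "g = Gen_eg v" "v \<in> {1..2*n}" for v
    unfolding that(1) gen_op.simps
    by (intro spoly_scale spoly_add spoly_pderiv_g[OF P, unfolded pderiv_g_def] spoly_gen P that(2))
qed

lemma dirac_gen_super_gauss:
  assumes "spoly n P" "g \<in> gens n"
  shows "dirac_gen g (super_gauss n P) = super_gauss n (gen_op n g P)"
  using assms(2)
proof (cases rule: gens_cases)
  case (1 i)
  show ?thesis
    unfolding 1 dirac_gen.simps gen_op.simps super_gauss_pderiv_x[OF assms(1)]
    by (simp add: super_gauss_def gmul_scale_left)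
next
  case (2 v)
  show ?thesis
    unfolding 2(1) dirac_gen.simps gen_op.simps pderiv_g_def super_gauss_pderiv_g[OF partner_in[OF 2(2)]] partner_partner[OF 2(2)]
    by (simp add: super_gauss_def gmul_scale_left)
qed

lemma super_fourier_on:
  assumes "spoly n P"
  shows "super_fourier n (super_gauss n P) y \<in> grass_on {1..2*n}"
proof (rule grass_onI)
  fix S assume S: "\<not> S \<subseteq> {1..2*n}"
  have "fermion_fourier n (gmul (fermion_gauss n) (P x)) S = 0" for x
    using S by (rule grass_onD[OF fermion_fourier_on[OF grass_on_mul[OF fermion_gauss_on spolyD(2)[OF assms]]]])
  then show "super_fourier n (super_gauss n P) y S = 0"
    unfolding super_fourier_super_gauss by (simp add: gauss_fourier_const)
qed

text \<open>The normalisation of the Dirac operator makes the constant \<open>- \<i>\<close> the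
  same for both kinds of generators, so the phase of a word depends on its length alone.\<close>

lemma super_fourier_gen_op:
  assumes "spoly n P" "g \<in> gens n"
  shows "super_fourier n (super_gauss n (gen_op n g P)) y = gscale (- \<i>) (gmul (gen_val y g) (super_fourier n (super_gauss n P) y))"
  using assms(2)
proof (cases rule: gens_cases)
  case (1 i)
  note sp = spoly_diff[OF spoly_pderiv_x[OF assms(1)] spoly_coord[OF assms(1)]]
  show ?thesis
    unfolding 1 gen_op.simps gen_val.simps gmul_const_left_on[OF super_fourier_on[OF assms(1)] finite_atLeastAtMost]
    by (rule ext) (simp only: super_fourier_scale[OF sp] super_fourier_pderiv_x[OF assms(1)] gscale_eval, simp)
next
  case (2 v)
  note p = partner_in[OF 2(2)]
  have sp: "spoly n (\<lambda>x. gderiv (partner v) (P x) + gscale (psign (partner v) / 2) (gmul (ggen (partner (partner v))) (P x)))"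
    unfolding partner_partner[OF 2(2)]
    by (intro spoly_add spoly_pderiv_g[OF assms(1), unfolded pderiv_g_def] spoly_scale spoly_gen assms(1) 2(2))
  show ?thesis
  proof
    fix S
    have "super_fourier n (super_gauss n (gen_op n g P)) y S = (- 2 * psign v) * (- (\<i> / 2) * psign (partner v) *
        gmul (ggen v) (super_fourier n (super_gauss n P) y) S)"
      using super_fourier_scale[OF sp, of "- 2 * psign v" y S] super_fourier_pderiv_g[OF assms(1) p, of y S]
      by (simp only: 2(1) gen_op.simps partner_partner[OF 2(2)])
    then show "super_fourier n (super_gauss n (gen_op n g P)) y S = gscale (- \<i>) (gmul (gen_val y g) (super_fourier n (super_gauss n P) y)) S"
      by (simp only: 2(1) gen_val.simps gscale_eval psign_partner[OF 2(2)]) (simp add: mult_ac)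
  qed
qed

lemma spoly_word_op: "spoly n P \<Longrightarrow> set w \<subseteq> gens n \<Longrightarrow> spoly n (word_op n w P)"
  by (induction w) (simp_all add: spoly_gen_op)

lemma super_fourier_word_op:
  assumes "spoly n P" "set w \<subseteq> gens n"
  shows "super_fourier n (super_gauss n (word_op n w P)) y =
    gscale ((- \<i>) ^ length w) (word_mul y w (super_fourier n (super_gauss n P) y))"
  using assms(2)
  by (induction w)
    (simp_all add: super_fourier_gen_op spoly_word_op assms(1) gmul_scale_right gscale_simps(1,3))

lemma dirac_Nil: "dirac n F [] = 0"
  by (intro ext) (simp add: dirac_def left_gen_def)

text \<open>In the free algebra a word with first letter \<open>g\<close> arises in only one way, so
  no terms have to be collected and each power of the Dirac operator has one operator per
  word.\<close>

lemma dirac_Cons: "dirac n F (g # w) = (if g \<in> gens n then dirac_gen g (F w) else 0)"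
proof (intro ext)
  fix x S
  show "dirac n F (g # w) x S = (if g \<in> gens n then dirac_gen g (F w) else 0) x S"
  proof (cases g)
    case (Gen_e i)
    then show ?thesis
      by (simp add: dirac_def left_gen_def coeffwise_def gens_def gscale_eval if_distrib if_distribR eq_commute[of i] cong: if_cong)
  next
    case (Gen_eg u)
    have *: "dirac n F (g # w) x S = 2 * ((\<Sum>j=1..n. if 2*j = u then pderiv_g (2*j - 1) (F w) x S else 0) -
        (\<Sum>j=1..n. if 2*j - 1 = u then pderiv_g (2*j) (F w) x S else 0))"
      unfolding Gen_eg dirac_def left_gen_def coeffwise_def sum_subtractf[symmetric]
      by (auto intro!: sum.cong)
    show ?thesis
    proof (cases "u \<in> {1..2*n}")
      case True
      then have g: "g \<in> gens n" by (simp add: Gen_eg gens_def)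
      from True show ?thesis
      proof (cases rule: index_cases)
        case (1 l)
        have "2*j - 1 = u \<longleftrightarrow> j = l" "2*j \<noteq> u" if "j \<in> {1..n}" for j
          using 1 that by (auto, presburger)
        then show ?thesis
          unfolding * using 1 g by (simp add: sum_index_delta[of l] Gen_eg gscale_eval)
      next
        case (2 l)
        have "2*j = u \<longleftrightarrow> j = l" "2*j - 1 \<noteq> u" if "j \<in> {1..n}" for j
          using 2 that by (auto, presburger)
        then show ?thesis
          unfolding * using 2 g by (simp add: sum_index_delta[of l] Gen_eg gscale_eval)
      qed
    next
      case False
      then have "2*j \<noteq> u" "2*j - 1 \<noteq> u" if "j \<in> {1..n}" for j using that by auto
      moreover have "g \<notin> gens n" using False by (auto simp: Gen_eg gens_def)
      ultimately show ?thesis unfolding * by simp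
    qed
  qed
qed

lemma dirac_gen_zero: "dirac_gen g 0 = 0"
  by (cases g) (auto simp: fun_eq_iff gscale_eval pderiv_x_def pderiv_g_def gderiv_def)

lemma dirac_power:
  assumes "spoly n P"
  shows "(dirac n ^^ m) (scalar_cfun (super_gauss n P)) w =
    (if length w = m \<and> set w \<subseteq> gens n then super_gauss n (word_op n w P) else 0)"
proof (induction m arbitrary: w)
  case 0
  show ?case by (simp add: scalar_cfun_def)
next
  case (Suc m)
  show ?case
  proof (cases w)
    case Nil
    then show ?thesis by (simp add: dirac_Nil)
  next
    case (Cons g v)
    have step: "(dirac n ^^ Suc m) (scalar_cfun (super_gauss n P)) w =
        (if g \<in> gens n then dirac_gen g ((dirac n ^^ m) (scalar_cfun (super_gauss n P)) v) else 0)"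
      unfolding Cons by (simp only: funpow.simps o_apply dirac_Cons)
    show ?thesis
    proof (cases "length v = m \<and> set v \<subseteq> gens n \<and> g \<in> gens n")
      case True
      then show ?thesis
        unfolding step Suc.IH by (simp add: Cons dirac_gen_super_gauss spoly_word_op assms)
    next
      case False
      then have "\<not> (length w = Suc m \<and> set w \<subseteq> gens n)" by (auto simp: Cons)
      moreover have "(if g \<in> gens n then dirac_gen g (if length v = m \<and> set v \<subseteq> gens n then super_gauss n (word_op n v P) else 0) else 0) = 0"
      proof (cases "g \<in> gens n")
        case True
        with False have "\<not> (length v = m \<and> set v \<subseteq> gens n)" by blast
        then show ?thesis by (simp only: if_False dirac_gen_zero if_cancel)
      qed (simp only: if_False)
      ultimately show ?thesis unfolding step Suc.IH by (simp only: if_False)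
    qed
  qed
qed

lemma psi_eq: "psi n j H = (dirac n ^^ (2*j)) (scalar_cfun (super_gauss n H))"
  by (simp add: psi_def super_gauss_def)

section \<open>Smoothness\<close>

declare gauss_moment.simps [simp del]

lemma Ck_on_cong:
  assumes "open U" "\<And>x. x \<in> U \<Longrightarrow> f x = g x"
  shows "Ck_on k U f \<longleftrightarrow> Ck_on k U g"
  using assms(2)
proof (induction k arbitrary: f g)
  case 0
  then show ?case by (simp cong: continuous_on_cong)
next
  case (Suc k)
  have "(f has_derivative D) (at x) \<longleftrightarrow> (g has_derivative D) (at x)" if "x \<in> U" for x D
    using has_derivative_transform_within_open[OF _ assms(1) that, of f D UNIV g]
      has_derivative_transform_within_open[OF _ assms(1) that, of g D UNIV f] Suc.prems by auto
  then have "f differentiable at x \<longleftrightarrow> g differentiable at x"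
    and eq: "frechet_derivative f (at x) = frechet_derivative g (at x)" if "x \<in> U" for x
    using that by (simp_all add: differentiable_def frechet_derivative_def)
  moreover have "Ck_on k U (\<lambda>x. frechet_derivative f (at x) b) \<longleftrightarrow> Ck_on k U (\<lambda>x. frechet_derivative g (at x) b)" for b
    by (rule Suc.IH) (simp add: eq)
  ultimately show ?case unfolding Ck_on.simps by blast
qed

lemma Ck_on_SucI:
  assumes "open U" "\<And>x. x \<in> U \<Longrightarrow> (f has_derivative f' x) (at x)" "\<And>b. b \<in> Basis \<Longrightarrow> Ck_on k U (\<lambda>x. f' x b)"
  shows "Ck_on (Suc k) U f"
proof -
  have "frechet_derivative f (at x) = f' x" if "x \<in> U" for x
    using frechet_derivative_at[OF assms(2)[OF that]] by simp
  then have "Ck_on k U (\<lambda>x. frechet_derivative f (at x) b)" if "b \<in> Basis" for b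
    using assms(3)[OF that] Ck_on_cong[OF assms(1), of "\<lambda>x. frechet_derivative f (at x) b" "\<lambda>x. f' x b"] by simp
  then show ?thesis using assms(2) by (auto simp: differentiable_def)
qed

lemma Ck_on_mono: "Ck_on (Suc k) U f \<Longrightarrow> Ck_on k U f"
proof (induction k arbitrary: f)
  case 0
  then show ?case
    by (auto intro!: continuous_at_imp_continuous_on differentiable_imp_continuous_within)
qed auto

lemma Ck_on_deriv:
  assumes "Ck_on (Suc k) U f" "x \<in> U"
  shows "(f has_derivative frechet_derivative f (at x)) (at x)"
  using assms frechet_derivative_works by auto

lemma Ck_on_add:
  assumes "open U" "Ck_on k U f" "Ck_on k U g"
  shows "Ck_on k U (\<lambda>x. f x + g x)"
  using assms(2,3)
proof (induction k arbitrary: f g)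
  case 0
  then show ?case by (auto intro: continuous_intros)
next
  case (Suc k)
  show ?case
    using Suc by (intro Ck_on_SucI[OF assms(1) has_derivative_add[OF Ck_on_deriv[OF Suc.prems(1)] Ck_on_deriv[OF Suc.prems(2)]]]) auto
qed

lemma Ck_on_mult:
  fixes f g :: "'a::euclidean_space \<Rightarrow> complex"
  assumes "open U" "Ck_on k U f" "Ck_on k U g"
  shows "Ck_on k U (\<lambda>x. f x * g x)"
  using assms(2,3)
proof (induction k arbitrary: f g)
  case 0
  then show ?case by (auto intro: continuous_intros)
next
  case (Suc k)
  have "Ck_on k U f" "Ck_on k U g" using Suc.prems by (auto intro: Ck_on_mono simp del: Ck_on.simps)
  then show ?case
    using Suc
    by (intro Ck_on_SucI[OF assms(1) has_derivative_mult[OF Ck_on_deriv[OF Suc.prems(1)] Ck_on_deriv[OF Suc.prems(2)]]]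
      Ck_on_add[OF assms(1)] Suc.IH) auto
qed

lemma open_radon_domain: "open (radon_domain :: ((real^'m::finite) \<times> real) set)"
  unfolding radon_domain_def by (intro open_Times) auto

lemma smooth_add: "smooth_on radon_domain f \<Longrightarrow> smooth_on radon_domain g \<Longrightarrow> smooth_on radon_domain (\<lambda>z. f z + g z)"
  by (simp add: smooth_on_def Ck_on_add open_radon_domain)

lemma smooth_mult:
  fixes f g :: "(real^'m::finite) \<times> real \<Rightarrow> complex"
  shows "smooth_on radon_domain f \<Longrightarrow> smooth_on radon_domain g \<Longrightarrow> smooth_on radon_domain (\<lambda>z. f z * g z)"
  by (simp add: smooth_on_def Ck_on_mult open_radon_domain)

lemma smooth_cpoly:
  fixes q :: "real^'m::finite \<Rightarrow> complex"
  assumes "cpoly q"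
  shows "smooth_on radon_domain (\<lambda>z. q (fst z))"
proof -
  have "Ck_on k radon_domain (\<lambda>z :: (real^'m) \<times> real. q (fst z))" for k
    using assms
  proof (induction k arbitrary: q)
    case 0
    have "((\<lambda>z. q (fst z)) has_derivative (\<lambda>h. \<Sum>i\<in>UNIV. of_real (fst h $ i) * pd i q (fst z))) (at z)" for z :: "(real^'m) \<times> real"
      using has_derivative_compose[OF has_derivative_fst[OF has_derivative_ident] cpoly_has_derivative[OF 0]] .
    then show ?case
      by (auto intro!: continuous_at_imp_continuous_on has_derivative_continuous)
  next
    case (Suc k)
    have "((\<lambda>z. q (fst z)) has_derivative (\<lambda>h. \<Sum>i\<in>UNIV. of_real (fst h $ i) * pd i q (fst z))) (at z)" for z :: "(real^'m) \<times> real"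
      using has_derivative_compose[OF has_derivative_fst[OF has_derivative_ident] cpoly_has_derivative[OF Suc.prems]] .
    moreover have "Ck_on k radon_domain (\<lambda>z :: (real^'m) \<times> real. \<Sum>i\<in>UNIV. of_real (fst b $ i) * pd i q (fst z))" for b :: "(real^'m) \<times> real"
      by (rule Suc.IH) (intro cpoly_sum cpoly_scale cpoly_pd Suc.prems)
    ultimately show ?case
      by (rule Ck_on_SucI[OF open_radon_domain])
  qed
  then show ?thesis by (simp add: smooth_on_def)
qed

lemma smooth_const:
  fixes c :: complex
  shows "smooth_on (radon_domain :: ((real^'m::finite) \<times> real) set) (\<lambda>z. c)"
  using smooth_cpoly[OF cpoly_const] .

lemma smooth_sum:
  fixes f :: "'i \<Rightarrow> (real^'m::finite) \<times> real \<Rightarrow> complex"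
  shows "(\<And>i. i \<in> I \<Longrightarrow> smooth_on radon_domain (f i)) \<Longrightarrow> smooth_on radon_domain (\<lambda>z. \<Sum>i\<in>I. f i z)"
  by (induction I rule: infinite_finite_induct) (simp_all add: smooth_const smooth_add)

text \<open>The partial derivatives of a member are again members up to constants, so an induction
  on the order of differentiability works once \<open>v\<close> is replaced by |\<omega>|^2, which
  is positive on the domain. The index \<open>a\<close> serves the averages below, whose derivative
  in \<open>v\<close> raises the weight as well.\<close>

lemma smooth_family:
  fixes f :: "nat \<Rightarrow> nat \<Rightarrow> real \<Rightarrow> real \<Rightarrow> complex"
  assumes deriv: "\<And>a b v p. v > 0 \<Longrightarrow> ((\<lambda>z. f a b (fst z) (snd z)) has_derivative
    (\<lambda>h. of_real (fst h) * (- f (Suc a) (b + 2) v p / 2) + of_real (snd h) * (\<i> * f a (b + 1) v p))) (at (v, p))"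
  shows "smooth_on (radon_domain :: ((real^'m::finite) \<times> real) set) (\<lambda>z. f a b (fst z \<bullet> fst z) (snd z))"
proof -
  have d: "((\<lambda>z :: (real^'m) \<times> real. f a b (fst z \<bullet> fst z) (snd z)) has_derivative
      (\<lambda>h. (\<Sum>i\<in>UNIV. of_real (fst h $ i) * of_real (fst z $ i)) * (- f (Suc a) (b + 2) (fst z \<bullet> fst z) (snd z)) +
        of_real (snd h) * (\<i> * f a (b + 1) (fst z \<bullet> fst z) (snd z)))) (at z)"
    if "z \<in> radon_domain" for a b z
  proof -
    have "fst z \<bullet> fst z > 0" using that by (auto simp: radon_domain_def)
    note 1 = deriv[OF this, of a b "snd z"]
    have "((\<lambda>z :: (real^'m) \<times> real. (fst z \<bullet> fst z, snd z)) has_derivative (\<lambda>h. (2 * (fst z \<bullet> fst h), snd h))) (at z)"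
      by (auto intro!: derivative_eq_intros simp: inner_commute)
    from has_derivative_compose[OF this 1] show ?thesis
      unfolding fst_conv snd_conv
      by (rule has_derivative_eq_rhs) (simp add: fun_eq_iff inner_vec_def mult.commute)
  qed
  have "Ck_on k (radon_domain :: ((real^'m) \<times> real) set) (\<lambda>z. f a b (fst z \<bullet> fst z) (snd z))" for k
  proof (induction k arbitrary: a b)
    case 0
    show ?case
      using d by (auto intro!: continuous_at_imp_continuous_on has_derivative_continuous)
  next
    case (Suc k)
    have c: "Ck_on k (radon_domain :: ((real^'m) \<times> real) set) (\<lambda>z. q (fst z))" if "cpoly q" for q
      using smooth_cpoly[OF that] by (simp add: smooth_on_def)
    have "Ck_on k (radon_domain :: ((real^'m) \<times> real) set) (\<lambda>z. (\<Sum>i\<in>UNIV. of_real (fst h $ i) * of_real (fst z $ i)) * (- f (Suc a) (b + 2) (fst z \<bullet> fst z) (snd z)) +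
        of_real (snd h) * (\<i> * f a (b + 1) (fst z \<bullet> fst z) (snd z)))" for h :: "(real^'m) \<times> real"
    proof -
      have "cpoly (\<lambda>x. - (\<Sum>i\<in>UNIV. complex_of_real (fst h $ i) * (of_real (x $ i) * 1)))"
      proof -
        have "cpoly (\<lambda>x. (-1) * (\<Sum>i\<in>UNIV. complex_of_real (fst h $ i) * (of_real (x $ i) * 1)))"
          by (intro cpoly_scale cpoly_sum cpoly_coord cpoly_const)
        then show ?thesis by simp
      qed
      from Ck_on_add[OF open_radon_domain Ck_on_mult[OF open_radon_domain c[OF this] Suc.IH[of "Suc a" "b + 2"]]
          Ck_on_mult[OF open_radon_domain c[OF cpoly_const[of "of_real (snd h) * \<i>"]] Suc.IH[of a "b + 1"]]]
      show ?thesis by (simp add: mult.assoc)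
    qed
    then show ?case by (intro Ck_on_SucI[OF open_radon_domain d])
  qed
  then show ?thesis by (simp add: smooth_on_def)
qed

lemma smooth_gauss_moment:
  "smooth_on (radon_domain :: ((real^'m::finite) \<times> real) set) (\<lambda>z. gauss_moment b (fst z \<bullet> fst z) (snd z))"
  using smooth_family[of "\<lambda>_. gauss_moment" undefined b] has_derivative_gauss_moment by blast

text \<open>An average over the segment from 1 to \<open>v\<close>. The weight arises because along
  the segment from -1 to \<omega>^2 the nilpotent part is scaled by \<open>\<tau>\<close>, so that
  its a-th power acquires \<open>\<tau> ^ a\<close>.\<close>

definition gauss_average :: "nat \<Rightarrow> nat \<Rightarrow> real \<Rightarrow> real \<Rightarrow> complex" where
  "gauss_average a b v p = integral {0..1} (\<lambda>\<tau>. of_real (\<tau> ^ a) * gauss_moment b (1 + \<tau> * (v - 1)) p)"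

lemma segment_pos: "v > 0 \<Longrightarrow> \<tau> \<in> {0..1} \<Longrightarrow> 1 + \<tau> * (v - 1) > (0::real)"
proof -
  assume v: "v > 0" "\<tau> \<in> {0..1}"
  have "1 + \<tau> * (v - 1) = (1 - \<tau>) + \<tau> * v" by (simp add: algebra_simps)
  also have "\<dots> > 0"
  proof (cases "\<tau> = 1")
    case False
    then have "1 - \<tau> > 0" "\<tau> * v \<ge> 0" using v by auto
    then show ?thesis by linarith
  qed (use v in simp)
  finally show ?thesis .
qed

lemma continuous_gauss_moment:
  "continuous_on {z. fst z > 0} (\<lambda>z. gauss_moment b (fst z) (snd z))"
  using has_derivative_continuous[OF has_derivative_gauss_moment]
  by (auto intro!: continuous_at_imp_continuous_on)

lemma continuous_average_integrand:
  "continuous_on (({0<..} \<times> UNIV) \<times> {0..1}) (\<lambda>(z, \<tau>). complex_of_real (\<tau> ^ a) * gauss_moment b (1 + \<tau> * (fst z - 1)) (snd z))"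
proof -
  have "continuous_on (({0<..} \<times> UNIV) \<times> {0..1}) (\<lambda>x. gauss_moment b (fst (1 + snd x * (fst (fst x) - 1), snd (fst x))) (snd (1 + snd x * (fst (fst x) - 1), snd (fst x))))"
    by (rule continuous_on_compose2[OF continuous_gauss_moment])
      (auto intro!: continuous_intros segment_pos)
  then show ?thesis
    by (auto simp: case_prod_unfold intro!: continuous_intros)
qed

lemma integrable_average:
  assumes "v > 0"
  shows "(\<lambda>\<tau>. complex_of_real (\<tau> ^ a) * gauss_moment b (1 + \<tau> * (v - 1)) p) integrable_on {0..1}"
proof (rule integrable_continuous_real)
  have "continuous_on {0..1} (\<lambda>\<tau>. (\<lambda>(z, \<tau>). complex_of_real (\<tau> ^ a) * gauss_moment b (1 + \<tau> * (fst z - 1)) (snd z)) ((v, p), \<tau>))"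
    by (rule continuous_on_compose2[OF continuous_average_integrand]) (use assms in \<open>auto intro!: continuous_intros\<close>)
  then show "continuous_on {0..1} (\<lambda>\<tau>. complex_of_real (\<tau> ^ a) * gauss_moment b (1 + \<tau> * (v - 1)) p)" by simp
qed

text \<open>Differentiation under the integral over a compact interval; the inner derivative of
  \<open>1 + \<tau> * (v - 1)\<close> in \<open>v\<close> is the source of the additional factor
  \<open>\<tau>\<close>.\<close>

lemma has_derivative_gauss_average:
  assumes "v > 0"
  shows "((\<lambda>z. gauss_average a b (fst z) (snd z)) has_derivative
    (\<lambda>h. of_real (fst h) * (- gauss_average (Suc a) (b + 2) v p / 2) + of_real (snd h) * (\<i> * gauss_average a (b + 1) v p))) (at (v, p))"
proof -
  define D where "D z \<tau> = (\<lambda>h::real \<times> real. fst h *\<^sub>R (- 1/2 * (complex_of_real (\<tau> ^ Suc a) * gauss_moment (b + 2) (1 + \<tau> * (fst z - 1)) (snd z))) +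
      snd h *\<^sub>R (\<i> * (complex_of_real (\<tau> ^ a) * gauss_moment (b + 1) (1 + \<tau> * (fst z - 1)) (snd z))))" for z and \<tau> :: real
  have bl: "bounded_linear (D z \<tau>)" for z \<tau>
    unfolding D_def by (intro bounded_linear_add bounded_linear_scaleR_const bounded_linear_fst bounded_linear_snd)
  let ?U = "{0::real<..} \<times> (UNIV :: real set)"
  have c: "continuous_on (?U \<times> {0..1}) (\<lambda>x. complex_of_real (snd x ^ a) * gauss_moment b (1 + snd x * (fst (fst x) - 1)) (snd (fst x)))" for a b
    using continuous_average_integrand[of a b] by (simp add: case_prod_unfold)
  have cont: "continuous_on (?U \<times> cbox 0 1) (\<lambda>(z, \<tau>). Blinfun (D z \<tau>))"
  proof (rule continuous_on_blinfun_componentwise)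
    fix h :: "real \<times> real"
    show "continuous_on (?U \<times> cbox 0 1) (\<lambda>x. blinfun_apply (case x of (z, \<tau>) \<Rightarrow> Blinfun (D z \<tau>)) h)"
      unfolding case_prod_unfold bounded_linear_Blinfun_apply[OF bl] unfolding D_def
      using c[of "Suc a" "b + 2"] c[of a "b + 1"] by (auto intro!: continuous_intros)
  qed
  have "((\<lambda>z. integral (cbox 0 1) (\<lambda>\<tau>. complex_of_real (\<tau> ^ a) * gauss_moment b (1 + \<tau> * (fst z - 1)) (snd z))) has_derivative
      integral (cbox 0 1) (\<lambda>\<tau>. Blinfun (D (v, p) \<tau>))) (at (v, p) within ?U)"
  proof (rule leibniz_rule)
    fix z and \<tau> :: real assume z: "z \<in> ?U" "\<tau> \<in> cbox 0 1"
    have pos: "1 + \<tau> * (fst z - 1) > 0" using z by (intro segment_pos) auto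
    have 1: "((\<lambda>z. (1 + \<tau> * (fst z - 1), snd z)) has_derivative (\<lambda>h. (\<tau> * fst h, snd h))) (at z within ?U)"
      by (auto intro!: derivative_eq_intros)
    from has_derivative_mult_right[OF has_derivative_compose[OF 1 has_derivative_gauss_moment[OF pos, of b "snd z"]], of "of_real (\<tau> ^ a)"]
    show "((\<lambda>z. complex_of_real (\<tau> ^ a) * gauss_moment b (1 + \<tau> * (fst z - 1)) (snd z)) has_derivative blinfun_apply (Blinfun (D z \<tau>))) (at z within ?U)"
      unfolding bounded_linear_Blinfun_apply[OF bl] fst_conv snd_conv unfolding D_def
      by (rule has_derivative_eq_rhs) (simp add: fun_eq_iff scaleR_conv_of_real algebra_simps)
  next
    fix z assume "z \<in> ?U"
    then show "(\<lambda>\<tau>. complex_of_real (\<tau> ^ a) * gauss_moment b (1 + \<tau> * (fst z - 1)) (snd z)) integrable_on cbox 0 1"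
      using integrable_average[of "fst z" a b "snd z"] by auto
  next
    show "continuous_on (?U \<times> cbox 0 1) (\<lambda>(z, \<tau>). Blinfun (D z \<tau>))" by (rule cont)
  next
    show "(v, p) \<in> ?U" using assms by simp
    show "convex ?U" by (intro convex_Times) auto
  qed
  moreover have "(at (v, p) within ?U) = at (v, p)"
    using assms by (intro at_within_open open_Times) auto
  moreover have "blinfun_apply (integral (cbox 0 1) (\<lambda>\<tau>. Blinfun (D (v, p) \<tau>))) =
    (\<lambda>h. of_real (fst h) * (- gauss_average (Suc a) (b + 2) v p / 2) + of_real (snd h) * (\<i> * gauss_average a (b + 1) v p))"
  proof
    fix h
    have "(\<lambda>\<tau>. Blinfun (D (v, p) \<tau>)) integrable_on cbox 0 1"
    proof (rule integrable_continuous)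
      have "continuous_on (cbox 0 1) (\<lambda>\<tau>. (\<lambda>(z, \<tau>). Blinfun (D z \<tau>)) ((v, p), \<tau>))"
        by (rule continuous_on_compose2[OF cont]) (use assms in \<open>auto intro!: continuous_intros\<close>)
      then show "continuous_on (cbox 0 1) (\<lambda>\<tau>. Blinfun (D (v, p) \<tau>))" by simp
    qed
    from integral_linear[OF this blinfun.bounded_linear_left[of h]]
    have "blinfun_apply (integral (cbox 0 1) (\<lambda>\<tau>. Blinfun (D (v, p) \<tau>))) h = integral {0..1} (\<lambda>\<tau>. D (v, p) \<tau> h)"
      by (simp add: o_def bounded_linear_Blinfun_apply[OF bl])
    also have "\<dots> = of_real (fst h) * (- gauss_average (Suc a) (b + 2) v p / 2) + of_real (snd h) * (\<i> * gauss_average a (b + 1) v p)"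
    proof (rule integral_unique)
      have "((\<lambda>\<tau>. D (v, p) \<tau> h) has_integral (fst h *\<^sub>R (- 1/2 * gauss_average (Suc a) (b + 2) v p) + snd h *\<^sub>R (\<i> * gauss_average a (b + 1) v p))) {0..1}"
        unfolding D_def gauss_average_def fst_conv snd_conv
        by (intro has_integral_add has_integral_cmul has_integral_mult_right integrable_integral integrable_average assms)
      then show "((\<lambda>\<tau>. D (v, p) \<tau> h) has_integral (of_real (fst h) * (- gauss_average (Suc a) (b + 2) v p / 2) + of_real (snd h) * (\<i> * gauss_average a (b + 1) v p))) {0..1}"
        by (simp add: scaleR_conv_of_real)
    qed
    finally show "blinfun_apply (integral (cbox 0 1) (\<lambda>\<tau>. Blinfun (D (v, p) \<tau>))) h =
      of_real (fst h) * (- gauss_average (Suc a) (b + 2) v p / 2) + of_real (snd h) * (\<i> * gauss_average a (b + 1) v p)" .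
  qed
  ultimately show ?thesis by (simp add: gauss_average_def)
qed

lemma smooth_gauss_average:
  "smooth_on (radon_domain :: ((real^'m::finite) \<times> real) set) (\<lambda>z. gauss_average a b (fst z \<bullet> fst z) (snd z))"
  by (rule smooth_family) (rule has_derivative_gauss_average)

text \<open>The fundamental theorem of calculus for \<open>\<tau> ^ l\<close> times the moment at
  \<open>1 + \<tau> * (v - 1)\<close>. At \<open>\<tau> = 0\<close> the boundary term survives for
  \<open>l = 0\<close> only, which the factor \<open>0 ^ l\<close> records.\<close>

lemma gauss_average_FTC:
  assumes "v > 0"
  shows "gauss_moment b v p - 0 ^ l * gauss_moment b 1 p =
    - of_real (v - 1) / 2 * gauss_average l (b + 2) v p + of_nat l * gauss_average (l - 1) b v p"
proof -
  let ?g = "\<lambda>\<tau>. of_nat l * (complex_of_real (\<tau> ^ (l - 1)) * gauss_moment b (1 + \<tau> * (v - 1)) p) +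
      (- of_real (v - 1) / 2) * (complex_of_real (\<tau> ^ l) * gauss_moment (b + 2) (1 + \<tau> * (v - 1)) p)"
  have "((\<lambda>\<tau>. complex_of_real (\<tau> ^ l) * gauss_moment b (1 + \<tau> * (v - 1)) p) has_vector_derivative ?g \<tau>) (at \<tau> within {0..1})"
    if "\<tau> \<in> {0..1}" for \<tau>
  proof -
    have pos: "1 + \<tau> * (v - 1) > 0" using segment_pos[OF assms that] .
    have 1: "((\<lambda>\<tau>. (1 + \<tau> * (v - 1), p)) has_derivative (\<lambda>h. (h * (v - 1), 0))) (at \<tau> within {0..1})"
      by (auto intro!: derivative_eq_intros)
    from has_derivative_compose[OF 1 has_derivative_gauss_moment[OF pos, of b p]]
    have g: "((\<lambda>\<tau>. gauss_moment b (1 + \<tau> * (v - 1)) p) has_vector_derivative (of_real (v - 1) * (- gauss_moment (b + 2) (1 + \<tau> * (v - 1)) p / 2))) (at \<tau> within {0..1})"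
      unfolding has_vector_derivative_def fst_conv snd_conv
      by (rule has_derivative_eq_rhs) (simp add: fun_eq_iff scaleR_conv_of_real)
    have "((\<lambda>\<tau>. \<tau> ^ l) has_real_derivative of_nat l * \<tau> ^ (l - 1)) (at \<tau> within {0..1})"
      by (auto intro!: derivative_eq_intros simp: One_nat_def)
    from has_vector_derivative_of_real[OF this, where 'a = complex]
    have "((\<lambda>\<tau>. complex_of_real (\<tau> ^ l)) has_vector_derivative of_real (of_nat l * \<tau> ^ (l - 1))) (at \<tau> within {0..1})" .
    from has_vector_derivative_mult[OF this g] show ?thesis
      by (rule has_vector_derivative_eq_rhs) (simp add: field_simps)
  qed
  from fundamental_theorem_of_calculus[OF zero_le_one this]
  have "(?g has_integral (complex_of_real (1 ^ l) * gauss_moment b (1 + 1 * (v - 1)) p - complex_of_real (0 ^ l) * gauss_moment b (1 + 0 * (v - 1)) p)) {0..1}"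
    by blast
  moreover have "(?g has_integral (of_nat l * gauss_average (l - 1) b v p + (- of_real (v - 1) / 2) * gauss_average l (b + 2) v p)) {0..1}"
    unfolding gauss_average_def
    by (intro has_integral_add has_integral_mult_right integrable_integral integrable_average assms)
  ultimately have "complex_of_real (1 ^ l) * gauss_moment b (1 + 1 * (v - 1)) p - complex_of_real (0 ^ l) * gauss_moment b (1 + 0 * (v - 1)) p =
      of_nat l * gauss_average (l - 1) b v p + (- of_real (v - 1) / 2) * gauss_average l (b + 2) v p"
    by (rule has_integral_unique)
  then show ?thesis by (simp add: add.commute)
qed

section \<open>The Radon transform of the Dirac powers\<close>

text \<open>The effect on coefficients of scaling all anti-commuting variables by \<open>r\<close>;
  being a substitution, it is multiplicative.\<close>

definition grade_scale :: "real \<Rightarrow> grass \<Rightarrow> grass" where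
  "grade_scale r a = (\<lambda>S. of_real r ^ card S * a S)"

definition half_square :: "nat \<Rightarrow> grass" where
  "half_square n = gscale (1/2) (fermion_square n)"

text \<open>The integral over r for the scalar part, without constants: the l-th power of the
  nilpotent part of \<omega>^2/2 carries r^(2l), whence the index \<open>t + 2*l\<close>. Powers
  beyond \<open>2*n\<close> vanish.\<close>

definition radon_rep :: "nat \<Rightarrow> nat \<Rightarrow> (real^'m::finite \<Rightarrow> grass) \<Rightarrow> (real^'m) \<times> real \<Rightarrow> grass" where
  "radon_rep n t H z = (\<Sum>l\<le>2*n. gscale (gauss_moment (t + 2*l) (fst z \<bullet> fst z) (snd z) / fact l)
     (gmul (H (fst z)) (gpow (half_square n) l)))"

lemma grade_scale_mul: "grade_scale r (gmul a b) = gmul (grade_scale r a) (grade_scale r b)"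
proof
  fix S
  show "grade_scale r (gmul a b) S = gmul (grade_scale r a) (grade_scale r b) S"
  proof (cases "finite S")
    case True
    show ?thesis
      unfolding grade_scale_def gmul_def sum_distrib_left
    proof (rule sum.cong[OF refl])
      fix A assume "A \<in> Pow S"
      then have "card S = card A + card (S - A)"
        using True by (metis PowD card_Diff_subset card_mono finite_subset le_add_diff_inverse)
      then show "of_real r ^ card S * (reorder_sign A (S - A) * a A * b (S - A)) =
          reorder_sign A (S - A) * (of_real r ^ card A * a A) * (of_real r ^ card (S - A) * b (S - A))"
        by (simp add: power_add)
    qed
  qed (simp add: grade_scale_def gmul_infinite)
qed

lemma grade_scale_const: "grade_scale r (gconst c) = gconst c"
  by (auto simp: grade_scale_def gconst_def)

lemma grade_scale_gen: "grade_scale r (ggen v) = gscale (of_real r) (ggen v)"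
  by (auto simp: grade_scale_def ggen_def gscale_def)

lemma grade_scale_scale: "grade_scale r (gscale c a) = gscale c (grade_scale r a)"
  by (rule ext) (simp add: grade_scale_def gscale_def)

lemma grade_scale_sum: "grade_scale r (\<Sum>i\<in>I. a i) = (\<Sum>i\<in>I. grade_scale r (a i))"
  by (rule ext) (simp add: grade_scale_def sum_fun_eval sum_distrib_left)

lemma gscale_sum: "gscale c (\<Sum>i\<in>I. a i) = (\<Sum>i\<in>I. gscale c (a i))"
  by (rule ext) (simp add: gscale_eval sum_fun_eval sum_distrib_left)

lemma grade_scale_pow: "grade_scale r (gpow a k) = gpow (grade_scale r a) k"
  by (induction k) (simp_all add: grade_scale_const grade_scale_mul)

lemma gpow_scale: "gpow (gscale c a) k = gscale (c ^ k) (gpow a k)"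
  by (induction k) (simp_all add: gscale_simps gmul_scale_left gmul_scale_right mult.commute)

lemma grade_scale_half_square: "grade_scale r (half_square n) = gscale (of_real r ^ 2) (half_square n)"
proof -
  have "grade_scale r (fermion_square n) = gscale (of_real r ^ 2) (fermion_square n)"
    unfolding fermion_square_def grade_scale_sum grade_scale_mul grade_scale_gen gmul_scale_left gmul_scale_right gscale_sum
    by (simp add: gscale_simps(3) power2_eq_square)
  then show ?thesis
    unfolding half_square_def grade_scale_scale by (simp add: gscale_simps(3) mult.commute)
qed

lemma half_square_on: "half_square n \<in> grass_on {1..2*n}"
  unfolding half_square_def by (intro grass_on_scale fermion_square_props)

lemma half_square_empty: "half_square n {} = 0"
  by (simp add: half_square_def gscale_eval fermion_square_props)

lemma geven_half_square: "geven (half_square n)"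
  unfolding half_square_def by (intro geven_scale fermion_square_props)

lemma fermion_gauss_series: "fermion_gauss n = (\<Sum>l\<le>2*n. gscale (1 / fact l) (gpow (half_square n) l))"
proof
  fix S
  show "fermion_gauss n S = (\<Sum>l\<le>2*n. gscale (1 / fact l) (gpow (half_square n) l)) S"
  proof (cases "S \<subseteq> {1..2*n}")
    case True
    then have "card S \<le> 2*n" using card_mono[of "{1..2*n}" S] by simp
    from gexp_nilpotent[of "half_square n", OF half_square_empty this] show ?thesis
      by (simp add: fermion_gauss_def half_square_def[symmetric] sum_fun_eval gscale_eval)
  next
    case False
    have "gpow (half_square n) l S = 0" for l
      using grass_onD[OF grass_on_pow[OF half_square_on] False] .
    then show ?thesis
      using grass_onD[OF fermion_gauss_on False] by (simp add: sum_fun_eval gscale_eval)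
  qed
qed

lemma gmul_one: "gfin a \<Longrightarrow> gmul (gconst 1) a = a"
  by (rule ext) (metis gfin_def gmul_const_left gmul_infinite mult_1)

lemma word_mul_scale: "word_mul y w (gscale c a) = gscale c (word_mul y w a)"
  by (induction w) (simp_all add: gmul_scale_right)

lemma word_mul_sum: "word_mul y w (\<Sum>i\<in>I. a i) = (\<Sum>i\<in>I. word_mul y w (a i))"
  by (induction w) (simp_all only: word_mul.simps gmul_sum_right)

text \<open>Each letter supplies exactly one factor \<open>r\<close>: a \<open>Gen_e\<close> through
  its scaled coordinate, a \<open>Gen_eg\<close> through the grade.\<close>

lemma grade_scale_word_mul:
  "grade_scale r (word_mul (r *\<^sub>R y) w a) = gscale (of_real r ^ length w) (word_mul y w (grade_scale r a))"
proof (induction w)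
  case Nil
  show ?case by (simp add: gscale_simps(1))
next
  case (Cons g w)
  have "grade_scale r (gen_val (r *\<^sub>R y) g) = gscale (of_real r) (gen_val y g)"
  proof (cases g)
    case (Gen_e i)
    show ?thesis
      unfolding Gen_e gen_val.simps grade_scale_const by (rule ext) (simp add: gconst_def gscale_eval)
  qed (simp add: grade_scale_gen)
  then show ?case
    by (simp add: grade_scale_mul Cons gmul_scale_left gmul_scale_right gscale_simps(3) mult.commute)
qed

lemma grade_scale_super_gauss:
  fixes H :: "real^'m::finite \<Rightarrow> grass"
  assumes "harmonic n k H"
  shows "grade_scale r (super_gauss n H (r *\<^sub>R \<omega>)) =
    (\<Sum>l\<le>2*n. gscale (of_real (r ^ (k + 2*l) * exp (- ((\<omega> \<bullet> \<omega>) * r\<^sup>2 / 2))) / fact l) (gmul (H \<omega>) (gpow (half_square n) l)))"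
proof -
  have "grade_scale r (H (r *\<^sub>R \<omega>)) = gscale (of_real r ^ k) (H \<omega>)"
    unfolding grade_scale_def gscale_def harmonic_homogeneous[OF assms] ..
  moreover have "exp (- (\<Sum>i\<in>UNIV. complex_of_real (((r *\<^sub>R \<omega>) $ i)\<^sup>2)) / 2) = of_real (exp (- ((\<omega> \<bullet> \<omega>) * r\<^sup>2 / 2)))"
  proof -
    have "(\<Sum>i\<in>UNIV. ((r *\<^sub>R \<omega>) $ i)\<^sup>2) = (\<omega> \<bullet> \<omega>) * r\<^sup>2"
      by (simp add: inner_vec_def power2_eq_square sum_distrib_left mult_ac)
    then show ?thesis unfolding of_real_sum[symmetric] by (simp add: exp_of_real[symmetric])
  qed
  moreover have "gmul (gpow (half_square n) l) (H \<omega>) = gmul (H \<omega>) (gpow (half_square n) l)" for l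
    by (rule gmul_even_commute[OF geven_pow[OF geven_half_square]])
  ultimately show ?thesis
    unfolding super_gauss_eq fermion_gauss_series grade_scale_scale grade_scale_mul grade_scale_sum grade_scale_pow
      grade_scale_half_square gpow_scale gmul_sum_left gscale_sum
    by (simp add: gmul_scale_left gmul_scale_right gscale_simps(3) power_add mult_ac flip: power_mult)
qed

lemma radon_scalar_word_op:
  fixes H :: "real^'m::finite \<Rightarrow> grass"
  assumes H: "harmonic n k H" and w: "set w \<subseteq> gens n" and "\<omega> \<noteq> 0"
  shows "radon_scalar n (super_gauss n (word_op n w H)) (\<omega>, p) S =
    of_real ((2 * pi) powr (of_int (superdim TYPE('m) n) / 2 - 1)) * (- \<i>) ^ (length w + k) *
    word_mul \<omega> w (radon_rep n (length w + k) H (\<omega>, p)) S"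
proof -
  note sp = harmonicD(1)[OF H]
  let ?b = "\<lambda>l. word_mul \<omega> w (gmul (H \<omega>) (gpow (half_square n) l)) S"
  let ?t = "length w + k"
  have s: "\<omega> \<bullet> \<omega> > 0" using assms by simp
  have "exp (\<i> * of_real (p * r)) * (of_real r ^ card S * super_fourier n (super_gauss n (word_op n w H)) (r *\<^sub>R \<omega>) S) =
      (\<Sum>l\<le>2*n. (- \<i>) ^ ?t / fact l * ?b l * gauss_integrand (?t + 2*l) (\<omega> \<bullet> \<omega>) p r)" for r
  proof -
    have "super_fourier n (super_gauss n H) (r *\<^sub>R \<omega>) = gscale ((- \<i>) ^ k) (super_gauss n H (r *\<^sub>R \<omega>))"
      by (rule ext) (simp add: super_fourier_harmonic[OF H] gscale_eval)
    then have "super_fourier n (super_gauss n (word_op n w H)) (r *\<^sub>R \<omega>) =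
        gscale ((- \<i>) ^ ?t) (word_mul (r *\<^sub>R \<omega>) w (super_gauss n H (r *\<^sub>R \<omega>)))"
      by (simp add: super_fourier_word_op[OF sp w] word_mul_scale gscale_simps(3) power_add)
    then have "of_real r ^ card S * super_fourier n (super_gauss n (word_op n w H)) (r *\<^sub>R \<omega>) S =
        (- \<i>) ^ ?t * grade_scale r (word_mul (r *\<^sub>R \<omega>) w (super_gauss n H (r *\<^sub>R \<omega>))) S"
      by (simp add: grade_scale_def gscale_eval)
    also have "\<dots> = (\<Sum>l\<le>2*n. (- \<i>) ^ ?t / fact l * ?b l * of_real (r ^ (?t + 2*l) * exp (- ((\<omega> \<bullet> \<omega>) * r\<^sup>2 / 2))))"
      unfolding grade_scale_word_mul grade_scale_super_gauss[OF H] word_mul_sum word_mul_scale gscale_sum sum_fun_eval gscale_eval sum_distrib_left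
      by (rule sum.cong[OF refl]) (simp add: power_add mult_ac)
    finally show ?thesis
      by (simp add: gauss_integrand_def sum_distrib_left mult_ac)
  qed
  then have "(\<integral>r. exp (\<i> * of_real (p * r)) * (of_real r ^ card S * super_fourier n (super_gauss n (word_op n w H)) (r *\<^sub>R \<omega>) S) \<partial>lborel) =
      (\<Sum>l\<le>2*n. (- \<i>) ^ ?t / fact l * ?b l * gauss_moment (?t + 2*l) (\<omega> \<bullet> \<omega>) p)"
    by (simp only:) (subst Bochner_Integration.integral_sum; simp add: integrable_gauss_integrand[OF s] gauss_integral[OF s])
  also have "\<dots> = (- \<i>) ^ ?t * word_mul \<omega> w (radon_rep n ?t H (\<omega>, p)) S"
    unfolding radon_rep_def word_mul_sum word_mul_scale sum_fun_eval gscale_eval sum_distrib_left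
    by (simp add: mult_ac)
  finally show ?thesis by (simp add: radon_scalar_def)
qed

lemma radon_scalar_zero: "radon_scalar n 0 = 0"
proof -
  have "berezin n 0 = 0"
    using fold_gderiv_scale[of "[1..<2*n + 1]" 0 0] by (simp only: berezin_def gscale_simps(2)) (simp add: fun_eq_iff gscale_eval)
  then have "super_fourier n 0 y S = 0" for y :: "real^'a" and S
    by (simp add: super_fourier_def)
  then show ?thesis by (intro ext) (simp add: radon_scalar_def case_prod_unfold)
qed

lemma radon_psi:
  fixes H :: "real^'m::finite \<Rightarrow> grass"
  assumes H: "harmonic n k H" and "\<omega> \<noteq> 0"
  shows "radon n (psi n j H) w (\<omega>, p) S = (if length w = 2*j \<and> set w \<subseteq> gens n then
    of_real ((2 * pi) powr (of_int (superdim TYPE('m) n) / 2 - 1)) * (- \<i>) ^ (2*j + k) *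
    word_mul \<omega> w (radon_rep n (2*j + k) H (\<omega>, p)) S else 0)"
proof (cases "length w = 2*j \<and> set w \<subseteq> gens n")
  case True
  then show ?thesis
    using radon_scalar_word_op[OF H, of w \<omega> p S] assms(2)
    by (simp add: radon_def coeffwise_def psi_eq dirac_power[OF harmonicD(1)[OF H]])
next
  case False
  have "radon n (psi n j H) w = radon_scalar n 0"
    unfolding radon_def coeffwise_def psi_eq dirac_power[OF harmonicD(1)[OF H]] using False by (simp only: if_False)
  then show ?thesis using False by (simp only: radon_scalar_zero if_False) simp
qed

text \<open>Hadamard division of \<open>radon_rep\<close> by \<open>\<omega>\<^sup>2 + 1\<close>: the quotient is the average of the derivative
  along the segment from \<open>-1\<close> to \<open>\<omega>\<^sup>2\<close>.\<close>

definition radon_quotient :: "nat \<Rightarrow> nat \<Rightarrow> (real^'m::finite \<Rightarrow> grass) \<Rightarrow> (real^'m) \<times> real \<Rightarrow> grass" where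
  "radon_quotient n t H z = (\<Sum>l\<le>2*n. gscale (gauss_average l (t + 2*l + 2) (fst z \<bullet> fst z) (snd z) / (2 * fact l))
     (gmul (H (fst z)) (gpow (half_square n) l)))"

lemma super_square_eq: "super_square n \<omega> = gscale 2 (half_square n) + gconst (- of_real (\<omega> \<bullet> \<omega>))"
  by (rule ext) (simp add: super_square_def half_square_def fermion_square_def gscale_def gconst_def inner_vec_def power2_eq_square)

text \<open>By \<open>gauss_average_FTC\<close> each difference of moments is a combination of two
  averages. After an index shift both belong to the same average, with the factor
  \<open>2 * b (Suc l) - (?v - 1) * b l\<close>, which is \<omega>^2 + 1 times
  \<open>b l\<close>.\<close>

lemma radon_rep_division:
  fixes H :: "real^'m::finite \<Rightarrow> grass"
  assumes sp: "spoly n H" and "\<omega> \<noteq> 0"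
  shows "radon_rep n t H (\<omega>, p) - gscale (gauss_moment t 1 p) (H \<omega>) =
    gmul (super_square n \<omega> + gconst 1) (radon_quotient n t H (\<omega>, p))"
proof
  fix S
  let ?v = "\<omega> \<bullet> \<omega>"
  have v: "?v > 0" using assms by simp
  have fin: "gfin (H \<omega>)" using spolyD(2)[OF sp] by (rule gfin_on) simp
  define b where "b l = gmul (H \<omega>) (gpow (half_square n) l)" for l
  define J where "J l = gauss_average l (t + 2*l + 2) ?v p" for l
  have on: "gpow (half_square n) l \<in> grass_on {1..2*n}" for l by (rule grass_on_pow[OF half_square_on])
  have b0: "b 0 = H \<omega>" unfolding b_def by (simp add: gmul_const_right gmul_one[OF fin])
  have b_Suc: "gmul (half_square n) (b l) = b (Suc l)" for l
    unfolding b_def by (simp add: gmul_assoc[symmetric] gmul_even_commute[OF geven_half_square, where b = "H \<omega>"])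
  \<comment> \<open>The term by which the index shift overshoots the range of summation.\<close>
  have b_top: "b (Suc (2*n)) S = 0"
  proof (cases "S \<subseteq> {1..2*n}")
    case True
    have "gpow (half_square n) (Suc (2*n)) A = 0" if "A \<subseteq> S" for A
    proof (rule gpow_nilpotent[of "half_square n", OF half_square_empty])
      have "card A \<le> card {1..2*n}" using that True by (intro card_mono) auto
      then show "card A < Suc (2*n)" by simp
    qed
    then show ?thesis unfolding b_def gmul_def by (intro sum.neutral) (simp del: gpow.simps)
  next
    case False
    show ?thesis unfolding b_def by (rule grass_onD[OF grass_on_mul[OF spolyD(2)[OF sp] on] False])
  qed
  have b_fin: "gfin (b l)" for l unfolding b_def by simp
  have FTC: "gauss_moment (t + 2*l) ?v p - 0 ^ l * gauss_moment t 1 p = - of_real (?v - 1) / 2 * J l + of_nat l * J (l - 1)" for l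
    using gauss_average_FTC[OF v, of "t + 2*l" p l] unfolding J_def by (cases l) simp_all
  have "(radon_rep n t H (\<omega>, p) - gscale (gauss_moment t 1 p) (H \<omega>)) S =
      (\<Sum>l\<le>2*n. gauss_moment (t + 2*l) ?v p / fact l * b l S) - (\<Sum>l\<le>2*n. (if l = 0 then gauss_moment t 1 p * b 0 S else 0))"
    by (simp add: radon_rep_def sum_fun_eval gscale_eval b_def[symmetric] b0)
  also have "\<dots> = (\<Sum>l\<le>2*n. (gauss_moment (t + 2*l) ?v p - 0 ^ l * gauss_moment t 1 p) / fact l * b l S)"
    unfolding sum_subtractf[symmetric] by (rule sum.cong[OF refl]) (simp add: field_simps)
  also have "\<dots> = (\<Sum>l\<le>2*n. - of_real (?v - 1) / 2 * J l / fact l * b l S) + (\<Sum>l\<le>2*n. of_nat l * J (l - 1) / fact l * b l S)"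
    unfolding FTC sum.distrib[symmetric] by (rule sum.cong[OF refl]) (simp add: field_simps)
  also have "(\<Sum>l\<le>2*n. of_nat l * J (l - 1) / fact l * b l S) = (\<Sum>l\<le>2*n. J l / fact l * b (Suc l) S)"
  proof -
    have "(\<Sum>l\<le>2*n. of_nat l * J (l - 1) / fact l * b l S) = (\<Sum>l\<le>Suc (2*n). of_nat l * J (l - 1) / fact l * b l S)"
      by (simp add: b_top)
    also have "\<dots> = (\<Sum>l\<le>2*n. J l / fact l * b (Suc l) S)"
      unfolding sum.atMost_Suc_shift by (simp add: field_simps del: of_nat_Suc)
    finally show ?thesis .
  qed
  also have "(\<Sum>l\<le>2*n. - of_real (?v - 1) / 2 * J l / fact l * b l S) + (\<Sum>l\<le>2*n. J l / fact l * b (Suc l) S) =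
      (\<Sum>l\<le>2*n. J l / (2 * fact l) * gmul (super_square n \<omega> + gconst 1) (b l) S)"
  proof -
    have "gmul (super_square n \<omega> + gconst 1) (b l) S = 2 * b (Suc l) S - of_real (?v - 1) * b l S" for l
    proof (cases "finite S")
      case True
      then show ?thesis
        unfolding super_square_eq gmul_add_left gmul_scale_left b_Suc
        by (simp add: gscale_eval gmul_const_left algebra_simps)
    next
      case False
      then show ?thesis using b_fin by (simp add: gmul_infinite gfin_def)
    qed
    note expand = this
    show ?thesis
      unfolding expand sum.distrib[symmetric] by (intro sum.cong refl) (simp add: field_simps)
  qed
  also have "\<dots> = gmul (super_square n \<omega> + gconst 1) (radon_quotient n t H (\<omega>, p)) S"
    by (simp add: radon_quotient_def gmul_sum_right gmul_scale_right sum_fun_eval gscale_eval J_def b_def)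
  finally show "(radon_rep n t H (\<omega>, p) - gscale (gauss_moment t 1 p) (H \<omega>)) S =
    gmul (super_square n \<omega> + gconst 1) (radon_quotient n t H (\<omega>, p)) S" .
qed

section \<open>The ideal of the super-sphere\<close>

text \<open>The expansion over words of X^a, where X is the sum of all generators times their
  variables.\<close>

definition dirac_symbol_pow :: "nat \<Rightarrow> nat \<Rightarrow> ('m::finite, (real^'m) \<times> real) cfun" where
  "dirac_symbol_pow n a = (\<lambda>w z. if length w = a \<and> set w \<subseteq> gens n then word_mul (fst z) w (gconst 1) else 0)"

lemma gfin_const [simp]: "gfin (gconst c)"
  by (simp add: gfin_def gconst_infinite)

lemma gfin_zero [simp]: "gfin 0"
  by (simp add: gfin_def)

lemma gfin_diff: "gfin a \<Longrightarrow> gfin b \<Longrightarrow> gfin (a - b)"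
  by (simp add: gfin_def)

lemma gfin_sum: "(\<And>i. i \<in> I \<Longrightarrow> gfin (a i)) \<Longrightarrow> gfin (\<Sum>i\<in>I. a i)"
  by (simp add: gfin_def sum_fun_eval)

lemma gmul_const: "gfin a \<Longrightarrow> gmul (gconst c) a = gscale c a"
  by (rule ext) (metis gfin_def gmul_const_left gmul_infinite gscale_eval mult_zero_right)

lemma cmul_eval: "cmul F G w z S = (\<Sum>i\<le>length w. gmul (F (take i w) z) (G (drop i w) z) S)"
  by (simp add: cmul_def sum_fun_eval)

text \<open>If the left factor has words of a single length only, a word can be cut in just one
  place.\<close>

lemma cmul_homogeneous:
  assumes "\<And>u. length u \<noteq> a \<Longrightarrow> F u z = 0"
  shows "cmul F G w z = (if a \<le> length w then gmul (F (take a w) z) (G (drop a w) z) else 0)"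
proof
  fix S
  have "cmul F G w z S = (\<Sum>i\<le>length w. if i = a then gmul (F (take a w) z) (G (drop a w) z) S else 0)"
    unfolding cmul_eval
  proof (rule sum.cong[OF refl])
    fix i assume i: "i \<in> {..length w}"
    show "gmul (F (take i w) z) (G (drop i w) z) S = (if i = a then gmul (F (take a w) z) (G (drop a w) z) S else 0)"
    proof (cases "i = a")
      case False
      then have "F (take i w) z = 0" using i by (intro assms) simp
      with False show ?thesis by simp
    qed simp
  qed
  then show "cmul F G w z S = (if a \<le> length w then gmul (F (take a w) z) (G (drop a w) z) else 0) S"
    by simp
qed

lemma cmul_scalar_left: "cmul (scalar_cfun f) G w z = gmul (f z) (G w z)"
  by (subst cmul_homogeneous[where a = 0]) (simp_all add: scalar_cfun_def)

lemma word_mul_append_one: "gfin a \<Longrightarrow> gmul (word_mul y w (gconst 1)) a = word_mul y w a"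
  by (induction w) (simp_all add: gmul_one gmul_assoc)

lemma gfin_word_mul: "gfin a \<Longrightarrow> gfin (word_mul y w a)"
  by (cases w) simp_all

lemma cmul_symbol_pow:
  assumes "gfin (G (drop a w) z)"
  shows "cmul (dirac_symbol_pow n a) G w z =
    (if a \<le> length w \<and> set (take a w) \<subseteq> gens n then word_mul (fst z) (take a w) (G (drop a w) z) else 0)"
proof -
  have "cmul (dirac_symbol_pow n a) G w z = (if a \<le> length w then gmul (dirac_symbol_pow n a (take a w) z) (G (drop a w) z) else 0)"
    by (rule cmul_homogeneous) (simp add: dirac_symbol_pow_def)
  also have "\<dots> = (if a \<le> length w \<and> set (take a w) \<subseteq> gens n then word_mul (fst z) (take a w) (G (drop a w) z) else 0)"
    by (simp add: dirac_symbol_pow_def word_mul_append_one[OF assms])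
  finally show ?thesis .
qed

lemma word_mul_append: "word_mul y (u @ v) a = word_mul y u (word_mul y v a)"
  by (induction u) simp_all

text \<open>A word of length \<open>a + b\<close> has exactly one cut into pieces of these lengths,
  and the variables keep the order of the letters.\<close>

lemma dirac_symbol_pow_add:
  "cmul (dirac_symbol_pow n a) (dirac_symbol_pow n b) = (dirac_symbol_pow n (a + b) :: ('m::finite, (real^'m) \<times> real) cfun)"
proof (intro ext)
  fix w :: "'m cgen list" and z :: "(real^'m) \<times> real" and S
  have fin: "gfin (dirac_symbol_pow n b u z)" for u
    by (simp add: dirac_symbol_pow_def gfin_word_mul)
  have "set w = set (take a w) \<union> set (drop a w)" by (metis append_take_drop_id set_append)
  then have sets: "set w \<subseteq> gens n \<longleftrightarrow> set (take a w) \<subseteq> gens n \<and> set (drop a w) \<subseteq> gens n" by blast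
  have mul: "word_mul (fst z) w (gconst 1) = word_mul (fst z) (take a w) (word_mul (fst z) (drop a w) (gconst 1))"
    by (metis append_take_drop_id word_mul_append)
  have zero: "word_mul (fst z) u 0 = 0" for u by (induction u) (simp_all only: word_mul.simps gmul_zero)
  show "cmul (dirac_symbol_pow n a) (dirac_symbol_pow n b) w z S = dirac_symbol_pow n (a + b) w z S"
  proof (cases "length w = a + b \<and> set w \<subseteq> gens n")
    case True
    then have "a \<le> length w" "length (drop a w) = b" by simp_all
    then show ?thesis
      using True unfolding cmul_symbol_pow[where G = "dirac_symbol_pow n b", OF fin] sets
      unfolding dirac_symbol_pow_def mul by (simp add: sets)
  next
    case False
    then have "\<not> (length (drop a w) = b \<and> set (drop a w) \<subseteq> gens n)" if "a \<le> length w" "set (take a w) \<subseteq> gens n"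
      using that unfolding sets by auto
    then have "cmul (dirac_symbol_pow n a) (dirac_symbol_pow n b) w z = 0"
      unfolding cmul_symbol_pow[where G = "dirac_symbol_pow n b", OF fin]
    proof (cases "a \<le> length w \<and> set (take a w) \<subseteq> gens n")
      case True
      with \<open>\<lbrakk>a \<le> length w; set (take a w) \<subseteq> gens n\<rbrakk> \<Longrightarrow> \<not> (length (drop a w) = b \<and> set (drop a w) \<subseteq> gens n)\<close>
      have "dirac_symbol_pow n b (drop a w) z = 0"
        unfolding dirac_symbol_pow_def by (simp only: if_False zero_fun_apply)
      then show "(if a \<le> length w \<and> set (take a w) \<subseteq> gens n
          then word_mul (fst z) (take a w) (dirac_symbol_pow n b (drop a w) z) else 0) = 0"
        by (simp only: zero if_cancel)
    qed (simp only: if_False)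
    then show ?thesis using False by (simp only: dirac_symbol_pow_def if_False zero_fun_apply)
  qed
qed

lemma cpoly_gen_val: "cpoly (\<lambda>x. gen_val x g S)"
proof (cases g)
  case (Gen_e i)
  have "(\<lambda>x::real^'a. gen_val x g S) = (\<lambda>x. of_real (x $ i) * (if S = {} then 1 else 0))"
    by (auto simp: Gen_e gconst_def)
  then show ?thesis by (simp add: cpoly_coord cpoly_const del: mult_cancel_left1)
qed (simp add: cpoly_const)

lemma cpoly_gmul:
  assumes "\<And>S. cpoly (\<lambda>x. a x S)" "\<And>S. cpoly (\<lambda>x. b x S)"
  shows "cpoly (\<lambda>x. gmul (a x) (b x) S)"
  unfolding gmul_def by (intro cpoly_sum cpoly_mult cpoly_const assms)

lemma cpoly_word_mul: "cpoly (\<lambda>x. word_mul x w (gconst 1) S)"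
  by (induction w arbitrary: S) (simp_all add: cpoly_const cpoly_gmul cpoly_gen_val)

lemma gen_val_on: "g \<in> gens n \<Longrightarrow> gen_val y g \<in> grass_on {1..2*n}"
  by (erule gens_cases) (auto intro: grass_on_gen)

lemma finite_gens: "finite (gens n :: 'm::finite cgen set)"
  by (simp add: gens_def)

lemma smooth_cfun_symbol: "dirac_symbol_pow n a \<in> smooth_cfun n"
proof -
  let ?X = "dirac_symbol_pow n a :: ('m, (real^'m) \<times> real) cfun"
  have supp: "length w = a \<and> set w \<subseteq> gens n" if "?X w \<noteq> 0" for w
    using that by (auto simp: dirac_symbol_pow_def fun_eq_iff split: if_splits)
  have "{w. ?X w \<noteq> 0} \<subseteq> {w. set w \<subseteq> gens n \<and> length w = a}" using supp by blast
  then have fin: "finite {w. ?X w \<noteq> 0}"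
    using finite_lists_length_eq[OF finite_gens] finite_subset by blast
  have on: "?X w z S = 0" if "\<not> S \<subseteq> {1..2*n}" for w z S
  proof (cases "length w = a \<and> set w \<subseteq> gens n")
    case True
    have "word_mul y w (gconst 1) \<in> grass_on {1..2*n}" if "set w \<subseteq> gens n" for y :: "real^'m" and w
      using that by (induction w) (auto intro: grass_on_mul gen_val_on)
    then have "word_mul (fst z) w (gconst 1) S = 0" using True that grass_onD by blast
    then show ?thesis using True by (simp add: dirac_symbol_pow_def)
  next
    case False
    then show ?thesis unfolding dirac_symbol_pow_def by (simp only: if_False zero_fun_apply)
  qed
  have smooth: "smooth_on radon_domain (\<lambda>z. ?X w z S)" for w S
  proof (cases "length w = a \<and> set w \<subseteq> gens n")
    case True
    then show ?thesis using smooth_cpoly[OF cpoly_word_mul[of w S]] by (simp add: dirac_symbol_pow_def)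
  next
    case False
    then show ?thesis unfolding dirac_symbol_pow_def by (simp only: if_False zero_fun_apply smooth_const)
  qed
  have "set w \<subseteq> range Gen_e \<union> Gen_eg ` {1..2*n}" if "?X w \<noteq> 0" for w
    using supp[OF that] by (simp add: gens_def)
  then show ?thesis
    unfolding smooth_cfun_def using fin on smooth by (intro CollectI conjI allI impI)
qed

lemma scalar_cfun_nonempty: "w \<noteq> [] \<Longrightarrow> scalar_cfun f w = 0"
  unfolding scalar_cfun_def by (simp only: if_False)

lemma smooth_cfun_scalar:
  assumes f: "\<And>z. f z \<in> grass_on {1..2*n}" and sm: "\<And>S. smooth_on radon_domain (\<lambda>z. f z S)"
  shows "(scalar_cfun f :: ('m::finite, (real^'m) \<times> real) cfun) \<in> smooth_cfun n"
proof -
  let ?F = "scalar_cfun f :: ('m::finite, (real^'m) \<times> real) cfun"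
  have supp: "w = []" if "?F w \<noteq> 0" for w using that scalar_cfun_nonempty by blast
  have "finite {w. ?F w \<noteq> 0}" by (rule finite_subset[of _ "{[]}"]) (use supp in blast, simp)
  moreover have "set w \<subseteq> range Gen_e \<union> Gen_eg ` {1..2*n}" if "?F w \<noteq> 0" for w
    unfolding supp[OF that] by simp
  moreover have "?F w z S = 0" if "\<not> S \<subseteq> {1..2*n}" for w z S
  proof (cases "w = []")
    case True
    then show ?thesis using grass_onD[OF f that] by (simp add: scalar_cfun_def)
  qed (simp only: scalar_cfun_nonempty not_False_eq_True zero_fun_apply)
  moreover have "smooth_on radon_domain (\<lambda>z. ?F w z S)" for w S
  proof (cases "w = []")
    case True
    then show ?thesis using sm by (simp add: scalar_cfun_def)
  qed (simp only: scalar_cfun_nonempty not_False_eq_True zero_fun_apply smooth_const)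
  ultimately show ?thesis
    unfolding smooth_cfun_def by (intro CollectI conjI allI impI)
qed

lemma smooth_cfun_const: "scalar_cfun (\<lambda>z. gconst c) \<in> smooth_cfun n"
  by (rule smooth_cfun_scalar) (simp_all add: smooth_const)

lemma ideal_gfin:
  assumes "F \<in> sphere_ideal n"
  shows "gfin (F w z)"
  using assms
proof (induction rule: sphere_ideal.induct)
  case (relation R)
  have "word_cfun c u w z S = 0" if "infinite S" for c u S
    using that by (simp add: word_cfun_def gconst_infinite)
  with relation show ?case
    unfolding clifford_weyl_relations_def gfin_def by auto
next
  case sphere
  have "gfin (super_square n \<omega>)" for \<omega> :: "real^'a"
    unfolding super_square_def by (intro gfin_diff gfin_sum gfin_mul gfin_const)
  then show ?case
    by (cases "w = []") (simp_all add: scalar_cfun_def case_prod_unfold gfin_def gconst_infinite)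
next
  case (add F G)
  then show ?case by (simp add: gfin_def)
qed (simp_all only: cmul_def gfin_sum gfin_mul)

text \<open>The rules of \<open>sphere_ideal\<close> contain no scaling; it is left multiplication
  by a constant, which acts as a scaling because members of the ideal have no coefficients at
  infinite sets.\<close>

lemma ideal_scale:
  assumes "F \<in> sphere_ideal n"
  shows "(\<lambda>w z. gscale c (F w z)) \<in> sphere_ideal n"
proof -
  have "(\<lambda>w z. gscale c (F w z)) = cmul (scalar_cfun (\<lambda>z. gconst c)) F"
    by (intro ext) (simp add: cmul_scalar_left gmul_const ideal_gfin[OF assms])
  then show ?thesis using sphere_ideal.left[OF smooth_cfun_const assms] by simp
qed

lemma ideal_add:
  assumes "F \<in> sphere_ideal n" "G \<in> sphere_ideal n"
  shows "(\<lambda>w z. F w z + G w z) \<in> sphere_ideal n"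
proof -
  have "(\<lambda>w z. F w z + G w z) = F + G" by (intro ext) simp
  then show ?thesis using sphere_ideal.add[OF assms] by simp
qed

lemma ideal_sum:
  assumes "\<And>i. i \<in> I \<Longrightarrow> F i \<in> sphere_ideal n"
  shows "(\<lambda>w z. \<Sum>i\<in>I. F i w z) \<in> sphere_ideal n"
proof -
  have zero: "(\<lambda>w z. 0) \<in> sphere_ideal n"
    using ideal_scale[OF sphere_ideal.sphere, of 0] by (simp add: gscale_simps(2))
  show ?thesis
    using assms
  proof (induction I rule: infinite_finite_induct)
    case (insert i I)
    have "(\<lambda>w z. F i w z + (\<Sum>i\<in>I. F i w z)) \<in> sphere_ideal n"
      using insert by (intro ideal_add) auto
    then show ?case unfolding sum.insert[OF insert.hyps] .
  qed (simp_all only: sum.infinite sum.empty zero not_False_eq_True)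
qed

text \<open>The symmetrised products of two summands of \<open>\<Sum> e\<^sub>i \<omega>\<^sub>i + \<Sum> \<grave>e\<^sub>j \<grave>\<omega>\<^sub>j\<close>; the correction collects the
  constants of the commutation relations.\<close>

fun correction :: "nat \<Rightarrow> real^'m::finite \<Rightarrow> 'm cgen \<Rightarrow> 'm cgen \<Rightarrow> grass" where
  "correction n y (Gen_e i) (Gen_e l) = (if i = l then gconst (- 2 * of_real (y $ i) * of_real (y $ i)) else 0)"
| "correction n y (Gen_eg a) (Gen_eg b) =
     (if b = partner a then gmul (ggen (if odd a then a else b)) (ggen (if odd a then b else a)) else 0)"
| "correction n y _ _ = 0"

definition sym_product :: "nat \<Rightarrow> 'm::finite cgen \<Rightarrow> 'm cgen \<Rightarrow> ('m, (real^'m) \<times> real) cfun" where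
  "sym_product n g h = (\<lambda>w z.
     (if w = [g, h] then gmul (gen_val (fst z) g) (gen_val (fst z) h) else 0) +
     (if w = [h, g] then gmul (gen_val (fst z) h) (gen_val (fst z) g) else 0) -
     (if w = [] then correction n (fst z) g h else 0))"

lemma gfin_gen_val [simp]: "gfin (gen_val y g)"
  by (cases g) simp_all

lemma smooth_gen_product:
  fixes g h :: "'m::finite cgen"
  assumes "g \<in> gens n" "h \<in> gens n"
  shows "(scalar_cfun (\<lambda>z. gmul (gen_val (fst z) g) (gen_val (fst z) h)) :: ('m, (real^'m) \<times> real) cfun) \<in> smooth_cfun n"
  using assms
  by (intro smooth_cfun_scalar grass_on_mul gen_val_on smooth_cpoly cpoly_gmul cpoly_gen_val)

lemma gen_anticommute: "gmul (ggen u) (ggen v) = gscale (-1) (gmul (ggen v) (ggen u))"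
proof
  fix S :: "nat set"
  have ne: "S - {u} = {v} \<Longrightarrow> u \<in> S \<Longrightarrow> S = {u, v}" for u v by auto
  have 1: "gmul (ggen u) (ggen v) S = (if S = {u, v} \<and> u \<noteq> v then (-1) ^ card {w \<in> S. w < u} else 0)" for u v
  proof (cases "S = {u, v} \<and> u \<noteq> v")
    case True
    then have "S - {u} = {v}" by auto
    then show ?thesis using True unfolding gmul_gen_left by (simp add: ggen_def)
  next
    case False
    then have "\<not> (u \<in> S \<and> S - {u} = {v})" using ne[of u v] by (metis Diff_iff insert_iff insert_not_empty singletonI)
    then show ?thesis using False unfolding gmul_gen_left by (auto simp: ggen_def)
  qed
  have swap: "S = {v, u} \<and> v \<noteq> u \<longleftrightarrow> S = {u, v} \<and> u \<noteq> v" by blast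
  show "gmul (ggen u) (ggen v) S = gscale (-1) (gmul (ggen v) (ggen u)) S"
  proof (cases "S = {u, v} \<and> u \<noteq> v")
    case True
    have "{w \<in> {u, v}. w < u} = (if v < u then {v} else {})" "{w \<in> {u, v}. w < v} = (if u < v then {u} else {})" by auto
    then have card: "card {w \<in> S. w < u} = (if v < u then 1 else 0)" "card {w \<in> S. w < v} = (if u < v then 1 else 0)"
      using True by simp_all
    show ?thesis using True unfolding gscale_eval 1 swap card by (cases "u < v") simp_all
  next
    case False
    then show ?thesis unfolding gscale_eval 1 swap by (simp only: if_False mult_zero_right)
  qed
qed

text \<open>The mixed relations are given for one order of the two generators; this supplies the
  other. \<open>correction\<close> is symmetric since it always puts the odd index first.\<close>

lemma sym_product_commute:
  assumes "g \<in> gens n" "h \<in> gens n"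
  shows "sym_product n g h = sym_product n h g"
proof -
  have corr: "correction n y g h = correction n y h g" for y
  proof (cases "\<exists>a b. g = Gen_eg a \<and> h = Gen_eg b")
    case True
    then obtain a b where ab: "g = Gen_eg a" "h = Gen_eg b" by blast
    then have ab_in: "a \<in> {1..2*n}" "b \<in> {1..2*n}" using assms by (auto simp: gens_def)
    have "b = partner a \<longleftrightarrow> a = partner b"
      using partner_partner[OF ab_in(1)] partner_partner[OF ab_in(2)] by auto
    moreover have "odd (partner a) \<longleftrightarrow> even a"
      using ab_in(1) by (cases rule: index_cases) auto
    ultimately show ?thesis unfolding ab correction.simps by auto
  next
    case False
    then show ?thesis by (cases g; cases h) auto
  qed
  show ?thesis
    unfolding sym_product_def corr by (intro ext) (simp only: fun_diff_def plus_fun_apply add.commute)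
qed

text \<open>The signs of generators and variables match: where the relation is a sum of the two
  orders the variables commute, where it is a difference they anticommute. So the product of the
  variables factors out of the symmetrised product and leaves the relation itself.\<close>

lemma sym_product_relation:
  fixes R :: "('m::finite, (real^'m) \<times> real) cfun"
  assumes "R \<in> clifford_weyl_relations n" "g \<in> gens n" "h \<in> gens n"
    and R: "R = (\<lambda>w z. gconst ((if w = [g, h] then 1 else 0) + \<epsilon> * (if w = [h, g] then 1 else 0) - (if w = [] then rc else 0)))"
    and comm: "\<And>y. gmul (gen_val y h) (gen_val y g) = gscale \<epsilon> (gmul (gen_val y g) (gen_val y h))"
    and corr: "\<And>y. correction n y g h = gscale rc (gmul (gen_val y g) (gen_val y h))"
  shows "sym_product n g h \<in> sphere_ideal n"
proof -
  have "sym_product n g h = cmul (scalar_cfun (\<lambda>z. gmul (gen_val (fst z) g) (gen_val (fst z) h))) R"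
  proof (intro ext)
    fix w z S
    have m: "gmul a (gconst c) = gscale c a" if "gfin a" for a c
      using that by (simp add: gmul_const_right gmul_const)
    have aux: "((if b1 then P else 0) + (if b2 then gscale \<epsilon> P else 0) - (if b3 then gscale rc P else 0)) S =
        gscale ((if b1 then 1 else 0) + \<epsilon> * (if b2 then 1 else 0) - (if b3 then rc else 0)) P S" for P b1 b2 b3
      by (cases b1; cases b2; cases b3) (simp_all add: gscale_eval algebra_simps)
    show "sym_product n g h w z S = cmul (scalar_cfun (\<lambda>z. gmul (gen_val (fst z) g) (gen_val (fst z) h))) R w z S"
      unfolding cmul_scalar_left R m[OF gfin_mul] sym_product_def comm corr by (rule aux)
  qed
  then show ?thesis
    using sphere_ideal.left[OF smooth_gen_product[OF assms(2,3)] sphere_ideal.relation[OF assms(1)]] by (simp only:)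
qed

lemma word_relation:
  "word_cfun 1 [g, h] + word_cfun 1 [h, g] + word_cfun c [] =
    (\<lambda>w z. gconst ((if w = [g, h] then 1 else 0) + 1 * (if w = [h, g] then 1 else 0) - (if w = [] then - c else 0)))"
  "word_cfun 1 [g, h] + word_cfun 1 [h, g] =
    (\<lambda>w z. gconst ((if w = [g, h] then 1 else 0) + 1 * (if w = [h, g] then 1 else 0) - (if w = [] then 0 else 0)))"
  "word_cfun 1 [g, h] - word_cfun 1 [h, g] - word_cfun c [] =
    (\<lambda>w z. gconst ((if w = [g, h] then 1 else 0) + -1 * (if w = [h, g] then 1 else 0) - (if w = [] then c else 0)))"
  "word_cfun 1 [g, h] - word_cfun 1 [h, g] =
    (\<lambda>w z. gconst ((if w = [g, h] then 1 else 0) + -1 * (if w = [h, g] then 1 else 0) - (if w = [] then 0 else 0)))"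
proof -
  \<comment> \<open>The conditions are abstracted: \<open>w = [g, h]\<close> and \<open>w = [h, g]\<close> together make the simplifier loop.\<close>
  have "(if b1 then gconst 1 else 0) S + (if b2 then gconst 1 else 0) S + (if b3 then gconst c else 0) S =
      gconst ((if b1 then 1 else 0) + 1 * (if b2 then 1 else 0) - (if b3 then - c else 0)) S"
    "(if b1 then gconst 1 else 0) S + (if b2 then gconst 1 else 0) S =
      gconst ((if b1 then 1 else 0) + 1 * (if b2 then 1 else 0) - (if b3 then 0 else 0)) S"
    "(if b1 then gconst 1 else 0) S - (if b2 then gconst 1 else 0) S - (if b3 then gconst c else 0) S =
      gconst ((if b1 then 1 else 0) + -1 * (if b2 then 1 else 0) - (if b3 then c else 0)) S"
    "(if b1 then gconst 1 else 0) S - (if b2 then gconst 1 else 0) S =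
      gconst ((if b1 then 1 else 0) + -1 * (if b2 then 1 else 0) - (if b3 then 0 else 0)) S" for b1 b2 b3 S
    by (cases b1; cases b2; cases b3; simp add: gconst_def)+
  note if_sums = this
  show "word_cfun 1 [g, h] + word_cfun 1 [h, g] + word_cfun c [] =
    (\<lambda>w z. gconst ((if w = [g, h] then 1 else 0) + 1 * (if w = [h, g] then 1 else 0) - (if w = [] then - c else 0)))"
    by (intro ext) (unfold plus_fun_apply word_cfun_def, rule if_sums)
  show "word_cfun 1 [g, h] + word_cfun 1 [h, g] =
    (\<lambda>w z. gconst ((if w = [g, h] then 1 else 0) + 1 * (if w = [h, g] then 1 else 0) - (if w = [] then 0 else 0)))"
    by (intro ext) (unfold plus_fun_apply word_cfun_def, rule if_sums)
  show "word_cfun 1 [g, h] - word_cfun 1 [h, g] - word_cfun c [] =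
    (\<lambda>w z. gconst ((if w = [g, h] then 1 else 0) + -1 * (if w = [h, g] then 1 else 0) - (if w = [] then c else 0)))"
    by (intro ext) (unfold fun_diff_def word_cfun_def, rule if_sums)
  show "word_cfun 1 [g, h] - word_cfun 1 [h, g] =
    (\<lambda>w z. gconst ((if w = [g, h] then 1 else 0) + -1 * (if w = [h, g] then 1 else 0) - (if w = [] then 0 else 0)))"
    by (intro ext) (unfold fun_diff_def word_cfun_def, rule if_sums)
qed

lemma gens_mem: "Gen_e i \<in> gens n" "v \<in> {1..2*n} \<Longrightarrow> Gen_eg v \<in> gens n"
  by (auto simp: gens_def)

lemma sym_product_in_ideal:
  assumes "g \<in> gens n" "h \<in> gens n"
  shows "sym_product n g h \<in> sphere_ideal n"
proof -
  have ee: "sym_product n (Gen_e i) (Gen_e l) \<in> sphere_ideal n" for i l :: 'a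
  proof (rule sym_product_relation[where \<epsilon> = 1 and rc = "- (if i = l then 2 else 0)"])
    show "word_cfun 1 [Gen_e i, Gen_e l] + word_cfun 1 [Gen_e l, Gen_e i] + word_cfun (if i = l then 2 else 0) []
        \<in> clifford_weyl_relations n"
      unfolding clifford_weyl_relations_def by blast
    show "gmul (gen_val y (Gen_e l)) (gen_val y (Gen_e i)) = gscale 1 (gmul (gen_val y (Gen_e i)) (gen_val y (Gen_e l)))" for y
      by (simp only: gen_val.simps gscale_simps(1)) (rule gmul_const_right)
    show "correction n y (Gen_e i) (Gen_e l) = gscale (- (if i = l then 2 else 0)) (gmul (gen_val y (Gen_e i)) (gen_val y (Gen_e l)))" for y
      unfolding gen_val.simps gmul_const[OF gfin_const] by (rule ext) (simp add: gscale_eval gconst_def)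
  qed (rule gens_mem gens_mem word_relation(1))+
  have eg: "sym_product n (Gen_e i) (Gen_eg k) \<in> sphere_ideal n" if "k \<in> {1..2*n}" for i :: 'a and k
  proof (rule sym_product_relation[where \<epsilon> = 1 and rc = 0])
    show "word_cfun 1 [Gen_e i, Gen_eg k] + word_cfun 1 [Gen_eg k, Gen_e i] \<in> clifford_weyl_relations n"
      using that unfolding clifford_weyl_relations_def by blast
    show "gmul (gen_val y (Gen_eg k)) (gen_val y (Gen_e i)) = gscale 1 (gmul (gen_val y (Gen_e i)) (gen_val y (Gen_eg k)))" for y
      by (simp only: gen_val.simps gscale_simps(1)) (rule gmul_const_right)
  show "correction n y (Gen_e i) (Gen_eg k) = gscale 0 (gmul (gen_val y (Gen_e i)) (gen_val y (Gen_eg k)))" for y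
      by (simp only: correction.simps gscale_simps(2))
  qed (rule gens_mem gens_mem(2)[OF that] word_relation(2))+
  have comm: "gmul (gen_val y (Gen_eg b)) (gen_val y (Gen_eg a)) = gscale (-1) (gmul (gen_val y (Gen_eg a)) (gen_val y (Gen_eg b)))"
    for a b and y :: "real^'a"
    using gen_anticommute[of b a] by simp
  have mem: "Gen_eg (2*j) \<in> (gens n :: 'a cgen set)" "Gen_eg (2*j - 1) \<in> (gens n :: 'a cgen set)" if "j \<in> {1..n}" for j
    using that by (auto intro!: gens_mem(2))
  have pe: "partner (2*j) = 2*j - 1" for j by (simp add: partner_def)
  have po: "odd (2*j - 1)" "partner (2*j - 1) = 2*j" if "j \<in> {1..n}" for j
    using that by (cases j; simp add: partner_def)+
  have even: "sym_product n (Gen_eg (2*j)) (Gen_eg (2*k) :: 'a cgen) \<in> sphere_ideal n" if "j \<in> {1..n}" "k \<in> {1..n}" for j k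
  proof (rule sym_product_relation[where \<epsilon> = "-1" and rc = 0, OF _ _ _ _ comm])
    show "word_cfun 1 [Gen_eg (2*j), Gen_eg (2*k)] - word_cfun 1 [Gen_eg (2*k), Gen_eg (2*j)] \<in> clifford_weyl_relations n"
      using that unfolding clifford_weyl_relations_def by blast
    \<comment> \<open>A correction requires one even and one odd index.\<close>
    have "2*k \<noteq> partner (2*j)"
    proof
      assume "2*k = partner (2*j)"
      then have "2*j - 1 = 2*k" by (simp only: pe)
      moreover have "even (2*k)" by simp
      ultimately show False using po(1)[OF that(1)] by simp
    qed
    then show "correction n y (Gen_eg (2*j)) (Gen_eg (2*k)) = gscale 0 (gmul (gen_val y (Gen_eg (2*j))) (gen_val y (Gen_eg (2*k))))" for y :: "real^'a"
      by (simp only: correction.simps if_False gscale_simps(2))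
  qed (rule mem[OF that(1)] mem[OF that(2)] word_relation(4))+
  have odd: "sym_product n (Gen_eg (2*j - 1)) (Gen_eg (2*k - 1) :: 'a cgen) \<in> sphere_ideal n" if "j \<in> {1..n}" "k \<in> {1..n}" for j k
  proof (rule sym_product_relation[where \<epsilon> = "-1" and rc = 0, OF _ _ _ _ comm])
    show "word_cfun 1 [Gen_eg (2*j - 1), Gen_eg (2*k - 1)] - word_cfun 1 [Gen_eg (2*k - 1), Gen_eg (2*j - 1)] \<in> clifford_weyl_relations n"
      using that unfolding clifford_weyl_relations_def by blast
    have "2*k - 1 \<noteq> partner (2*j - 1)"
    proof
      assume "2*k - 1 = partner (2*j - 1)"
      then have "2*k - 1 = 2*j" by (simp only: po(2)[OF that(1)])
      moreover have "even (2*j)" by simp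
      ultimately show False using po(1)[OF that(2)] by simp
    qed
    then show "correction n y (Gen_eg (2*j - 1)) (Gen_eg (2*k - 1)) = gscale 0 (gmul (gen_val y (Gen_eg (2*j - 1))) (gen_val y (Gen_eg (2*k - 1))))" for y :: "real^'a"
      by (simp only: correction.simps if_False gscale_simps(2))
  qed (rule mem[OF that(1)] mem[OF that(2)] word_relation(4))+
  have odd_even: "sym_product n (Gen_eg (2*j - 1)) (Gen_eg (2*k) :: 'a cgen) \<in> sphere_ideal n" if "j \<in> {1..n}" "k \<in> {1..n}" for j k
  proof (rule sym_product_relation[where \<epsilon> = "-1" and rc = "if j = k then 1 else 0", OF _ _ _ _ comm])
    show "word_cfun 1 [Gen_eg (2*j - 1), Gen_eg (2*k)] - word_cfun 1 [Gen_eg (2*k), Gen_eg (2*j - 1)]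
        - word_cfun (if j = k then 1 else 0) [] \<in> clifford_weyl_relations n"
      using that unfolding clifford_weyl_relations_def by blast
    have "2*k = partner (2*j - 1) \<longleftrightarrow> j = k" "odd (2*j - 1)"
      using po[OF that(1)] by auto
    then show "correction n y (Gen_eg (2*j - 1)) (Gen_eg (2*k)) =
        gscale (if j = k then 1 else 0) (gmul (gen_val y (Gen_eg (2*j - 1))) (gen_val y (Gen_eg (2*k))))" for y :: "real^'a"
      by (simp add: gscale_simps)
  qed (rule mem[OF that(1)] mem[OF that(2)] word_relation(3))+
  show ?thesis
    using assms(1)
  proof (cases rule: gens_cases)
    case g: (1 i)
    from assms(2) show ?thesis
      by (cases rule: gens_cases) (simp_all add: g ee eg)
  next
    case g: (2 a)
    from assms(2) show ?thesis
    proof (cases rule: gens_cases)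
      case h: (1 i)
      show ?thesis
        using eg[OF g(2), of i] sym_product_commute[OF assms] by (simp add: g h)
    next
      case h: (2 b)
      from g(2) show ?thesis
      proof (cases rule: index_cases)
        case a: (1 j)
        from h(2) show ?thesis
          by (cases rule: index_cases) (simp_all only: g h a odd odd_even)
      next
        case a: (2 j)
        from h(2) show ?thesis
        proof (cases rule: index_cases)
          case b: (1 k)
          show ?thesis
            using odd_even[OF b(1) a(1)] sym_product_commute[OF assms] by (simp only: g h a(2) b(2))
        next
          case b: (2 k)
          show ?thesis using even[OF a(1) b(1)] by (simp only: g h a(2) b(2))
        qed
      qed
    qed
  qed
qed

section \<open>Powers of the symbol modulo the ideal\<close>

lemma sum_gens:
  fixes f :: "'m::finite cgen \<Rightarrow> complex"
  shows "(\<Sum>g\<in>gens n. f g) = (\<Sum>i\<in>UNIV. f (Gen_e i)) + (\<Sum>a=1..2*n. f (Gen_eg a))"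
proof -
  have "(\<Sum>g\<in>gens n. f g) = (\<Sum>g\<in>range Gen_e. f g) + (\<Sum>g\<in>Gen_eg ` {1..2*n}. f g)"
    unfolding gens_def by (intro sum.union_disjoint) auto
  then show ?thesis by (simp add: sum.reindex inj_on_def)
qed

text \<open>Each pair \<open>2*j - 1\<close>, \<open>2*j\<close> occurs in both orders with the same
  correction, and each \<open>Gen_e i\<close> contributes \<open>- 2 * (y $ i)\<^sup>2\<close>;
  hence the factor 2.\<close>

lemma sum_correction:
  "(\<Sum>g\<in>gens n. \<Sum>h\<in>gens n. correction n y g h S) = 2 * super_square n y S"
proof -
  have "(\<Sum>b=1..2*n. correction n y (Gen_eg a) (Gen_eg b) S) =
      gmul (ggen (if odd a then a else partner a)) (ggen (if odd a then partner a else a)) S" if "a \<in> {1..2*n}" for a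
  proof -
    have "(\<Sum>b=1..2*n. correction n y (Gen_eg a) (Gen_eg b) S) =
        (\<Sum>b=1..2*n. if b = partner a then gmul (ggen (if odd a then a else partner a)) (ggen (if odd a then partner a else a)) S else 0)"
      by (rule sum.cong[OF refl]) simp
    then show ?thesis using partner_in[OF that] by simp
  qed
  then have "(\<Sum>a=1..2*n. \<Sum>b=1..2*n. correction n y (Gen_eg a) (Gen_eg b) S) =
      (\<Sum>a=1..2*n. gmul (ggen (if odd a then a else partner a)) (ggen (if odd a then partner a else a)) S)"
    by (intro sum.cong refl)
  also have "\<dots> = (\<Sum>j=1..n. 2 * gmul (ggen (2*j - 1)) (ggen (2*j)) S)"
    unfolding sum_pairs by (intro sum.cong refl) (auto simp: partner_def)
  finally have gg: "(\<Sum>a=1..2*n. \<Sum>b=1..2*n. correction n y (Gen_eg a) (Gen_eg b) S) = 2 * fermion_square n S"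
    by (simp add: fermion_square_def sum_fun_eval sum_distrib_left)
  have "(\<Sum>i\<in>UNIV. \<Sum>l\<in>UNIV. correction n y (Gen_e i) (Gen_e l) S) = (\<Sum>i\<in>UNIV. gconst (- 2 * of_real (y $ i) * of_real (y $ i)) S)"
  proof (rule sum.cong[OF refl])
    fix i
    have "(\<Sum>l\<in>UNIV. correction n y (Gen_e i) (Gen_e l) S) = (\<Sum>l\<in>UNIV. if l = i then gconst (- 2 * of_real (y $ i) * of_real (y $ i)) S else 0)"
      by (rule sum.cong[OF refl]) auto
    then show "(\<Sum>l\<in>UNIV. correction n y (Gen_e i) (Gen_e l) S) = gconst (- 2 * of_real (y $ i) * of_real (y $ i)) S" by simp
  qed
  also have "\<dots> = 2 * (super_square n y S - fermion_square n S)"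
    by (simp add: super_square_def fermion_square_def gconst_def sum_negf sum_distrib_left power2_eq_square mult.assoc)
  finally have ee: "(\<Sum>i\<in>UNIV. \<Sum>l\<in>UNIV. correction n y (Gen_e i) (Gen_e l) S) = 2 * (super_square n y S - fermion_square n S)" .
  show ?thesis
    unfolding sum_gens sum.distrib by (simp add: ee gg del: correction.simps(1,2))
qed

text \<open>X^2 runs over all ordered pairs of generators, so it is half the sum over both orders of
  each pair; the corrections add up to \<omega>^2.\<close>

lemma symbol_square:
  "(\<Sum>g\<in>gens n. \<Sum>h\<in>gens n. gscale (1/2) (sym_product n g h w z)) =
    dirac_symbol_pow n 2 w z - (if w = [] then super_square n (fst z) else 0)"
proof
  fix S
  define A where "A = (\<Sum>g\<in>gens n. \<Sum>h\<in>gens n. if w = [g, h] then gmul (gen_val (fst z) g) (gen_val (fst z) h) S else 0)"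
  have A': "(\<Sum>g\<in>gens n. \<Sum>h\<in>gens n. if w = [h, g] then gmul (gen_val (fst z) h) (gen_val (fst z) g) S else 0) = A"
    unfolding A_def by (rule sum.swap)
  have one: "gmul a (gconst 1) = a" if "gfin a" for a
    using that by (simp add: gmul_const_right gmul_one)
  have A: "A = dirac_symbol_pow n 2 w z S"
  proof (cases "length w = 2")
    case True
    then obtain a b where w: "w = [a, b]" by (metis length_0_conv length_Suc_conv numeral_2_eq_2)
    have "(\<Sum>h\<in>gens n. if w = [g, h] then gmul (gen_val (fst z) g) (gen_val (fst z) h) S else 0) =
        (if g = a then if b \<in> gens n then gmul (gen_val (fst z) a) (gen_val (fst z) b) S else 0 else 0)" for g
      by (cases "g = a") (simp_all add: w finite_gens)
    then show ?thesis
      by (simp add: A_def finite_gens dirac_symbol_pow_def w one)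
  next
    case False
    then have "w \<noteq> [g, h]" for g h by auto
    then show ?thesis using False by (simp add: A_def dirac_symbol_pow_def)
  qed
  have "(\<Sum>g\<in>gens n. \<Sum>h\<in>gens n. gscale (1/2) (sym_product n g h w z)) S =
      1/2 * (A + A - (if w = [] then \<Sum>g\<in>gens n. \<Sum>h\<in>gens n. correction n (fst z) g h S else 0))"
  proof -
    have "gscale (1/2) ((if b1 then P else 0) + (if b2 then Q else 0) - (if b3 then C else 0)) S =
        1/2 * ((if b1 then P S else 0) + (if b2 then Q S else 0) - (if b3 then C S else 0))" for b1 b2 b3 P Q C
      by (cases b1; cases b2; cases b3) (simp_all add: gscale_eval)
    then have "gscale (1/2) (sym_product n g h w z) S = 1/2 * ((if w = [g, h] then gmul (gen_val (fst z) g) (gen_val (fst z) h) S else 0) +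
        (if w = [h, g] then gmul (gen_val (fst z) h) (gen_val (fst z) g) S else 0) - (if w = [] then correction n (fst z) g h S else 0))" for g h
      unfolding sym_product_def by blast
    then have "(\<Sum>g\<in>gens n. \<Sum>h\<in>gens n. gscale (1/2) (sym_product n g h w z)) S =
        1/2 * (A + A - (\<Sum>g\<in>gens n. \<Sum>h\<in>gens n. if w = [] then correction n (fst z) g h S else 0))"
      unfolding sum_fun_eval by (simp only: sum_distrib_left[symmetric] sum.distrib sum_subtractf A' A_def[symmetric])
    then show ?thesis by (cases "w = []") (simp_all only: if_True if_False sum.neutral_const refl)
  qed
  moreover have "(a - (if b then c else 0)) S = 1/2 * (a S + a S - (if b then 2 * c S else 0))" for a c :: grass and b
    by (cases b) simp_all
  ultimately show "(\<Sum>g\<in>gens n. \<Sum>h\<in>gens n. gscale (1/2) (sym_product n g h w z)) S =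
      (dirac_symbol_pow n 2 w z - (if w = [] then super_square n (fst z) else 0)) S"
    unfolding A sum_correction by (simp only:)
qed

text \<open>X^2 - \<omega>^2 is in the ideal by the relations between the generators, and \<omega>^2
  + 1 generates the rest.\<close>

lemma symbol_square_ideal:
  "(\<lambda>w z. dirac_symbol_pow n 2 w z + (if w = [] then gconst 1 else 0)) \<in>
    (sphere_ideal n :: ('m::finite, (real^'m) \<times> real) cfun set)"
proof -
  have cancel: "(a - (if b then c else 0)) + (if b then c + d else 0) = a + (if b then d else 0)" for a c d :: grass and b
    by (cases b) simp_all
  have sphere: "scalar_cfun (\<lambda>(\<omega>, p). super_square n \<omega> + gconst 1) w z =
      (if w = [] then super_square n (fst z) + gconst 1 else 0)" for w :: "'m cgen list" and z :: "(real^'m) \<times> real"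
    unfolding scalar_cfun_def case_prod_unfold if_distribR zero_fun_apply ..
  have "(\<lambda>(w :: 'm cgen list) z. (\<Sum>g\<in>gens n. \<Sum>h\<in>gens n. gscale (1/2) (sym_product n g h w z)) +
      scalar_cfun (\<lambda>(\<omega>, p). super_square n \<omega> + gconst 1) w z) \<in> sphere_ideal n"
    by (intro ideal_add ideal_sum ideal_scale sym_product_in_ideal sphere_ideal.sphere)
  then show ?thesis by (simp only: symbol_square cancel sphere)
qed

lemma cmul_add_right: "cmul F (\<lambda>w z. G w z + G' w z) = (\<lambda>w z. cmul F G w z + cmul F G' w z)"
  by (intro ext) (simp add: cmul_eval gmul_add_right sum.distrib)

lemma cmul_const_right:
  assumes "gfin (F w z)"
  shows "cmul F (\<lambda>w z. if w = [] then gconst c else 0) w z = gscale c (F w z)"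
proof
  fix S
  have "cmul F (\<lambda>w z. if w = [] then gconst c else 0) w z S =
      (\<Sum>i\<le>length w. if i = length w then gmul (F w z) (gconst c) S else 0)"
    unfolding cmul_eval
  proof (rule sum.cong[OF refl])
    fix i assume "i \<in> {..length w}"
    then have "drop i w = [] \<longleftrightarrow> i = length w" by auto
    then show "gmul (F (take i w) z) (if drop i w = [] then gconst c else 0) S =
        (if i = length w then gmul (F w z) (gconst c) S else 0)"
      by (cases "i = length w") (simp_all only: simp_thms if_True if_False take_all order_refl gmul_zero zero_fun_apply)
  qed
  also have "\<dots> = gmul (F w z) (gconst c) S" by (simp only: sum.delta finite_atMost atMost_iff order_refl if_True)
  finally show "cmul F (\<lambda>w z. if w = [] then gconst c else 0) w z S = gscale c (F w z) S"
    by (simp only: gmul_const_right gmul_const[OF assms])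
qed

lemma symbol_pow_ideal:
  "(\<lambda>w z. dirac_symbol_pow n (2*j) w z + (if w = [] then gconst (- ((-1) ^ j)) else 0)) \<in>
    (sphere_ideal n :: ('m::finite, (real^'m) \<times> real) cfun set)"
proof (induction j)
  case 0
  have zero: "dirac_symbol_pow n 0 w z + (if w = [] then gconst (- 1) else 0) = 0" for w :: "'m cgen list" and z :: "(real^'m) \<times> real"
  proof (cases "w = []")
    case False
    then have "length w \<noteq> 0" by simp
    then show ?thesis using False unfolding dirac_symbol_pow_def by (simp only: if_False simp_thms add_0_right)
  qed (simp add: dirac_symbol_pow_def fun_eq_iff gconst_def)
  \<comment> \<open>Zero belongs to the ideal as an empty sum.\<close>
  have "(\<lambda>w z. \<Sum>i\<in>{}. undefined) \<in> (sphere_ideal n :: ('m, (real^'m) \<times> real) cfun set)"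
    by (rule ideal_sum) (simp only: empty_iff)
  then show ?case by (simp only: mult_0_right power_0 zero sum.empty)
next
  case (Suc j)
  let ?X = "dirac_symbol_pow n :: nat \<Rightarrow> ('m, (real^'m) \<times> real) cfun"
  have fin: "gfin (?X 2 w z)" for w z by (simp add: dirac_symbol_pow_def gfin_word_mul)
  \<comment> \<open>X^(2j+2) - (-1)^(j+1) = X^2 (X^(2j) - (-1)^j) + (-1)^j (X^2 + 1).\<close>
  have "(\<lambda>w z. cmul (?X 2) (\<lambda>w z. ?X (2*j) w z + (if w = [] then gconst (- ((-1) ^ j)) else 0)) w z +
      gscale ((-1) ^ j) (?X 2 w z + (if w = [] then gconst 1 else 0))) \<in> sphere_ideal n"
    by (intro ideal_add ideal_scale symbol_square_ideal sphere_ideal.left[OF smooth_cfun_symbol Suc])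
  moreover have "cmul (?X 2) (\<lambda>w z. ?X (2*j) w z + (if w = [] then gconst (- ((-1) ^ j)) else 0)) w z +
      gscale ((-1) ^ j) (?X 2 w z + (if w = [] then gconst 1 else 0)) =
      ?X (2 * Suc j) w z + (if w = [] then gconst (- ((-1) ^ Suc j)) else 0)" for w z
  proof -
    have cancel: "(a + gscale (- c) x) + gscale c (x + (if b then gconst 1 else 0)) = a + (if b then gconst c else 0)"
      for a x :: grass and b c
      by (cases b) (auto simp: gscale_def gconst_def fun_eq_iff algebra_simps)
    show ?thesis
      unfolding cmul_add_right cmul_const_right[where F = "?X 2", OF fin] dirac_symbol_pow_add cancel
      by (simp only: mult_Suc_right power_Suc mult_minus1 minus_minus)
  qed
  ultimately show ?case by (simp only:)
qed

section \<open>The main theorem\<close>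

text \<open>The common shape of \<open>radon_rep\<close> and \<open>radon_quotient\<close>, both of
  which have to be admissible multipliers in \<open>sphere_ideal\<close>.\<close>

lemma smooth_cfun_gauss_sum:
  fixes H :: "real^'m::finite \<Rightarrow> grass"
  assumes sp: "spoly n H" and c: "\<And>l. smooth_on radon_domain (c l)"
  shows "(scalar_cfun (\<lambda>z. \<Sum>l\<le>N. gscale (c l z) (gmul (H (fst z)) (gpow (half_square n) l))) :: ('m, (real^'m) \<times> real) cfun)
    \<in> smooth_cfun n"
proof (rule smooth_cfun_scalar)
  show "(\<Sum>l\<le>N. gscale (c l z) (gmul (H (fst z)) (gpow (half_square n) l))) \<in> grass_on {1..2*n}" for z
    by (intro grass_on_sum grass_on_scale grass_on_mul spolyD(2)[OF sp] grass_on_pow half_square_on)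
  have "cpoly (\<lambda>x. gmul (H x) (gpow (half_square n) l) S)" for l S
    by (intro cpoly_gmul spolyD(1)[OF sp] cpoly_const)
  then show "smooth_on radon_domain (\<lambda>z. (\<Sum>l\<le>N. gscale (c l z) (gmul (H (fst z)) (gpow (half_square n) l))) S)" for S
    unfolding sum_fun_eval gscale_eval by (intro smooth_sum smooth_mult c smooth_cpoly)
qed

lemma smooth_cfun_radon_rep:
  assumes "spoly n H"
  shows "scalar_cfun (radon_rep n t H) \<in> smooth_cfun n"
  unfolding radon_rep_def
  by (rule smooth_cfun_gauss_sum[OF assms]) (simp only: divide_inverse, intro smooth_mult smooth_const smooth_gauss_moment)

lemma smooth_cfun_radon_quotient:
  assumes "spoly n H"
  shows "scalar_cfun (radon_quotient n t H) \<in> smooth_cfun n"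
  unfolding radon_quotient_def
  by (rule smooth_cfun_gauss_sum[OF assms]) (simp only: divide_inverse, intro smooth_mult smooth_const smooth_gauss_average)

lemma cmul_scalar_right:
  assumes "gfin (f z)"
  shows "cmul (\<lambda>w z. dirac_symbol_pow n a w z + (if w = [] then gconst c else 0)) (scalar_cfun f) w z =
    (if length w = a \<and> set w \<subseteq> gens n then word_mul (fst z) w (f z) else 0) + (if w = [] then gscale c (f z) else 0)"
proof
  fix S
  let ?F = "\<lambda>w z. dirac_symbol_pow n a w z + (if w = [] then gconst c else 0)"
  have "cmul ?F (scalar_cfun f) w z S = (\<Sum>i\<le>length w. if i = length w then gmul (?F w z) (f z) S else 0)"
    unfolding cmul_eval
  proof (rule sum.cong[OF refl])
    fix i assume "i \<in> {..length w}"
    then have "drop i w = [] \<longleftrightarrow> i = length w" by auto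
    then show "gmul (?F (take i w) z) (scalar_cfun f (drop i w) z) S = (if i = length w then gmul (?F w z) (f z) S else 0)"
      unfolding scalar_cfun_def
      by (cases "i = length w") (simp_all only: simp_thms if_True if_False take_all order_refl gmul_zero zero_fun_apply)
  qed
  also have "\<dots> = gmul (?F w z) (f z) S" by (simp only: sum.delta finite_atMost atMost_iff order_refl if_True)
  also have "gmul ((if b1 then x else 0) + (if b2 then gconst c else 0)) (f z) =
      (if b1 then gmul x (f z) else 0) + (if b2 then gscale c (f z) else 0)" for b1 b2 x
    by (cases b1; cases b2) (simp_all only: if_True if_False gmul_add_left gmul_const[OF assms] gmul_zero)

  from this[of "length w = a \<and> set w \<subseteq> gens n" "word_mul (fst z) w (gconst 1)" "w = []"]
  have "gmul (?F w z) (f z) = (if length w = a \<and> set w \<subseteq> gens n then word_mul (fst z) w (f z) else 0) +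
      (if w = [] then gscale c (f z) else 0)"
    by (simp only: dirac_symbol_pow_def word_mul_append_one[OF assms])
  finally show "cmul ?F (scalar_cfun f) w z S = ((if length w = a \<and> set w \<subseteq> gens n then word_mul (fst z) w (f z) else 0) +
      (if w = [] then gscale c (f z) else 0)) S" .
qed

theorem mainTheorem4:
  fixes n j k :: nat and H :: "real^'m::finite \<Rightarrow> grass"
  assumes "spherical_harmonic n k H"
  shows "eq_on_supersphere n
    (radon n (psi n j H))
    (scalar_cfun (\<lambda>(\<omega>, p) S.
       of_real ((-1) ^ j * (2 * pi) powr ((of_int (superdim TYPE('m) n) - 1) / 2)
         * hermite (2*j + k) p * exp (- (p\<^sup>2) / 2)) * H \<omega> S))"
proof -
  have harm: "harmonic n k H" by (rule spherical_harmonic_harmonic[OF assms])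
  note sp = harmonicD(1)[OF harm]
  let ?t = "2*j + k"
  let ?M = "real_of_int (superdim TYPE('m) n)"
  define D where "D = complex_of_real ((2 * pi) powr (?M / 2 - 1)) * (- \<i>) ^ ?t"
  define Z where "Z = radon_rep n ?t H"
  define Q where "Q = radon_quotient n ?t H"
  define Y :: "('m, (real^'m) \<times> real) cfun" where
    "Y = (\<lambda>w z. dirac_symbol_pow n (2*j) w z + (if w = [] then gconst (- ((-1) ^ j)) else 0))"
  define N :: "('m, (real^'m) \<times> real) cfun" where "N = scalar_cfun (\<lambda>(\<omega>, p). super_square n \<omega> + gconst 1)"
  \<comment> \<open>With c the moment at \<open>v = 1\<close>: D X^(2j) Z - D (-1)^j c H = D (X^(2j)
    - (-1)^j) Z + D (-1)^j (Z - c H). The first summand is a multiple of \<open>Y\<close>, the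
    second a multiple of \<open>N\<close> with quotient \<open>Q\<close>.\<close>
  define K where "K = (\<lambda>w z. gscale D (cmul Y (scalar_cfun Z) w z) + gscale (D * (-1) ^ j) (cmul N (scalar_cfun Q) w z))"
  have "K \<in> sphere_ideal n"
    unfolding K_def Y_def N_def Z_def Q_def
    by (intro ideal_add ideal_scale sphere_ideal.right symbol_pow_ideal sphere_ideal.sphere
        smooth_cfun_radon_rep[OF sp] smooth_cfun_radon_quotient[OF sp])
  moreover have "radon n (psi n j H) w z - scalar_cfun (\<lambda>(\<omega>, p) S.
       of_real ((-1) ^ j * (2 * pi) powr ((?M - 1) / 2) * hermite ?t p * exp (- (p\<^sup>2) / 2)) * H \<omega> S) w z = K w z"
    if "z \<in> radon_domain" for w z
  proof -
    obtain \<omega> p where z: "z = (\<omega>, p)" by (cases z)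
    with that have nz: "\<omega> \<noteq> 0" by (simp add: radon_domain_def)
    have finZ: "gfin (Z z)" unfolding Z_def radon_rep_def by (auto simp: gfin_def sum_fun_eval gscale_eval gmul_infinite)
    let ?W = "if length w = 2*j \<and> set w \<subseteq> gens n then word_mul \<omega> w (Z z) else 0"
    have KY: "cmul Y (scalar_cfun Z) w z = ?W + (if w = [] then gscale (- ((-1) ^ j)) (Z z) else 0)"
      unfolding Y_def cmul_scalar_right[of Z z, OF finZ] by (simp only: z fst_conv)
    have KN: "cmul N (scalar_cfun Q) w z =
        (if w = [] then Z z - gscale (gauss_moment ?t 1 p) (H \<omega>) else 0)"
    proof (cases "w = []")
      case True
      have "cmul N (scalar_cfun Q) w z = gmul (super_square n \<omega> + gconst 1) (Q z)"
        unfolding N_def cmul_scalar_left by (simp add: z True scalar_cfun_def)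
      also have "\<dots> = Z z - gscale (gauss_moment ?t 1 p) (H \<omega>)"
        unfolding Z_def Q_def z by (rule radon_rep_division[OF sp nz, symmetric])
      finally show ?thesis using True by (simp only: simp_thms if_True)
    next
      case False
      then show ?thesis
        unfolding N_def cmul_scalar_left scalar_cfun_nonempty[OF False] by (simp only: zero_fun_apply gmul_zero if_False)
    qed
    have R: "radon n (psi n j H) w z = gscale D ?W"
    proof
      fix S
      have if_scale: "(if b then D * x S else 0) = gscale D (if b then x else 0) S" for b and x :: grass
        by (cases b) (simp_all add: gscale_eval)
      show "radon n (psi n j H) w z S = gscale D ?W S"
        unfolding z radon_psi[OF harm nz] D_def[symmetric] Z_def by (rule if_scale)
    qed
    \<comment> \<open>The second factor comes from \<open>hermite_gauss_moment\<close>.\<close>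
    have pow: "(2 * pi) powr (?M / 2 - 1) * sqrt (2 * pi) = (2 * pi) powr ((?M - 1) / 2)"
    proof -
      have "sqrt (2 * pi) = (2 * pi) powr (1 / 2)" by (simp add: powr_half_sqrt)
      then show ?thesis by (simp only: powr_add[symmetric]) (simp add: field_simps)
    qed
    \<comment> \<open>The phase of the Fourier transform against that of the moments.\<close>
    have unit: "(- \<i>) ^ ?t * \<i> ^ ?t = 1" by (simp add: power_mult_distrib[symmetric])
    have "a * u * (b * v * c) = (a * b) * (u * v) * c" for a b c u v :: complex by (simp only: mult_ac)
    then have const: "D * gauss_moment ?t 1 p =
        of_real ((2 * pi) powr ((?M - 1) / 2) * (hermite ?t p * exp (- (p\<^sup>2) / 2)))"
      unfolding D_def hermite_gauss_moment by (simp only: unit of_real_mult[symmetric] pow mult_1_right)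
    have G: "scalar_cfun (\<lambda>(\<omega>, p) S.
        of_real ((-1) ^ j * (2 * pi) powr ((?M - 1) / 2) * hermite ?t p * exp (- (p\<^sup>2) / 2)) * H \<omega> S) w z =
        (if w = [] then gscale (D * (-1) ^ j * gauss_moment ?t 1 p) (H \<omega>) else 0)"
    proof -
      have "D * (-1) ^ j * gauss_moment ?t 1 p = (-1) ^ j * (D * gauss_moment ?t 1 p)" by simp
      then have "of_real ((-1) ^ j * (2 * pi) powr ((?M - 1) / 2) * hermite ?t p * exp (- (p\<^sup>2) / 2)) =
          D * (-1) ^ j * gauss_moment ?t 1 p"
        unfolding const by simp
      then show ?thesis
        unfolding scalar_cfun_def gscale_def z by (cases "w = []") (simp_all only: simp_thms if_True if_False zero_fun_apply prod.case)
    qed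
    have "gscale D W - (if b then gscale (D * s * c) h else 0) =
        gscale D (W + (if b then gscale (- s) x else 0)) + gscale (D * s) (if b then x - gscale c h else 0)" for W h x b s c
      by (cases b) (auto simp: gscale_def fun_eq_iff algebra_simps)
    then show ?thesis unfolding K_def KY KN R G .
  qed
  ultimately show ?thesis unfolding eq_on_supersphere_def by blast
qed

end
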